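(* Let $(X,\rho,\mu)$ be a space of homogeneous type, let $T$ be a Calderón–Zygmund operator on $X$ and let $1<p<\infty$, $p'=p/(p-1)$. Then there is a constant $C$, depending only on $(X,\rho,\mu)$ and on $T$, such that for all $f$: if $w\in A_\infty$, $$\|Tf\|_{L^p(w)}\le C\,p\,p'\,[w]_{A_\infty}^{1/p'}\,\|f\|_{L^p(Mw)},$$ and if $w\in A_1$, $$\|Tf\|_{L^p(w)}\le C\,p\,p'\,[w]_{A_\infty}^{1/p'}\,[w]_{A_1}^{1/p}\,\|f\|_{L^p(w)}.$$
   Context: Space of homogeneous type: a triple $(X,\rho,\mu)$ where $\rho$ is a quasimetric ($\rho(x,y)=0$ iff $x=y$; symmetric; $\rho(x,z)\le\kappa(\rho(x,y)+\rho(y,z))$) and $\mu$ is a positive doubling measure: $0<\mu(B(x_0,2r))\le D_\mu\,\mu(B(x_0,r))<\infty$. Dyadic cubes: a dyadic decomposition of $X$ is a family $\mathcal D=\bigcup_{k\in\mathbb Z}\mathcal D_k$ of sets with points $x_c(Q)$, $Q\in\mathcal D$, and constants $\delta>1$, $0<C_0<\infty$, $0<\varepsilon<1$ such that: $X=\bigcup_{Q\in\mathcal D_k}Q$ for each $k$; two cubes that intersect are nested; every $Q\in\mathcal D_k$ has at least one child in $\mathcal D_{k-1}$ contained in $Q$ and exactly one parent in $\mathcal D_{k+1}$ containing $Q$; $\mu(Q_2)\ge\varepsilon\mu(Q_1)$ if $Q_2$ is a child of $Q_1$; $B(x_c(Q),\delta^k)\subset Q\subset B(x_c(Q),C_0\delta^k)$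 for $Q\in\mathcal D_k$. Fix finitely many dyadic decompositions (Hytönen–Kairema adjacent systems), with common constants depending only on $X$, such that every ball is contained in a cube, of one of them, of comparable measure. "Cube" means a member of one of these decompositions. $Mf(x)=\sup_{Q\ni x}\frac1{\mu(Q)}\int_Q|f|\,d\mu$, sup over cubes (comparable to the maximal operator over balls). A weight is a locally integrable function with values in $(0,\infty)$ a.e.; $w(Q)=\int_Q w\,d\mu$; $\|f\|_{L^p(v)}=(\int_X|f|^pv\,d\mu)^{1/p}$. $[w]_{A_1}=\sup_Q\left(\frac1{\mu(Q)}\int_Q w\,d\mu\right)\operatorname{ess\,sup}_Q w^{-1}$ and $[w]_{A_\infty}=\sup_Q\frac1{w(Q)}\int_Q M(w\chi_Q)\,d\mu$ (sup over cubes); $w\in A_1$, $w\in A_\infty$ mean that the respective constant is finite. Calderón–Zygmund kernel: $K:X\times X\setminus\{x=y\}\to\mathbb R$ such that for some $\eta>0$, $C_K<\infty$ and all $x_0\ne y$, $|K(x_0,y)|\le \frac{C_K}{\mu(B(x_0,\rho(x_0,y)))}$, and whenever $\rho(x_0,x)\le\eta\rho(x_0,y)$, both $|K(x,y)-K(x_0,y)|$ and $|K(y,x)-K(y,x_0)|$ are at most $\left(\frac{\rho(x,x_0)}{\rho(x_0,y)}\right)^{\eta}\frac1{\mu(B(x_0,\rho(x_0,y)))}$. A Calderón–Zygmund operator is a linear operator $T$ bounded on $L^2(X,\mu)$ with $Tf(x)=\int_X K(x,y)f(y)\,d\mu(y)$ for $x$ outside the support of $f$. Inequalities are understood for $f\in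 L^2(X,\mu)$, where $Tf$ is defined. *)

theory Defs
  imports "HOL-Probability.Essential_Supremum"
begin

section \<open>Spaces of homogeneous type\<close>

text \<open>A space \<open>(X, \<rho>, \<mu>)\<close> is given by a measure \<open>M\<close>, with \<open>X = space M\<close> and \<open>\<mu> = emeasure M\<close>, and
  a real function \<open>\<rho>\<close> whose values only matter on \<open>X \<times> X\<close>.\<close>

definition quasimetric_on :: "'a set \<Rightarrow> ('a \<Rightarrow> 'a \<Rightarrow> real) \<Rightarrow> bool" where
  "quasimetric_on X \<rho> \<longleftrightarrow>
     (\<forall>x\<in>X. \<forall>y\<in>X. 0 \<le> \<rho> x y \<and> (\<rho> x y = 0 \<longleftrightarrow> x = y) \<and> \<rho> x y = \<rho> y x) \<and>
     (\<exists>\<kappa>. \<forall>x\<in>X. \<forall>y\<in>X. \<forall>z\<in>X. \<rho> x z \<le> \<kappa> * (\<rho> x y + \<rho> y z))"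

definition qball :: "'a measure \<Rightarrow> ('a \<Rightarrow> 'a \<Rightarrow> real) \<Rightarrow> 'a \<Rightarrow> real \<Rightarrow> 'a set" where
  "qball M \<rho> x r = {y \<in> space M. \<rho> x y < r}"

definition qopen :: "'a measure \<Rightarrow> ('a \<Rightarrow> 'a \<Rightarrow> real) \<Rightarrow> 'a set \<Rightarrow> bool" where
  "qopen M \<rho> U \<longleftrightarrow> U \<subseteq> space M \<and> (\<forall>x\<in>U. \<exists>r>0. qball M \<rho> x r \<subseteq> U)"

text \<open>\<open>\<mu>\<close> is a Borel measure for the topology of \<open>\<rho>\<close>, or an extension of one by null sets (so \<open>M\<close> may
  be completed). Quasimetric balls need not be Borel, so their measurability is a separate
  requirement.\<close>

definition borel_measure_for :: "'a measure \<Rightarrow> ('a \<Rightarrow> 'a \<Rightarrow> real) \<Rightarrow> bool" where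
  "borel_measure_for M \<rho> \<longleftrightarrow>
     {U. qopen M \<rho> U} \<subseteq> sets M \<and>
     (\<forall>x\<in>space M. \<forall>r. qball M \<rho> x r \<in> sets M) \<and>
     (\<forall>A\<in>sets M. \<exists>B\<in>sigma_sets (space M) {U. qopen M \<rho> U}.
        emeasure M ((A - B) \<union> (B - A)) = 0)"

definition doubling :: "'a measure \<Rightarrow> ('a \<Rightarrow> 'a \<Rightarrow> real) \<Rightarrow> bool" where
  "doubling M \<rho> \<longleftrightarrow> (\<exists>D::real. \<forall>x\<in>space M. \<forall>r>0.
     0 < emeasure M (qball M \<rho> x (2 * r)) \<and>
     emeasure M (qball M \<rho> x (2 * r)) \<le> ennreal D * emeasure M (qball M \<rho> x r) \<and>
     ennreal D * emeasure M (qball M \<rho> x r) < \<infinity>)"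

definition homogeneous_type :: "'a measure \<Rightarrow> ('a \<Rightarrow> 'a \<Rightarrow> real) \<Rightarrow> bool" where
  "homogeneous_type M \<rho> \<longleftrightarrow>
     quasimetric_on (space M) \<rho> \<and> borel_measure_for M \<rho> \<and> doubling M \<rho>"

section \<open>Dyadic cubes\<close>

text \<open>\<open>\<D> k\<close> is the set of cubes of generation \<open>k\<close>. The same set may be a cube of several generations,
  and its centre \<open>x\<^sub>c(Q)\<close> may then depend on the generation.\<close>

definition dyadic_decomposition ::
    "'a measure \<Rightarrow> ('a \<Rightarrow> 'a \<Rightarrow> real) \<Rightarrow> real \<Rightarrow> real \<Rightarrow> real \<Rightarrow> (int \<Rightarrow> 'a set set) \<Rightarrow> bool" where
  "dyadic_decomposition M \<rho> \<delta> C\<^sub>0 \<epsilon> \<D> \<longleftrightarrow>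
     1 < \<delta> \<and> 0 < C\<^sub>0 \<and> 0 < \<epsilon> \<and> \<epsilon> < 1 \<and>
     (\<forall>k. \<D> k \<subseteq> sets M) \<and>
     (\<forall>k. \<Union>(\<D> k) = space M) \<and>
     (\<forall>Q\<in>(\<Union>k. \<D> k). \<forall>R\<in>(\<Union>k. \<D> k). Q \<inter> R \<noteq> {} \<longrightarrow> Q \<subseteq> R \<or> R \<subseteq> Q) \<and>
     (\<forall>k. \<forall>Q\<in>\<D> k. \<exists>R\<in>\<D> (k - 1). R \<subseteq> Q) \<and>
     (\<forall>k. \<forall>Q\<in>\<D> k. \<exists>!R. R \<in> \<D> (k + 1) \<and> Q \<subseteq> R) \<and>
     (\<forall>k. \<forall>Q\<in>\<D> k. \<forall>R\<in>\<D> (k - 1). R \<subseteq> Q \<longrightarrow> emeasure M R \<ge> ennreal \<epsilon> * emeasure M Q) \<and>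
     (\<forall>k. \<forall>Q\<in>\<D> k. \<exists>x\<in>space M.
        qball M \<rho> x (\<delta> powi k) \<subseteq> Q \<and> Q \<subseteq> qball M \<rho> x (C\<^sub>0 * \<delta> powi k))"

definition cubes :: "(int \<Rightarrow> 'a set set) set \<Rightarrow> 'a set set" where
  "cubes \<DD> = (\<Union>\<D>\<in>\<DD>. \<Union>k. \<D> k)"

text \<open>The number \<open>N\<close> of decompositions and the constant \<open>A\<close> in the comparability of balls and cubes
  are parameters, like the common constants \<open>\<delta>\<close>, \<open>C\<^sub>0\<close> and \<open>\<epsilon>\<close>, so that an estimate can be stated
  uniformly in the choice of the decompositions.\<close>

definition adjacent_dyadic_systems ::
    "'a measure \<Rightarrow> ('a \<Rightarrow> 'a \<Rightarrow> real) \<Rightarrow> nat \<Rightarrow> real \<Rightarrow> real \<Rightarrow> real \<Rightarrow> real \<Rightarrow>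
      (int \<Rightarrow> 'a set set) set \<Rightarrow> bool" where
  "adjacent_dyadic_systems M \<rho> N \<delta> C\<^sub>0 \<epsilon> A \<DD> \<longleftrightarrow>
     finite \<DD> \<and> card \<DD> = N \<and>
     (\<forall>\<D>\<in>\<DD>. dyadic_decomposition M \<rho> \<delta> C\<^sub>0 \<epsilon> \<D>) \<and>
     (\<forall>x\<in>space M. \<forall>r>0. \<exists>Q\<in>cubes \<DD>. qball M \<rho> x r \<subseteq> Q \<and>
        emeasure M Q \<le> ennreal A * emeasure M (qball M \<rho> x r))"

section \<open>The maximal operator and weights\<close>

definition maximal ::
    "'a measure \<Rightarrow> (int \<Rightarrow> 'a set set) set \<Rightarrow> ('a \<Rightarrow> real) \<Rightarrow> 'a \<Rightarrow> ennreal" where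
  "maximal M \<DD> f x =
     (SUP Q\<in>{Q \<in> cubes \<DD>. x \<in> Q}. (\<integral>\<^sup>+y\<in>Q. ennreal \<bar>f y\<bar> \<partial>M) / emeasure M Q)"

text \<open>Local integrability means integrability on balls.\<close>

definition weight :: "'a measure \<Rightarrow> ('a \<Rightarrow> 'a \<Rightarrow> real) \<Rightarrow> ('a \<Rightarrow> real) \<Rightarrow> bool" where
  "weight M \<rho> w \<longleftrightarrow>
     w \<in> borel_measurable M \<and>
     (\<forall>x\<in>space M. \<forall>r>0. set_integrable M (qball M \<rho> x r) w) \<and>
     (AE x in M. 0 < w x)"

definition A1_const ::
    "'a measure \<Rightarrow> (int \<Rightarrow> 'a set set) set \<Rightarrow> ('a \<Rightarrow> real) \<Rightarrow> ennreal" where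
  "A1_const M \<DD> w =
     (SUP Q\<in>cubes \<DD>. (\<integral>\<^sup>+x\<in>Q. ennreal (w x) \<partial>M) / emeasure M Q *
        esssup (restrict_space M Q) (\<lambda>x. inverse (ennreal (w x))))"

definition Ainf_const ::
    "'a measure \<Rightarrow> (int \<Rightarrow> 'a set set) set \<Rightarrow> ('a \<Rightarrow> real) \<Rightarrow> ennreal" where
  "Ainf_const M \<DD> w =
     (SUP Q\<in>cubes \<DD>. (\<integral>\<^sup>+x\<in>Q. maximal M \<DD> (\<lambda>y. w y * indicator Q y) x \<partial>M) /
        (\<integral>\<^sup>+x\<in>Q. ennreal (w x) \<partial>M))"

definition A1_weight :: "'a measure \<Rightarrow> ('a \<Rightarrow> 'a \<Rightarrow> real) \<Rightarrow> (int \<Rightarrow> 'a set set) set \<Rightarrow>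
    ('a \<Rightarrow> real) \<Rightarrow> bool" where
  "A1_weight M \<rho> \<DD> w \<longleftrightarrow> weight M \<rho> w \<and> A1_const M \<DD> w < \<infinity>"

definition Ainf_weight :: "'a measure \<Rightarrow> ('a \<Rightarrow> 'a \<Rightarrow> real) \<Rightarrow> (int \<Rightarrow> 'a set set) set \<Rightarrow>
    ('a \<Rightarrow> real) \<Rightarrow> bool" where
  "Ainf_weight M \<rho> \<DD> w \<longleftrightarrow> weight M \<rho> w \<and> Ainf_const M \<DD> w < \<infinity>"

text \<open>Power with a positive exponent on \<open>[0, \<infinity>]\<close>.\<close>

definition ennpowr :: "ennreal \<Rightarrow> real \<Rightarrow> ennreal" where
  "ennpowr t a = (if t = \<infinity> then \<infinity> else ennreal (enn2real t powr a))"

text \<open>\<open>\<parallel>f\<parallel>\<^bsub>L\<^sup>p(v)\<^esub>\<close>, infinite if \<open>f \<notin> L\<^sup>p(v)\<close>. The weight \<open>v\<close> may take the value \<open>\<infinity>\<close>, as \<open>Mw\<close> can.\<close>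

definition Lp_norm :: "'a measure \<Rightarrow> real \<Rightarrow> ('a \<Rightarrow> ennreal) \<Rightarrow> ('a \<Rightarrow> real) \<Rightarrow> ennreal" where
  "Lp_norm M p v f = ennpowr (\<integral>\<^sup>+x. ennreal (\<bar>f x\<bar> powr p) * v x \<partial>M) (1 / p)"

section \<open>Calder\'on--Zygmund operators\<close>

text \<open>A kernel is a total function whose values on the diagonal are irrelevant. If \<open>\<eta> \<ge> 1\<close>, the
  condition \<open>\<rho> x\<^sub>0 x \<le> \<eta> * \<rho> x\<^sub>0 y\<close> does not exclude \<open>x = y\<close>, so this is done explicitly.\<close>

definition cz_kernel ::
    "'a measure \<Rightarrow> ('a \<Rightarrow> 'a \<Rightarrow> real) \<Rightarrow> ('a \<Rightarrow> 'a \<Rightarrow> real) \<Rightarrow> bool" where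
  "cz_kernel M \<rho> K \<longleftrightarrow> (\<exists>\<eta> C\<^sub>K. 0 < \<eta> \<and>
     (\<forall>x\<^sub>0\<in>space M. \<forall>y\<in>space M. x\<^sub>0 \<noteq> y \<longrightarrow>
        \<bar>K x\<^sub>0 y\<bar> \<le> C\<^sub>K / measure M (qball M \<rho> x\<^sub>0 (\<rho> x\<^sub>0 y)) \<and>
        (\<forall>x\<in>space M. x \<noteq> y \<and> \<rho> x\<^sub>0 x \<le> \<eta> * \<rho> x\<^sub>0 y \<longrightarrow>
           \<bar>K x y - K x\<^sub>0 y\<bar>
             \<le> (\<rho> x x\<^sub>0 / \<rho> x\<^sub>0 y) powr \<eta> * (1 / measure M (qball M \<rho> x\<^sub>0 (\<rho> x\<^sub>0 y))) \<and>
           \<bar>K y x - K y x\<^sub>0\<bar>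
             \<le> (\<rho> x x\<^sub>0 / \<rho> x\<^sub>0 y) powr \<eta> * (1 / measure M (qball M \<rho> x\<^sub>0 (\<rho> x\<^sub>0 y))))))"

definition in_L2 :: "'a measure \<Rightarrow> ('a \<Rightarrow> real) \<Rightarrow> bool" where
  "in_L2 M f \<longleftrightarrow> f \<in> borel_measurable M \<and> integrable M (\<lambda>x. (f x)\<^sup>2)"

text \<open>The support of an almost everywhere equivalence class.\<close>

definition ess_support ::
    "'a measure \<Rightarrow> ('a \<Rightarrow> 'a \<Rightarrow> real) \<Rightarrow> ('a \<Rightarrow> real) \<Rightarrow> 'a set" where
  "ess_support M \<rho> f =
     {x \<in> space M. \<forall>r>0. \<not> (AE y in M. y \<in> qball M \<rho> x r \<longrightarrow> f y = 0)}"

text \<open>Elements of \<open>L\<^sup>2\<close> are represented by functions. Linearity (almost everywhere) and boundedness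
  together imply that \<open>T\<close> respects almost everywhere equality.\<close>

definition bounded_linear_on_L2 ::
    "'a measure \<Rightarrow> (('a \<Rightarrow> real) \<Rightarrow> 'a \<Rightarrow> real) \<Rightarrow> bool" where
  "bounded_linear_on_L2 M T \<longleftrightarrow>
     (\<forall>f. in_L2 M f \<longrightarrow> in_L2 M (T f)) \<and>
     (\<forall>f g a b. in_L2 M f \<and> in_L2 M g \<longrightarrow>
        (AE x in M. T (\<lambda>y. a * f y + b * g y) x = a * T f x + b * T g x)) \<and>
     (\<exists>B. \<forall>f. in_L2 M f \<longrightarrow> sqrt (\<integral>x. (T f x)\<^sup>2 \<partial>M) \<le> B * sqrt (\<integral>x. (f x)\<^sup>2 \<partial>M))"

definition cz_operator ::
    "'a measure \<Rightarrow> ('a \<Rightarrow> 'a \<Rightarrow> real) \<Rightarrow> (('a \<Rightarrow> real) \<Rightarrow> 'a \<Rightarrow> real) \<Rightarrow> bool" where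
  "cz_operator M \<rho> T \<longleftrightarrow> bounded_linear_on_L2 M T \<and>
     (\<exists>K. cz_kernel M \<rho> K \<and>
       (\<forall>f. in_L2 M f \<longrightarrow>
         (AE x in M. x \<notin> ess_support M \<rho> f \<longrightarrow> T f x = (\<integral>y. K x y * f y \<partial>M))))"

end

theory Submission
  imports Defs
begin

text \<open>Everything reduces to sparse sums. The weak type (1,1) bound for \<open>T\<close> comes from a
  Calderon--Zygmund decomposition inside a cube. With it, a stopping time argument bounds \<open>T(f\<chi>\<^bsub>\<alpha>Q\<^esub>)\<close>
  on a cube \<open>Q\<close> by a multiple of an average of \<open>|f|\<close> over a comparable cube \<open>Q'\<close>, outside disjoint
  subcubes \<open>P\<close> of total measure at most \<open>\<mu>(Q)/2\<close>, and on each \<open>P\<close> by this average plus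
  \<open>|T(f\<chi>\<^bsub>\<alpha>P\<^esub>)|\<close>: the kernel regularity controls the oscillation of the difference on \<open>P\<close> by \<open>Mf\<close>.
  Iterating gives \<open>|T(f\<chi>\<^bsub>\<alpha>Q\<^esub>)| \<le> C F\<close> on \<open>Q\<close>, with \<open>F = \<Sum> \<langle>|f|\<rangle>\<^bsub>P'\<^esub> \<chi>\<^bsub>P\<^esub>\<close> over a sparse family.

  Let \<open>q = p'\<close> and \<open>g = F\<^bsup>p-1\<^esup>\<close>. By Young's inequality, \<open>\<integral> F\<^sup>p w = \<Sum> \<langle>|f|\<rangle> w(P) \<langle>g\<rangle>\<^sup>w\<close> is controlled by
  \<open>\<Sum> \<langle>|f|\<rangle>\<^sup>p w(P)\<close> and \<open>\<Sum> (\<langle>g\<rangle>\<^sup>w)\<^sup>q w(P)\<close>. In the first sum \<open>\<langle>|f|\<rangle> \<langle>w\<rangle>\<^bsup>1/p\<^esup> \<le> \<langle>|f| (Mw)\<^bsup>1/p\<^esup>\<rangle>\<close>, so the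
  maximal inequality without weight gives \<open>\<integral> |f|\<^sup>p Mw\<close>. The second is a Carleson embedding: sparseness yields
  \<open>\<Sum>\<^bsub>P \<subseteq> R\<^esub> w(P) \<le> 2 \<integral>\<^sub>R M(w\<chi>\<^sub>R) \<le> 2 [w] w(R)\<close>, where \<open>[w]\<close> is the \<open>A\<^sub>\<infinity>\<close> constant. No reverse Hoelder
  inequality is needed.\<close>

section \<open>Nested families of sets\<close>

text \<open>Two features of the setting shape the proof. Balls need not be open, so the bound h <= t
  almost everywhere off the stopping cubes is not obtained from continuous functions: measurable
  sets are approximated from outside by unions of cubes, which uses that the measure is Borel up to
  null sets. Moreover one system need not contain a comparable cube around a dilated cube. The
  stopping cubes P live in one system, the cubes P' carrying the averages in any of them; so the
  weak type (1,1) bound is needed in all systems, and their number N enters the constant.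

  The factor p p' dominates two interpolation losses: p^(1/p') from the Carleson embedding and
  p'^(1/p) from the maximal inequality. Young's inequality is scaled so that the second sum becomes
  at most 1/p' times the integral to be estimated, which is then absorbed. This is legitimate
  because the family is finite at first, and so is the integral. The infinite family and the whole
  space are reached at the end, by monotone convergence and by Fatou's lemma.\<close>

definition nested :: "'a set set \<Rightarrow> bool" where
  "nested \<Q> \<longleftrightarrow> (\<forall>Q\<in>\<Q>. \<forall>R\<in>\<Q>. Q \<inter> R \<noteq> {} \<longrightarrow> Q \<subseteq> R \<or> R \<subseteq> Q)"

lemma nested_subset: "nested \<Q> \<Longrightarrow> \<R> \<subseteq> \<Q> \<Longrightarrow> nested \<R>"
  unfolding nested_def by blast

lemma nestedD: "nested \<Q> \<Longrightarrow> Q \<in> \<Q> \<Longrightarrow> R \<in> \<Q> \<Longrightarrow> x \<in> Q \<Longrightarrow> x \<in> R \<Longrightarrow> Q \<subseteq> R \<or> R \<subseteq> Q"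
  unfolding nested_def by blast

lemma nested_maximal_disjoint:
  assumes "nested \<Q>"
  shows "disjoint {Q \<in> \<Q>. \<forall>R\<in>\<Q>. Q \<subseteq> R \<longrightarrow> Q = R}"
proof (rule disjointI)
  fix P Q assume *: "P \<in> {Q \<in> \<Q>. \<forall>R\<in>\<Q>. Q \<subseteq> R \<longrightarrow> Q = R}"
    "Q \<in> {Q \<in> \<Q>. \<forall>R\<in>\<Q>. Q \<subseteq> R \<longrightarrow> Q = R}" "P \<noteq> Q"
  show "P \<inter> Q = {}"
  proof (rule ccontr)
    assume "P \<inter> Q \<noteq> {}"
    with * nestedD[OF assms, of P Q] have "P \<subseteq> Q \<or> Q \<subseteq> P" by auto
    with * show False by auto
  qed
qed

lemma nested_finite_maximal:
  assumes "finite \<Q>" "nested \<Q>"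
  obtains \<M> where "\<M> \<subseteq> \<Q>" "disjoint \<M>" "\<And>Q. Q \<in> \<Q> \<Longrightarrow> \<exists>R\<in>\<M>. Q \<subseteq> R"
proof
  let ?M = "{Q \<in> \<Q>. \<forall>R\<in>\<Q>. Q \<subseteq> R \<longrightarrow> Q = R}"
  show "?M \<subseteq> \<Q>" by blast
  show "disjoint ?M" by (rule nested_maximal_disjoint[OF assms(2)])
  show "\<exists>R\<in>?M. Q \<subseteq> R" if "Q \<in> \<Q>" for Q
    using finite_has_maximal2[OF assms(1) that] by blast
qed

lemma emeasure_Union_disjoint_finite:
  assumes "finite \<M>" "disjoint \<M>" "\<M> \<subseteq> sets M"
  shows "emeasure M (\<Union>\<M>) = (\<Sum>Q\<in>\<M>. emeasure M Q)"
  using sum_emeasure[of "\<lambda>Q. Q" \<M> M] assms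
  by (auto simp: disjoint_family_on_def disjoint_def)

lemma emeasure_nested_finite_le:
  assumes "finite \<Q>" "nested \<Q>" "\<Q> \<subseteq> sets M" "\<Q> \<subseteq> sets N"
    and le: "\<And>Q. Q \<in> \<Q> \<Longrightarrow> emeasure M Q \<le> emeasure N Q"
  shows "emeasure M (\<Union>\<Q>) \<le> emeasure N (\<Union>\<Q>)"
proof -
  obtain \<M> where M: "\<M> \<subseteq> \<Q>" "disjoint \<M>" "\<And>Q. Q \<in> \<Q> \<Longrightarrow> \<exists>R\<in>\<M>. Q \<subseteq> R"
    using nested_finite_maximal assms(1,2) by blast
  have U: "\<Union>\<Q> = \<Union>\<M>" using M by blast
  have fin: "finite \<M>" using M(1) assms(1) finite_subset by blast
  show ?thesis unfolding U
    using M assms by (subst (1 2) emeasure_Union_disjoint_finite) (auto intro!: sum_mono fin le)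
qed

text \<open>Stands in for a covering lemma, without loss of a constant: the maximal sets of a finite
  nested family are disjoint and have the same union. An infinite family may lack maximal members,
  hence the exhaustion by finite subfamilies. The measures compared later are
  \<open>density M h\<close> and multiples of \<open>M\<close>.\<close>

lemma emeasure_nested_le:
  assumes "countable \<Q>" "nested \<Q>" "\<Q> \<subseteq> sets M" "\<Q> \<subseteq> sets N"
    and le: "\<And>Q. Q \<in> \<Q> \<Longrightarrow> emeasure M Q \<le> emeasure N Q"
  shows "emeasure M (\<Union>\<Q>) \<le> emeasure N (\<Union>\<Q>)"
proof (cases "\<Q> = {}")
  case False
  define q where "q = from_nat_into \<Q>"
  have rq: "range q = \<Q>" unfolding q_def using False assms(1) by (rule range_from_nat_into)
  define A where "A n = \<Union>(q ` {..n})" for n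
  have U: "\<Union>\<Q> = (\<Union>n. A n)" unfolding A_def rq[symmetric] by blast
  have inc: "incseq A" unfolding A_def incseq_def by force
  have qs: "q i \<in> sets M" "q i \<in> sets N" for i using rq assms(3,4) by blast+
  have A: "A n \<in> sets M" "A n \<in> sets N" for n unfolding A_def using qs by auto
  have "emeasure M (A n) \<le> emeasure N (A n)" for n
    unfolding A_def using rq assms
    by (intro emeasure_nested_finite_le nested_subset[OF assms(2)]) auto
  moreover have "emeasure N (A n) \<le> emeasure N (\<Union>\<Q>)" for n
    unfolding U using A by (intro emeasure_mono) auto
  ultimately have "emeasure M (A n) \<le> emeasure N (\<Union>\<Q>)" for n
    using order_trans by blast
  moreover have "emeasure M (\<Union>\<Q>) = (SUP n. emeasure M (A n))"
    unfolding U using A inc by (intro SUP_emeasure_incseq[symmetric]) auto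
  ultimately show ?thesis by (simp add: SUP_le_iff)
qed auto

section \<open>Spaces of homogeneous type\<close>

locale hom_space =
  fixes M :: "'a measure" and \<rho> :: "'a \<Rightarrow> 'a \<Rightarrow> real" and \<kappa> D :: real
  assumes rho_nonneg: "x \<in> space M \<Longrightarrow> y \<in> space M \<Longrightarrow> 0 \<le> \<rho> x y"
    and rho_eq_0_iff: "x \<in> space M \<Longrightarrow> y \<in> space M \<Longrightarrow> \<rho> x y = 0 \<longleftrightarrow> x = y"
    and rho_sym: "x \<in> space M \<Longrightarrow> y \<in> space M \<Longrightarrow> \<rho> x y = \<rho> y x"
    and rho_triangle: "x \<in> space M \<Longrightarrow> y \<in> space M \<Longrightarrow> z \<in> space M \<Longrightarrow> \<rho> x z \<le> \<kappa> * (\<rho> x y + \<rho> y z)"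
    and kappa_ge_1: "1 \<le> \<kappa>" and D_ge_1: "1 \<le> D"
    and borel: "borel_measure_for M \<rho>"
    and ball_pos: "x \<in> space M \<Longrightarrow> 0 < r \<Longrightarrow> 0 < emeasure M (qball M \<rho> x r)"
    and ball_finite: "x \<in> space M \<Longrightarrow> 0 < r \<Longrightarrow> emeasure M (qball M \<rho> x r) < \<infinity>"
    and ball_doubling: "x \<in> space M \<Longrightarrow> 0 < r \<Longrightarrow>
      emeasure M (qball M \<rho> x (2 * r)) \<le> ennreal D * emeasure M (qball M \<rho> x r)"
begin

abbreviation ball where "ball \<equiv> qball M \<rho>"

definition V :: "'a \<Rightarrow> real \<Rightarrow> real" where "V x r = measure M (ball x r)"

text \<open>The price of dilating a ball by the factor \<open>s\<close>: one factor \<open>D\<close>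
  per doubling. The truncation by \<open>nat\<close> gives 1 when 0 < s <= 1.\<close>

definition dbl :: "real \<Rightarrow> real" where "dbl s = D ^ nat \<lceil>log 2 s\<rceil>"

lemma dbl_ge_1: "1 \<le> dbl s"
  unfolding dbl_def using D_ge_1 by (rule one_le_power)

lemma dbl_pos: "0 < dbl s"
  using dbl_ge_1[of s] by linarith

lemma ball_sets [measurable]: "x \<in> space M \<Longrightarrow> ball x r \<in> sets M"
  using borel unfolding borel_measure_for_def by blast

lemma qopen_sets: "qopen M \<rho> U \<Longrightarrow> U \<in> sets M"
  using borel unfolding borel_measure_for_def by blast

lemma ball_subset_space: "ball x r \<subseteq> space M"
  unfolding qball_def by blast

lemma ball_mono: "r \<le> s \<Longrightarrow> ball x r \<subseteq> ball x s"
  unfolding qball_def by auto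

lemma mem_ball: "y \<in> ball x r \<longleftrightarrow> y \<in> space M \<and> \<rho> x y < r"
  unfolding qball_def by simp

lemma center_mem_ball: "x \<in> space M \<Longrightarrow> 0 < r \<Longrightarrow> x \<in> ball x r"
  using rho_eq_0_iff[of x x] by (simp add: mem_ball)

lemma emeasure_ball: "x \<in> space M \<Longrightarrow> 0 < r \<Longrightarrow> emeasure M (ball x r) = ennreal (V x r)"
  unfolding V_def by (intro emeasure_eq_ennreal_measure) (use ball_finite[of x r] in auto)

lemma V_pos: "x \<in> space M \<Longrightarrow> 0 < r \<Longrightarrow> 0 < V x r"
  using ball_pos[of x r] by (simp add: emeasure_ball)

lemma V_mono: "x \<in> space M \<Longrightarrow> 0 < r \<Longrightarrow> r \<le> s \<Longrightarrow> V x r \<le> V x s"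
  unfolding V_def using ball_finite[of x s]
  by (intro measure_mono_fmeasurable ball_mono) (auto simp: fmeasurable_def)

lemma V_double: "x \<in> space M \<Longrightarrow> 0 < r \<Longrightarrow> V x (2 * r) \<le> D * V x r"
  using ball_doubling[of x r] D_ge_1 V_pos[of x r] by (simp add: emeasure_ball ennreal_mult'[symmetric] ennreal_le_iff)

lemma V_pow2: "x \<in> space M \<Longrightarrow> 0 < r \<Longrightarrow> V x (2 ^ n * r) \<le> D ^ n * V x r"
proof (induction n)
  case (Suc n)
  have "V x (2 ^ Suc n * r) \<le> D * V x (2 ^ n * r)"
    using V_double[of x "2 ^ n * r"] Suc.prems by (simp add: ac_simps)
  also have "\<dots> \<le> D * (D ^ n * V x r)" using Suc D_ge_1 by (intro mult_left_mono) auto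
  finally show ?case by (simp add: ac_simps)
qed simp

lemma V_scale:
  assumes "x \<in> space M" "0 < r" "0 < s"
  shows "V x (s * r) \<le> dbl s * V x r"
proof -
  have "log 2 s \<le> of_int \<lceil>log 2 s\<rceil>" by (rule le_of_int_ceiling)
  also have "\<dots> \<le> real (nat \<lceil>log 2 s\<rceil>)" by linarith
  finally have "s \<le> 2 ^ nat \<lceil>log 2 s\<rceil>"
    using assms(3) by (simp add: log_le_iff powr_realpow)
  hence "V x (s * r) \<le> V x (2 ^ nat \<lceil>log 2 s\<rceil> * r)"
    using assms by (intro V_mono mult_right_mono) auto
  also have "\<dots> \<le> dbl s * V x r" unfolding dbl_def by (rule V_pow2[OF assms(1,2)])
  finally show ?thesis .
qed

lemma ball_subset_ball:
  assumes "x \<in> space M" "y \<in> space M" "\<kappa> * (\<rho> x y + r) \<le> s"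
  shows "ball y r \<subseteq> ball x s"
proof
  fix z assume z: "z \<in> ball y r"
  hence zz: "z \<in> space M" "\<rho> y z < r" by (auto simp: mem_ball)
  have "\<rho> x z \<le> \<kappa> * (\<rho> x y + \<rho> y z)" using assms zz by (intro rho_triangle)
  also have "\<dots> < \<kappa> * (\<rho> x y + r)" using zz kappa_ge_1 by (intro mult_strict_left_mono) auto
  finally show "z \<in> ball x s" using assms(3) zz by (simp add: mem_ball)
qed

lemma rho_measurable [measurable]: "x \<in> space M \<Longrightarrow> \<rho> x \<in> borel_measurable M"
  unfolding borel_measurable_iff_less
  using ball_sets[of x] by (simp add: qball_def)

text \<open>Balls of finite radius about one point exhaust the space. This gives the countability of
  the cubes and Fubini's theorem in the layer cake argument.\<close>

lemma sigma_finite: "sigma_finite_measure M"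
proof (cases "space M = {}")
  case True
  thus ?thesis by (intro sigma_finite_measure.intro exI[of _ "{}"]) auto
next
  case False
  then obtain x where x: "x \<in> space M" by blast
  show ?thesis
  proof (intro sigma_finite_measure.intro exI[of _ "range (\<lambda>n::nat. ball x (real (Suc n)))"] conjI ballI)
    show "\<Union> (range (\<lambda>n. ball x (real (Suc n)))) = space M"
    proof (intro equalityI subsetI)
      fix y assume y: "y \<in> space M"
      obtain n where "\<rho> x y < real n" using reals_Archimedean2 by blast
      thus "y \<in> \<Union> (range (\<lambda>n. ball x (real (Suc n))))" using y by (auto simp: mem_ball intro!: exI[of _ n])
    qed (auto simp: mem_ball)
  next
    fix a assume "a \<in> range (\<lambda>n::nat. ball x (real (Suc n)))"
    then obtain n where "a = ball x (real (Suc n))" by blast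
    thus "emeasure M a \<noteq> \<infinity>" using ball_finite[OF x, of "real (Suc n)"] by simp
  qed (use x in auto)
qed

end

text \<open>Both constants are raised to at least 1, so that multiplication by them never decreases
  a nonnegative quantity.\<close>

lemma homogeneous_type_hom_space:
  assumes "homogeneous_type M \<rho>"
  obtains \<kappa> D where "hom_space M \<rho> \<kappa> D"
proof -
  from assms have q: "quasimetric_on (space M) \<rho>" and b: "borel_measure_for M \<rho>" and d: "doubling M \<rho>"
    unfolding homogeneous_type_def by auto
  from q obtain k where k: "\<forall>x\<in>space M. \<forall>y\<in>space M. \<forall>z\<in>space M. \<rho> x z \<le> k * (\<rho> x y + \<rho> y z)"
    unfolding quasimetric_on_def by (elim conjE exE)
  have q': "\<forall>x\<in>space M. \<forall>y\<in>space M. 0 \<le> \<rho> x y \<and> (\<rho> x y = 0 \<longleftrightarrow> x = y) \<and> \<rho> x y = \<rho> y x"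
    using q unfolding quasimetric_on_def by (elim conjE)
  have nn: "0 \<le> \<rho> x y" and z: "\<rho> x y = 0 \<longleftrightarrow> x = y" and s: "\<rho> x y = \<rho> y x"
    if "x \<in> space M" "y \<in> space M" for x y
    using bspec[OF bspec[OF q' that(1)] that(2)] by blast+
  from d obtain D where D: "\<And>x r. x \<in> space M \<Longrightarrow> r > 0 \<Longrightarrow>
     0 < emeasure M (qball M \<rho> x (2 * r)) \<and>
     emeasure M (qball M \<rho> x (2 * r)) \<le> ennreal D * emeasure M (qball M \<rho> x r) \<and>
     ennreal D * emeasure M (qball M \<rho> x r) < \<infinity>" unfolding doubling_def by blast
  have "hom_space M \<rho> (max k 1) (max D 1)"
  proof
    fix x y z assume *: "x \<in> space M" "y \<in> space M" "z \<in> space M"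
    have "\<rho> x z \<le> k * (\<rho> x y + \<rho> y z)" using k * by blast
    also have "\<dots> \<le> max k 1 * (\<rho> x y + \<rho> y z)" using nn * by (intro mult_right_mono) auto
    finally show "\<rho> x z \<le> max k 1 * (\<rho> x y + \<rho> y z)" .
  next
    fix x and r :: real assume *: "x \<in> space M" "0 < r"
    \<comment> \<open>Positivity is postulated for the doubled radius, so it is read off at half the
      radius.\<close>
    show "0 < emeasure M (qball M \<rho> x r)" using D[of x "r/2"] * by simp
    show "emeasure M (qball M \<rho> x r) < \<infinity>"
    proof (rule ccontr)
      \<comment> \<open>If the ball had infinite measure, finiteness of the product would force
        \<open>ennreal D = 0\<close>, and then the doubled ball would be null.\<close>
      assume "\<not> ?thesis"
      hence "emeasure M (qball M \<rho> x r) = \<infinity>" by (simp add: less_top[symmetric])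
      with D[OF *] show False by (auto simp: ennreal_mult_top split: if_splits)
    qed
    have "emeasure M (qball M \<rho> x (2 * r)) \<le> ennreal D * emeasure M (qball M \<rho> x r)" using D[OF *] by blast
    also have "\<dots> \<le> ennreal (max D 1) * emeasure M (qball M \<rho> x r)"
      by (intro mult_right_mono ennreal_leI) auto
    finally show "emeasure M (qball M \<rho> x (2 * r)) \<le> ennreal (max D 1) * emeasure M (qball M \<rho> x r)" .
  qed (use nn z s b in auto)
  thus ?thesis using that by blast
qed

section \<open>Dyadic cubes\<close>

locale dyadic_system = hom_space +
  fixes \<delta> C\<^sub>0 \<epsilon> :: real and \<D> :: "int \<Rightarrow> 'a set set"
  assumes dyadic: "dyadic_decomposition M \<rho> \<delta> C\<^sub>0 \<epsilon> \<D>"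
begin

definition "\<U> = (\<Union>k. \<D> k)"

lemma delta_gt_1: "1 < \<delta>" and C0_pos: "0 < C\<^sub>0" and eps_pos: "0 < \<epsilon>" and eps_less_1: "\<epsilon> < 1"
  and gen_sets: "\<forall>k. \<D> k \<subseteq> sets M"
  and Union_gen: "\<forall>k. \<Union>(\<D> k) = space M"
  and gen_nested: "\<forall>Q\<in>(\<Union>k. \<D> k). \<forall>R\<in>(\<Union>k. \<D> k). Q \<inter> R \<noteq> {} \<longrightarrow> Q \<subseteq> R \<or> R \<subseteq> Q"
  and child_ex: "\<forall>k. \<forall>Q\<in>\<D> k. \<exists>R\<in>\<D> (k - 1). R \<subseteq> Q"
  and parent_ex1: "\<forall>k. \<forall>Q\<in>\<D> k. \<exists>!R. R \<in> \<D> (k + 1) \<and> Q \<subseteq> R"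
  and child_measure: "\<forall>k. \<forall>Q\<in>\<D> k. \<forall>R\<in>\<D> (k - 1). R \<subseteq> Q \<longrightarrow> ennreal \<epsilon> * emeasure M Q \<le> emeasure M R"
  and cube_ball: "\<forall>k. \<forall>Q\<in>\<D> k. \<exists>x\<in>space M. ball x (\<delta> powi k) \<subseteq> Q \<and> Q \<subseteq> ball x (C\<^sub>0 * \<delta> powi k)"
  using dyadic unfolding dyadic_decomposition_def by simp_all

lemma gen_in_cubes: "Q \<in> \<D> k \<Longrightarrow> Q \<in> \<U>"
  unfolding \<U>_def by blast

lemma cube_sets [measurable]: "Q \<in> \<U> \<Longrightarrow> Q \<in> sets M"
  using gen_sets unfolding \<U>_def by blast

lemma cube_subset_space: "Q \<in> \<U> \<Longrightarrow> Q \<subseteq> space M"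
  using cube_sets sets.sets_into_space by blast

lemma nested_cubes: "nested \<U>"
  using gen_nested unfolding nested_def \<U>_def .

text \<open>A set may be a cube of several generations; \<open>gen\<close> selects one of them. Strict inclusion of cubes
  forces strict inequality between any of their generations, so the choice is harmless.\<close>

definition gen :: "'a set \<Rightarrow> int" where "gen Q = (SOME k. Q \<in> \<D> k)"

definition rad :: "'a set \<Rightarrow> real" where "rad Q = \<delta> powi gen Q"

definition cen :: "'a set \<Rightarrow> 'a" where
  "cen Q = (SOME x. x \<in> space M \<and> ball x (rad Q) \<subseteq> Q \<and> Q \<subseteq> ball x (C\<^sub>0 * rad Q))"

lemma gen_mem: "Q \<in> \<U> \<Longrightarrow> Q \<in> \<D> (gen Q)"
  unfolding gen_def \<U>_def by (auto intro: someI)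

lemma rad_pos: "0 < rad Q"
  unfolding rad_def using delta_gt_1 by simp

lemma
  assumes "Q \<in> \<U>"
  shows cen_space: "cen Q \<in> space M" and ball_subset_cube: "ball (cen Q) (rad Q) \<subseteq> Q"
    and cube_subset_ball: "Q \<subseteq> ball (cen Q) (C\<^sub>0 * rad Q)"
proof -
  have "\<exists>x. x \<in> space M \<and> ball x (rad Q) \<subseteq> Q \<and> Q \<subseteq> ball x (C\<^sub>0 * rad Q)"
    using bspec[OF spec[OF cube_ball] gen_mem[OF assms]] unfolding rad_def by blast
  from someI_ex[OF this, folded cen_def]
  show "cen Q \<in> space M" "ball (cen Q) (rad Q) \<subseteq> Q" "Q \<subseteq> ball (cen Q) (C\<^sub>0 * rad Q)" by auto
qed

lemma cen_in_cube: "Q \<in> \<U> \<Longrightarrow> cen Q \<in> Q"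
  using ball_subset_cube center_mem_ball[OF cen_space rad_pos] by blast

lemma cube_nonempty: "Q \<in> \<U> \<Longrightarrow> Q \<noteq> {}"
  using cen_in_cube by blast

lemma cube_pos: "Q \<in> \<U> \<Longrightarrow> 0 < emeasure M Q"
  using ball_pos[OF cen_space rad_pos, of Q] emeasure_mono[OF ball_subset_cube cube_sets, of Q] by (auto intro: less_le_trans)

lemma cube_finite: "Q \<in> \<U> \<Longrightarrow> emeasure M Q < \<infinity>"
  using ball_finite[OF cen_space, of Q "C\<^sub>0 * rad Q"] rad_pos[of Q] C0_pos
    emeasure_mono[OF cube_subset_ball ball_sets[OF cen_space], of Q] by (auto intro: le_less_trans)

lemma emeasure_cube: "Q \<in> \<U> \<Longrightarrow> emeasure M Q = ennreal (measure M Q)"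
  using cube_finite[of Q] by (intro emeasure_eq_ennreal_measure) auto

lemma measure_cube_pos: "Q \<in> \<U> \<Longrightarrow> 0 < measure M Q"
  using cube_pos emeasure_cube by (metis ennreal_0 less_irrefl measure_nonneg order_le_less)

lemma V_le_cube: "Q \<in> \<U> \<Longrightarrow> V (cen Q) (rad Q) \<le> measure M Q"
  unfolding V_def using cube_finite[of Q]
  by (intro measure_mono_fmeasurable ball_subset_cube) (auto simp: fmeasurable_def intro: cen_space ball_sets)

text \<open>Disjointness within a generation comes from uniqueness of the parent: if Q is contained
  in R, a child of Q lies in both, so both are its parent.\<close>

lemma same_gen_eq:
  assumes "Q \<in> \<D> k" "R \<in> \<D> k" "Q \<inter> R \<noteq> {}"
  shows "Q = R"
proof -
  have *: "Q = R" if q: "Q \<in> \<D> k" "R \<in> \<D> k" "Q \<subseteq> R" for Q R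
  proof -
    obtain S where S: "S \<in> \<D> (k - 1)" "S \<subseteq> Q" using bspec[OF spec[OF child_ex] q(1)] by auto
    from bspec[OF spec[OF parent_ex1] S(1)] q S show ?thesis by (elim ex1E) (metis diff_add_cancel order_trans)
  qed
  have "Q \<subseteq> R \<or> R \<subseteq> Q" using nested_cubes assms gen_in_cubes unfolding nested_def by blast
  thus ?thesis using * assms by blast
qed

lemma ancestor_ex:
  assumes "Q \<in> \<D> j"
  shows "\<exists>R\<in>\<D> (j + int n). Q \<subseteq> R"
proof (induction n)
  case (Suc n)
  then obtain R where R: "R \<in> \<D> (j + int n)" "Q \<subseteq> R" by blast
  from ex1_implies_ex[OF bspec[OF spec[OF parent_ex1] R(1)]] obtain S
    where "S \<in> \<D> (j + int n + 1)" "R \<subseteq> S" by auto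
  with R show ?case by (intro bexI[of _ S]) (auto simp: algebra_simps)
qed (use assms in auto)

lemma ancestor_le_ex: "Q \<in> \<D> j \<Longrightarrow> j \<le> k \<Longrightarrow> \<exists>R\<in>\<D> k. Q \<subseteq> R"
  using ancestor_ex[of Q j "nat (k - j)"] by simp

lemma gen_less_subset:
  assumes "P \<in> \<D> j" "Q \<in> \<D> k" "P \<inter> Q \<noteq> {}" "j \<le> k"
  shows "P \<subseteq> Q"
proof -
  obtain R where R: "R \<in> \<D> k" "P \<subseteq> R" using ancestor_le_ex assms(1,4) by blast
  hence "R = Q" using assms same_gen_eq[of R k Q] by blast
  thus ?thesis using R by simp
qed

lemma psubset_gen_less:
  assumes "P \<in> \<D> j" "Q \<in> \<D> k" "P \<subset> Q"
  shows "j < k"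
proof (rule ccontr)
  assume "\<not> j < k"
  hence "Q \<subseteq> P" using gen_less_subset[of Q k P j] assms cube_nonempty[OF gen_in_cubes[OF assms(1)]] by auto
  thus False using assms by blast
qed

lemma rad_mono: "P \<in> \<U> \<Longrightarrow> Q \<in> \<U> \<Longrightarrow> P \<subseteq> Q \<Longrightarrow> rad P \<le> rad Q"
  using psubset_gen_less[OF gen_mem gen_mem, of P Q] delta_gt_1 unfolding rad_def
  by (cases "P = Q") (auto intro!: power_int_increasing simp: psubset_eq)

text \<open>Disjoint sets of positive measure in a sigma-finite space. For a piece
  \<open>A i\<close> of finite measure the sums of the measures of the \<open>Q \<inter> A i\<close>
  are bounded, and a summable real family has only countably many nonzero terms.\<close>

lemma countable_gen: "countable (\<D> k)"
proof -
  interpret sf: sigma_finite_measure M by (rule sigma_finite)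
  obtain A :: "nat \<Rightarrow> 'a set" where A: "range A \<subseteq> sets M" "(\<Union>i. A i) = space M" "\<And>i. emeasure M (A i) \<noteq> \<infinity>"
    using sf.sigma_finite by metis
  let ?S = "\<lambda>i. {Q \<in> \<D> k. measure M (Q \<inter> A i) \<noteq> 0}"
  have cnt: "countable (?S i)" for i
  proof -
    have bound: "sum (\<lambda>Q. measure M (Q \<inter> A i)) F \<le> measure M (A i)" if "finite F" "F \<subseteq> \<D> k" for F
    proof -
      have fm: "Q \<inter> A i \<in> sets M" if "Q \<in> F" for Q
        using A(1) cube_sets[OF gen_in_cubes] that \<open>F \<subseteq> \<D> k\<close> by auto
      have Ai: "A i \<in> fmeasurable M" using A(1) A(3)[of i] by (auto simp: fmeasurable_def less_top)
      have fin: "emeasure M (Q \<inter> A i) \<noteq> \<infinity>" for Q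
        using emeasure_mono[of "Q \<inter> A i" "A i" M] range_subsetD[OF A(1), of i] A(3)[of i] by (auto simp: top_unique)
      have dj: "disjoint_family_on (\<lambda>Q. Q \<inter> A i) F"
        unfolding disjoint_family_on_def
      proof (intro ballI impI)
        fix P Q assume "P \<in> F" "Q \<in> F" "P \<noteq> Q"
        with that have "P \<inter> Q = {}" using same_gen_eq[of P k Q] by auto
        thus "P \<inter> A i \<inter> (Q \<inter> A i) = {}" by blast
      qed
      have "sum (\<lambda>Q. measure M (Q \<inter> A i)) F = measure M (\<Union>Q\<in>F. Q \<inter> A i)"
        using fm fin dj that(1) by (intro measure_finite_Union[symmetric]) auto
      also have "\<dots> \<le> measure M (A i)"
        using Ai fm that by (intro measure_mono_fmeasurable sets.finite_UN) auto
      finally show ?thesis .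
    qed
    have "(\<lambda>Q. measure M (Q \<inter> A i)) summable_on \<D> k"
      using bound by (intro nonneg_bdd_above_summable_on bdd_aboveI2) auto
    from summable_countable_real[OF this] show ?thesis by simp
  qed
  have "\<D> k \<subseteq> (\<Union>i. ?S i)"
  proof
    fix Q assume Q: "Q \<in> \<D> k"
    show "Q \<in> (\<Union>i. ?S i)"
    proof (rule ccontr)
      assume "\<not> ?thesis"
      hence "measure M (Q \<inter> A i) = 0" for i using Q by auto
      moreover have "emeasure M (Q \<inter> A i) \<noteq> \<infinity>" for i
        using emeasure_mono[of "Q \<inter> A i" "A i" M] range_subsetD[OF A(1), of i] A(3)[of i] by (auto simp: top_unique)
      ultimately have e0: "emeasure M (Q \<inter> A i) = 0" for i
        by (simp add: measure_def enn2real_eq_0_iff)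
      have "range (\<lambda>i. Q \<inter> A i) \<subseteq> sets M"
        using range_subsetD[OF A(1)] cube_sets[OF gen_in_cubes[OF Q]] by (intro image_subsetI sets.Int)
      with e0 have "emeasure M (\<Union>i. Q \<inter> A i) = 0" by (rule emeasure_UN_eq_0)
      moreover have "(\<Union>i. Q \<inter> A i) = Q"
        using cube_subset_space[OF gen_in_cubes[OF Q]] unfolding A(2)[symmetric] by blast
      ultimately show False using cube_pos[OF gen_in_cubes[OF Q]] by (metis less_irrefl)
    qed
  qed
  thus ?thesis using cnt by (meson countable_UN countable_subset countableI_type)
qed

lemma countable_cubes: "countable \<U>"
  unfolding \<U>_def using countable_gen by simp

end

section \<open>Chains of cubes, approximation by unions of cubes, and the Calderon-Zygmund
  decomposition\<close>

context dyadic_system begin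

lemma gen_mono:
  assumes "P \<in> \<U>" "R \<in> \<U>" "P \<subseteq> R"
  shows "gen P \<le> gen R"
proof (cases "P = R")
  case False
  hence "P \<subset> R" using assms(3) by blast
  from psubset_gen_less[OF gen_mem[OF assms(1)] gen_mem[OF assms(2)] this] show ?thesis by simp
qed simp

text \<open>Cubes containing P intersect each other, so each is determined by its generation, which
  lies between \<open>gen P\<close> and \<open>gen Q\<close>. This is why maximal stopping cubes
  exist.\<close>

lemma finite_between:
  assumes "P \<in> \<U>" "Q \<in> \<U>"
  shows "finite {R \<in> \<U>. P \<subseteq> R \<and> R \<subseteq> Q}"
proof (rule finite_imageD)
  have "gen P \<le> gen R \<and> gen R \<le> gen Q" if R: "R \<in> \<U>" "P \<subseteq> R" "R \<subseteq> Q" for R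
    using gen_mono R assms by blast
  hence "gen ` {R \<in> \<U>. P \<subseteq> R \<and> R \<subseteq> Q} \<subseteq> {gen P..gen Q}" by auto
  thus "finite (gen ` {R \<in> \<U>. P \<subseteq> R \<and> R \<subseteq> Q})" by (rule finite_subset) simp
  show "inj_on gen {R \<in> \<U>. P \<subseteq> R \<and> R \<subseteq> Q}"
  proof (rule inj_onI)
    fix R S assume "R \<in> {R \<in> \<U>. P \<subseteq> R \<and> R \<subseteq> Q}" "S \<in> {R \<in> \<U>. P \<subseteq> R \<and> R \<subseteq> Q}" "gen R = gen S"
    thus "R = S" using same_gen_eq[of R "gen R" S] gen_mem[of R] gen_mem[of S] cube_nonempty[OF assms(1)] by auto
  qed
qed

text \<open>The parent of P may be P itself as a set. The generations of P are bounded by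
  \<open>gen Q\<close> because the inclusion is strict; with j the largest of them, the cube of
  generation j + 1 around P is strictly larger than P and still inside Q.\<close>

lemma parent_within:
  assumes P: "P \<in> \<U>" and Q: "Q \<in> \<U>" and "P \<subset> Q"
  obtains R where "R \<in> \<U>" "P \<subset> R" "R \<subseteq> Q" "ennreal \<epsilon> * emeasure M R \<le> emeasure M P"
proof -
  define J where "J = {j. P \<in> \<D> j \<and> gen P \<le> j}"
  have less: "j < gen Q" if "j \<in> J" for j
    using that psubset_gen_less[OF _ gen_mem[OF Q] assms(3)] by (auto simp: J_def)
  have "J \<subseteq> {gen P..gen Q}" using less by (force simp: J_def)
  hence fin: "finite J" by (rule finite_subset) simp
  have ne: "gen P \<in> J" using gen_mem[OF P] by (simp add: J_def)
  define j where "j = Max J"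
  have j: "j \<in> J" unfolding j_def using fin ne by (intro Max_in) auto
  hence Pj: "P \<in> \<D> j" by (simp add: J_def)
  have "j + 1 \<notin> J" using Max_ge[OF fin, of "j + 1"] by (auto simp: j_def)
  hence nP: "P \<notin> \<D> (j + 1)" using j by (auto simp: J_def)
  obtain R where R: "R \<in> \<D> (j + 1)" "P \<subseteq> R"
    using ex1_implies_ex[OF bspec[OF spec[OF parent_ex1] Pj]] by auto
  have 1: "P \<subset> R" using R nP by auto
  have "P \<noteq> {}" by (rule cube_nonempty[OF P])
  hence 2: "R \<subseteq> Q" using gen_less_subset[OF R(1) gen_mem[OF Q]] less[OF j] R(2) assms(3) by auto
  have "P \<in> \<D> (j + 1 - 1)" using Pj by simp
  hence 3: "ennreal \<epsilon> * emeasure M R \<le> emeasure M P"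
    using bspec[OF bspec[OF spec[OF child_measure] R(1)]] R(2) by blast
  show ?thesis using that[OF gen_in_cubes[OF R(1)] 1 2 3] .
qed

text \<open>Plays the role of the open sets: there are countably many cubes, so their unions are
  measurable, and nestedness makes finite intersections cubic again.\<close>

definition cubic :: "'a set \<Rightarrow> bool" where
  "cubic U \<longleftrightarrow> U \<subseteq> space M \<and> (\<forall>x\<in>U. \<exists>Q\<in>\<U>. x \<in> Q \<and> Q \<subseteq> U)"

lemma cubic_eq: "cubic U \<Longrightarrow> U = \<Union>{Q \<in> \<U>. Q \<subseteq> U}"
  unfolding cubic_def by blast

lemma cubic_sets [measurable]:
  assumes "cubic U"
  shows "U \<in> sets M"
proof -
  have "countable {Q \<in> \<U>. Q \<subseteq> U}" using countable_cubes by simp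
  hence "\<Union>{Q \<in> \<U>. Q \<subseteq> U} \<in> sets M" using cube_sets by (intro sets.countable_Union) auto
  thus ?thesis using cubic_eq[OF assms] by simp
qed

lemma cubic_UN: "(\<And>i. i \<in> I \<Longrightarrow> cubic (U i)) \<Longrightarrow> cubic (\<Union>i\<in>I. U i)"
  unfolding cubic_def by (intro conjI ballI UN_least, blast, elim UN_E) (meson UN_upper order_trans)

lemma cubic_Int:
  assumes "cubic U" "cubic W"
  shows "cubic (U \<inter> W)"
  unfolding cubic_def
proof (intro conjI ballI)
  fix x assume "x \<in> U \<inter> W"
  then obtain Q R where "Q \<in> \<U>" "x \<in> Q" "Q \<subseteq> U" "R \<in> \<U>" "x \<in> R" "R \<subseteq> W"
    using assms unfolding cubic_def by blast
  with nestedD[OF nested_cubes, of Q R x] show "\<exists>Q\<in>\<U>. x \<in> Q \<and> Q \<subseteq> U \<inter> W" by blast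
qed (use assms in \<open>auto simp: cubic_def\<close>)

lemma cubic_INT_atMost: "(\<And>i. cubic (U i)) \<Longrightarrow> cubic (\<Inter>i\<le>(n::nat). U i)"
  by (induction n) (auto simp: atMost_Suc intro!: cubic_Int)

lemma cubic_cube: "Q \<in> \<U> \<Longrightarrow> cubic Q"
  unfolding cubic_def using cube_subset_space by blast

text \<open>The other cubes of the same generation fill the complement, so cubes behave like clopen
  sets.\<close>

lemma cubic_compl_cube:
  assumes "Q \<in> \<U>"
  shows "cubic (space M - Q)"
  unfolding cubic_def
proof (intro conjI ballI)
  fix x assume x: "x \<in> space M - Q"
  hence "x \<in> \<Union>(\<D> (gen Q))" using spec[OF Union_gen] by auto
  then obtain R where R: "R \<in> \<D> (gen Q)" "x \<in> R" by blast
  hence "R \<inter> Q = {}" using same_gen_eq[OF R(1) gen_mem[OF assms]] x by auto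
  thus "\<exists>R\<in>\<U>. x \<in> R \<and> R \<subseteq> space M - Q"
    using R gen_in_cubes[OF R(1)] cube_subset_space[of R] by (intro bexI[of _ R]) auto
qed auto

lemma cubic_qopen:
  assumes "qopen M \<rho> U"
  shows "cubic U"
  unfolding cubic_def
proof (intro conjI ballI)
  show "U \<subseteq> space M" using assms unfolding qopen_def by blast
  fix x assume x: "x \<in> U"
  then obtain r where r: "r > 0" "ball x r \<subseteq> U" using assms unfolding qopen_def by blast
  have xs: "x \<in> space M" using x assms unfolding qopen_def by blast
  have "0 < r / (2 * \<kappa> * C\<^sub>0)" using r C0_pos kappa_ge_1 by simp
  from real_arch_pow_inv[OF this, of "1 / \<delta>"] delta_gt_1
  obtain n where n: "(1 / \<delta>) ^ n < r / (2 * \<kappa> * C\<^sub>0)" by auto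
  \<comment> \<open>Two points of a cube of generation k have distance less than 2 \<kappa>
    \<open>C\<^sub>0\<close> \<delta>^k, which the choice of n makes smaller than r.\<close>
  define k where "k = - int n"
  have k: "\<delta> powi k = (1 / \<delta>) ^ n"
    unfolding k_def by (simp add: power_int_minus power_one_over inverse_eq_divide)
  have small: "\<kappa> * (C\<^sub>0 * \<delta> powi k + C\<^sub>0 * \<delta> powi k) \<le> r"
    using n C0_pos kappa_ge_1 unfolding k by (simp add: field_simps)
  have "x \<in> \<Union>(\<D> k)" using xs spec[OF Union_gen] by auto
  then obtain Q where Q: "Q \<in> \<D> k" "x \<in> Q" by blast
  obtain c where c: "c \<in> space M" "Q \<subseteq> ball c (C\<^sub>0 * \<delta> powi k)"
    using bspec[OF spec[OF cube_ball] Q(1)] by auto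
  have "\<rho> x c < C\<^sub>0 * \<delta> powi k" using Q c xs rho_sym[of x c] by (auto simp: mem_ball)
  hence "\<kappa> * (\<rho> x c + C\<^sub>0 * \<delta> powi k) \<le> r"
    using kappa_ge_1 by (intro order_trans[OF _ small] mult_left_mono add_right_mono) auto
  from ball_subset_ball[OF xs c(1) this] have "Q \<subseteq> U" using c(2) r(2) by blast
  thus "\<exists>Q\<in>\<U>. x \<in> Q \<and> Q \<subseteq> U" using Q gen_in_cubes by blast
qed

text \<open>Approximability from outside of a set and of its complement is stable under complements and
  countable unions; the outer half alone is not.\<close>

definition approximable :: "'a set \<Rightarrow> 'a set \<Rightarrow> bool" where
  "approximable Z A \<longleftrightarrow> A \<in> sets M \<and> (\<forall>e>0.
     (\<exists>U. cubic U \<and> A \<subseteq> U \<and> emeasure M (Z \<inter> (U - A)) \<le> ennreal e) \<and>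
     (\<exists>U. cubic U \<and> space M - A \<subseteq> U \<and> emeasure M (Z \<inter> (U \<inter> A)) \<le> ennreal e))"

lemma approximable_cube:
  assumes "Q \<in> \<U>"
  shows "approximable Z Q"
proof -
  have "Z \<inter> (Q - Q) = {}" "Z \<inter> ((space M - Q) \<inter> Q) = {}" by auto
  thus ?thesis using assms unfolding approximable_def
    by (metis cubic_cube cubic_compl_cube cube_sets emeasure_empty subset_refl zero_le)
qed

lemma approximable_compl:
  assumes "approximable Z A"
  shows "approximable Z (space M - A)"
proof -
  have A: "A \<subseteq> space M" using assms sets.sets_into_space unfolding approximable_def by blast
  hence *: "space M - (space M - A) = A" by blast
  have 1: "Z \<inter> (U - (space M - A)) = Z \<inter> (U \<inter> A)" if "cubic U" for U
    using that A unfolding cubic_def by blast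
  have 2: "Z \<inter> (U \<inter> (space M - A)) = Z \<inter> (U - A)" if "cubic U" for U
    using that unfolding cubic_def by blast
  have "\<exists>U. cubic U \<and> space M - A \<subseteq> U \<and> emeasure M (Z \<inter> (U - (space M - A))) \<le> ennreal e"
    "\<exists>U. cubic U \<and> space M - (space M - A) \<subseteq> U \<and> emeasure M (Z \<inter> (U \<inter> (space M - A))) \<le> ennreal e"
    if "e > 0" for e
    using assms that 1 2 * unfolding approximable_def by metis+
  moreover have "space M - A \<in> sets M" using assms unfolding approximable_def by auto
  ultimately show ?thesis unfolding approximable_def by blast
qed

lemma suminf_half: "e \<ge> 0 \<Longrightarrow> (\<Sum>i. ennreal (e * (1/2) ^ Suc i)) = ennreal e"
  using sums_mult[OF power_half_series, of e] by (intro suminf_ennreal_eq) auto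

text \<open>For the union itself the errors e / 2^(i+1) add up to e. For its complement, an infinite
  intersection of cubic sets need not be cubic, so only finitely many are intersected; the rest
  \<open>r n\<close> is small by continuity from above, which rests on the finite measure of
  Z.\<close>

lemma approximable_UN:
  assumes a: "\<And>i::nat. approximable Z (a i)" and Z: "Z \<in> sets M" "emeasure M Z < \<infinity>"
  shows "approximable Z (\<Union>i. a i)"
  unfolding approximable_def
proof (intro conjI allI impI)
  have as [measurable]: "a i \<in> sets M" for i using a unfolding approximable_def by blast
  note Z(1)[measurable]
  show "(\<Union>i. a i) \<in> sets M" by simp
  fix e :: real assume e: "e > 0"
  have "\<exists>U. \<forall>i. cubic (U i) \<and> a i \<subseteq> U i \<and> emeasure M (Z \<inter> (U i - a i)) \<le> ennreal (e * (1/2) ^ Suc i)"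
    using a e unfolding approximable_def by (intro choice allI) simp
  then obtain U where U: "\<And>i. cubic (U i)" "\<And>i. a i \<subseteq> U i"
    "\<And>i. emeasure M (Z \<inter> (U i - a i)) \<le> ennreal (e * (1/2) ^ Suc i)" by blast
  note cubic_sets[OF U(1), measurable]
  have "emeasure M (Z \<inter> ((\<Union>i. U i) - (\<Union>i. a i))) \<le> emeasure M (\<Union>i. Z \<inter> (U i - a i))"
    by (intro emeasure_mono) auto
  also have "\<dots> \<le> (\<Sum>i. emeasure M (Z \<inter> (U i - a i)))"
    by (intro emeasure_subadditive_countably) auto
  also have "\<dots> \<le> (\<Sum>i. ennreal (e * (1/2) ^ Suc i))" by (intro suminf_le U) auto
  finally have "emeasure M (Z \<inter> ((\<Union>i. U i) - (\<Union>i. a i))) \<le> ennreal e"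
    unfolding suminf_half[OF less_imp_le[OF e]] .
  thus "\<exists>U. cubic U \<and> (\<Union>i. a i) \<subseteq> U \<and> emeasure M (Z \<inter> (U - (\<Union>i. a i))) \<le> ennreal e"
    using U by (intro exI[of _ "\<Union>i. U i"]) (auto intro!: cubic_UN)
  define r where "r n = Z \<inter> ((\<Union>i. a i) - (\<Union>i\<le>n. a i))" for n :: nat
  have rs: "r n \<in> sets M" for n unfolding r_def by measurable
  have r0: "(\<Inter>n. r n) = {}"
  proof (intro equalityI subsetI)
    fix x assume x: "x \<in> (\<Inter>n. r n)"
    then obtain i where "x \<in> a i" by (auto simp: r_def)
    hence "x \<notin> r i" by (auto simp: r_def)
    thus "x \<in> {}" using x by blast
  qed simp
  have "(\<lambda>n. emeasure M (r n)) \<longlonglongrightarrow> emeasure M (\<Inter>n. r n)"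
  proof (rule Lim_emeasure_decseq)
    show "range r \<subseteq> sets M" using rs by auto
    show "decseq r" unfolding r_def decseq_def by fastforce
    show "emeasure M (r i) \<noteq> \<infinity>" for i
      using emeasure_mono[of "r i" Z M] Z by (auto simp: r_def top_unique)
  qed
  hence "(\<lambda>n. emeasure M (r n)) \<longlonglongrightarrow> 0" by (simp add: r0)
  hence "\<forall>\<^sub>F n in sequentially. emeasure M (r n) < ennreal (e/2)" using e by (intro order_tendstoD) auto
  then obtain n where n: "emeasure M (r n) < ennreal (e/2)" by (auto simp: eventually_sequentially)
  have "\<exists>U. \<forall>i. cubic (U i) \<and> space M - a i \<subseteq> U i \<and> emeasure M (Z \<inter> (U i \<inter> a i)) \<le> ennreal ((e/2) * (1/2) ^ Suc i)"
    using a e unfolding approximable_def by (intro choice allI) simp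
  then obtain W where W: "\<And>i. cubic (W i)" "\<And>i. space M - a i \<subseteq> W i"
    "\<And>i. emeasure M (Z \<inter> (W i \<inter> a i)) \<le> ennreal ((e/2) * (1/2) ^ Suc i)" by blast
  note cubic_sets[OF W(1), measurable]
  have "emeasure M (Z \<inter> ((\<Inter>i\<le>n. W i) \<inter> (\<Union>i. a i))) \<le> emeasure M (r n \<union> (\<Union>i. Z \<inter> (W i \<inter> a i)))"
    using rs by (intro emeasure_mono) (auto simp: r_def)
  also have "\<dots> \<le> emeasure M (r n) + emeasure M (\<Union>i. Z \<inter> (W i \<inter> a i))"
    using rs by (intro emeasure_subadditive) auto
  also have "emeasure M (\<Union>i. Z \<inter> (W i \<inter> a i)) \<le> (\<Sum>i. emeasure M (Z \<inter> (W i \<inter> a i)))"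
    by (intro emeasure_subadditive_countably) auto
  also have "\<dots> \<le> (\<Sum>i. ennreal ((e/2) * (1/2) ^ Suc i))" by (intro suminf_le W) auto
  also have "\<dots> = ennreal (e/2)" by (rule suminf_half) (use e in simp)
  also have "emeasure M (r n) + ennreal (e/2) \<le> ennreal (e/2) + ennreal (e/2)" using n by (intro add_right_mono) auto
  also have "\<dots> = ennreal e" using e by (simp flip: ennreal_plus)
  finally have *: "emeasure M (Z \<inter> ((\<Inter>i\<le>n. W i) \<inter> (\<Union>i. a i))) \<le> ennreal e" by (simp add: add_left_mono)
  show "\<exists>U. cubic U \<and> space M - (\<Union>i. a i) \<subseteq> U \<and> emeasure M (Z \<inter> (U \<inter> (\<Union>i. a i))) \<le> ennreal e"
  proof (intro exI conjI)
    show "cubic (\<Inter>i\<le>n. W i)" by (rule cubic_INT_atMost[OF W(1)])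
    show "space M - (\<Union>i. a i) \<subseteq> (\<Inter>i\<le>n. W i)" using W(2) by blast
  qed (rule *)
qed

lemma approximable_cubic:
  assumes "cubic U" "Z \<in> sets M" "emeasure M Z < \<infinity>"
  shows "approximable Z U"
proof -
  let ?C = "{Q \<in> \<U>. Q \<subseteq> U}"
  have cnt: "countable ?C" using countable_cubes by (rule countable_subset[rotated]) auto
  \<comment> \<open>Enumerating the cubes in U presupposes that there is one, so the empty set is
    treated apart.\<close>
  have e: "approximable Z {}"
  proof -
    have "qopen M \<rho> (space M)" unfolding qopen_def using ball_subset_space by (auto intro: zero_less_one)
    hence "cubic (space M)" by (rule cubic_qopen)
    moreover have "cubic {}" unfolding cubic_def by simp
    ultimately show ?thesis unfolding approximable_def by (auto intro: exI[of _ "space M"] exI[of _ "{}"])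
  qed
  show ?thesis
  proof (cases "?C = {}")
    case True
    hence "U = {}" using cubic_eq[OF assms(1)] by blast
    thus ?thesis using e by simp
  next
    case False
    have "U = (\<Union>i. from_nat_into ?C i)"
      using cubic_eq[OF assms(1)] range_from_nat_into[OF False cnt] by simp
    moreover have "approximable Z (\<Union>i. from_nat_into ?C i)"
      using from_nat_into[OF False] by (intro approximable_UN approximable_cube assms) auto
    ultimately show ?thesis by simp
  qed
qed

lemma approximable_sigma_sets:
  assumes "A \<in> sigma_sets (space M) {U. qopen M \<rho> U}" "Z \<in> sets M" "emeasure M Z < \<infinity>"
  shows "approximable Z A"
  using assms(1)
proof (induction rule: sigma_sets.induct)
  case (Basic a)
  thus ?case by (intro approximable_cubic cubic_qopen assms) auto
next
  case Empty
  show ?case by (intro approximable_cubic assms) (auto simp: cubic_def)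
next
  case (Compl a)
  from Compl.IH show ?case by (rule approximable_compl)
next
  case (Union a)
  thus ?case by (intro approximable_UN assms)
qed

text \<open>A measurable set is Borel only up to a null set, which is why E is contained in U merely
  almost everywhere.\<close>

lemma outer_regular:
  assumes E: "E \<in> sets M" "E \<subseteq> Z" and Z: "cubic Z" "emeasure M Z < \<infinity>" and e: "0 < e"
  obtains U where "cubic U" "U \<subseteq> Z" "AE x in M. x \<in> E \<longrightarrow> x \<in> U" "emeasure M U \<le> emeasure M E + ennreal e"
proof -
  from borel E(1) obtain B where B: "B \<in> sigma_sets (space M) {U. qopen M \<rho> U}"
    "emeasure M ((E - B) \<union> (B - E)) = 0" unfolding borel_measure_for_def by blast
  have a: "approximable Z B" by (rule approximable_sigma_sets[OF B(1) cubic_sets[OF Z(1)] Z(2)])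
  hence Bs [measurable]: "B \<in> sets M" unfolding approximable_def by blast
  note E(1)[measurable] cubic_sets[OF Z(1), measurable]
  from a e obtain W where W: "cubic W" "B \<subseteq> W" "emeasure M (Z \<inter> (W - B)) \<le> ennreal e"
    unfolding approximable_def by blast
  note cubic_sets[OF W(1), measurable]
  have N: "(E - B) \<union> (B - E) \<in> null_sets M" using B(2) by auto
  show thesis
  proof (rule that)
    show "cubic (W \<inter> Z)" using W Z by (intro cubic_Int)
    show "AE x in M. x \<in> E \<longrightarrow> x \<in> W \<inter> Z"
      using AE_not_in[OF N] by eventually_elim (use W E in auto)
    have "emeasure M (W \<inter> Z) \<le> emeasure M (E \<union> (((E - B) \<union> (B - E)) \<union> (Z \<inter> (W - B))))"
      by (intro emeasure_mono) auto
    also have "\<dots> \<le> emeasure M E + (emeasure M ((E - B) \<union> (B - E)) + emeasure M (Z \<inter> (W - B)))"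
      by (intro order_trans[OF emeasure_subadditive] add_left_mono emeasure_subadditive) auto
    also have "\<dots> \<le> emeasure M E + ennreal e" using W B(2) by (simp add: add_left_mono)
    finally show "emeasure M (W \<inter> Z) \<le> emeasure M E + ennreal e" .
  qed auto
qed

text \<open>The cubes P are the maximal cubes in Q with average above t. The last claim takes the
  place of the Lebesgue differentiation theorem: on the set F where it fails, h exceeds t, yet
  approximating F from outside by cubes of average at most t bounds the integral of h over F by t
  times the measure of F.\<close>

lemma cz_decomposition:
  fixes h :: "'a \<Rightarrow> ennreal"
  assumes Q: "Q \<in> \<U>" and h [measurable]: "h \<in> borel_measurable M" and t: "0 < t"
    and avg: "(\<integral>\<^sup>+x\<in>Q. h x \<partial>M) \<le> ennreal t * emeasure M Q"
  obtains \<P> where "\<P> \<subseteq> \<U>" "disjoint \<P>" "\<And>P. P \<in> \<P> \<Longrightarrow> P \<subseteq> Q"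
    "\<And>P. P \<in> \<P> \<Longrightarrow> ennreal t * emeasure M P \<le> (\<integral>\<^sup>+x\<in>P. h x \<partial>M)"
    "\<And>P. P \<in> \<P> \<Longrightarrow> (\<integral>\<^sup>+x\<in>P. h x \<partial>M) \<le> ennreal (t / \<epsilon>) * emeasure M P"
    "AE x in M. x \<in> Q - \<Union>\<P> \<longrightarrow> h x \<le> ennreal t"
proof -
  define I where "I P = (\<integral>\<^sup>+x\<in>P. h x \<partial>M)" for P
  define \<G> where "\<G> = {P \<in> \<U>. P \<subseteq> Q \<and> ennreal t * emeasure M P < I P}"
  define \<P> where "\<P> = {P \<in> \<G>. \<forall>R\<in>\<G>. P \<subseteq> R \<longrightarrow> P = R}"
  have GU: "\<G> \<subseteq> \<U>" unfolding \<G>_def by blast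
  have QG: "Q \<notin> \<G>" using avg unfolding \<G>_def I_def by auto
  have PG: "\<P> \<subseteq> \<G>" unfolding \<P>_def by blast
  have cov: "\<exists>R\<in>\<P>. P \<subseteq> R" if P: "P \<in> \<G>" for P
  proof -
    have "finite {R \<in> \<G>. P \<subseteq> R}"
      using finite_between[of P Q] P Q by (rule_tac finite_subset[of _ "{R \<in> \<U>. P \<subseteq> R \<and> R \<subseteq> Q}"]) (auto simp: \<G>_def)
    from finite_has_maximal2[OF this, of P] P obtain R where R: "R \<in> \<G>" "P \<subseteq> R"
      "\<And>S. S \<in> \<G> \<Longrightarrow> P \<subseteq> S \<Longrightarrow> R \<subseteq> S \<Longrightarrow> R = S" by auto
    hence "R \<in> \<P>" unfolding \<P>_def by (auto dest: order_trans[OF R(2)])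
    thus ?thesis using R(2) by blast
  qed
  have mono: "I P \<le> I R" if "P \<subseteq> R" for P R
    unfolding I_def using that by (intro nn_integral_mono) (auto simp: indicator_def)
  \<comment> \<open>By maximality the next larger cube R in Q has average at most t, and P carries
    at least the fraction \<epsilon> of its measure.\<close>
  have up: "I P \<le> ennreal (t / \<epsilon>) * emeasure M P" if P: "P \<in> \<P>" for P
  proof -
    have "P \<in> \<U>" "P \<subset> Q" using P PG QG unfolding \<G>_def by auto
    from parent_within[OF this(1) Q this(2)] obtain R
      where R: "R \<in> \<U>" "P \<subset> R" "R \<subseteq> Q" "ennreal \<epsilon> * emeasure M R \<le> emeasure M P" .
    have "R \<notin> \<G>" using P R unfolding \<P>_def by blast
    hence "I R \<le> ennreal t * emeasure M R" using R unfolding \<G>_def by auto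
    also have "\<dots> = ennreal (t / \<epsilon>) * (ennreal \<epsilon> * emeasure M R)"
      using t eps_pos by (simp add: mult.assoc[symmetric] ennreal_mult[symmetric])
    also have "\<dots> \<le> ennreal (t / \<epsilon>) * emeasure M P" using R(4) by (intro mult_left_mono) auto
    finally show ?thesis using mono[of P R] R by auto
  qed
  have PU: "\<P> \<subseteq> \<U>" using PG GU by blast
  have cP: "countable \<P>" by (rule countable_subset[OF PU countable_cubes])
  have UP [measurable]: "\<Union>\<P> \<in> sets M" using cP PU cube_sets by (intro sets.countable_Union) auto
  note cube_sets[OF Q, measurable]
  define F where "F = {x \<in> space M. x \<in> Q - \<Union>\<P> \<and> ennreal t < h x}"
  have F [measurable]: "F \<in> sets M" unfolding F_def by measurable
  have FQ: "F \<subseteq> Q" unfolding F_def by blast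
  have Ffin: "emeasure M F < \<infinity>" using emeasure_mono[OF FQ cube_sets[OF Q]] cube_finite[OF Q] by (rule le_less_trans)
  \<comment> \<open>A cube in U that is not inside a stopping cube does not belong to
    \<open>\<G>\<close>, since every cube of \<open>\<G>\<close> lies in a stopping cube. So F is
    covered, up to a null set, by cubes of average at most t; \<open>emeasure_nested_le\<close> adds
    these bounds over their union.\<close>
  have IF: "I F \<le> ennreal t * (emeasure M F + ennreal e)" if e: "e > 0" for e
  proof -
    obtain U where U: "cubic U" "U \<subseteq> Q" "AE x in M. x \<in> F \<longrightarrow> x \<in> U" "emeasure M U \<le> emeasure M F + ennreal e"
      using outer_regular[OF F FQ cubic_cube[OF Q] cube_finite[OF Q] e] by blast
    define \<C> where "\<C> = {R \<in> \<U>. R \<subseteq> U \<and> R \<notin> \<G>}"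
    have CU: "\<C> \<subseteq> \<U>" unfolding \<C>_def by blast
    have cC: "countable \<C>" by (rule countable_subset[OF CU countable_cubes])
    have UC [measurable]: "\<Union>\<C> \<in> sets M" using cC CU cube_sets by (intro sets.countable_Union) auto
    have sub: "U - \<Union>\<P> \<subseteq> \<Union>\<C>"
    proof
      fix x assume x: "x \<in> U - \<Union>\<P>"
      then obtain R where R: "R \<in> \<U>" "x \<in> R" "R \<subseteq> U" using U(1) unfolding cubic_def by blast
      hence "R \<notin> \<G>" using cov[of R] x by blast
      thus "x \<in> \<Union>\<C>" using R unfolding \<C>_def by blast
    qed
    have "emeasure (density M h) (\<Union>\<C>) \<le> emeasure (density M (\<lambda>_. ennreal t)) (\<Union>\<C>)"
    proof (rule emeasure_nested_le[OF cC nested_subset[OF nested_cubes CU]])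
      fix R assume R: "R \<in> \<C>"
      hence [measurable]: "R \<in> sets M" using CU cube_sets by auto
      have "I R \<le> ennreal t * emeasure M R" using R U(2) unfolding \<C>_def \<G>_def by auto
      thus "emeasure (density M h) R \<le> emeasure (density M (\<lambda>_. ennreal t)) R"
        by (simp add: emeasure_density I_def nn_integral_cmult_indicator)
    qed (use CU cube_sets in auto)
    hence "I (\<Union>\<C>) \<le> ennreal t * emeasure M (\<Union>\<C>)"
      by (simp add: emeasure_density I_def nn_integral_cmult_indicator)
    also have "\<dots> \<le> ennreal t * emeasure M U"
      using cubic_sets[OF U(1)] by (intro mult_left_mono emeasure_mono) (auto simp: \<C>_def)
    also have "\<dots> \<le> ennreal t * (emeasure M F + ennreal e)" by (intro mult_left_mono U) auto
    finally have "I (\<Union>\<C>) \<le> ennreal t * (emeasure M F + ennreal e)" .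
    moreover have "I F \<le> I (\<Union>\<C>)" unfolding I_def
      using U(3) by (intro nn_integral_mono_AE, eventually_elim) (use sub in \<open>auto simp: indicator_def F_def\<close>)
    ultimately show ?thesis by simp
  qed
  have "I F \<le> ennreal t * emeasure M F"
  proof (rule ennreal_le_epsilon)
    fix e :: real assume e: "e > 0"
    have "I F \<le> ennreal t * (emeasure M F + ennreal (e / t))" using e t by (intro IF) auto
    also have "\<dots> = ennreal t * emeasure M F + ennreal e"
      using t e by (simp add: distrib_left ennreal_mult[symmetric])
    finally show "I F \<le> ennreal t * emeasure M F + ennreal e" .
  qed
  \<comment> \<open>On F, h is split into h - t and t. Cancelling t times the measure of F, which is
    finite, shows that the integral of h - t over F vanishes.\<close>
  moreover have "I F = (\<integral>\<^sup>+x. (h x - ennreal t) * indicator F x \<partial>M) + ennreal t * emeasure M F"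
  proof -
    have "I F = (\<integral>\<^sup>+x. (h x - ennreal t) * indicator F x + ennreal t * indicator F x \<partial>M)"
      unfolding I_def
    proof (rule nn_integral_cong)
      fix x show "h x * indicator F x = (h x - ennreal t) * indicator F x + ennreal t * indicator F x"
        by (cases "x \<in> F") (auto simp: F_def diff_add_cancel_ennreal)
    qed
    also have "\<dots> = (\<integral>\<^sup>+x. (h x - ennreal t) * indicator F x \<partial>M) + (\<integral>\<^sup>+x. ennreal t * indicator F x \<partial>M)"
      by (rule nn_integral_add) measurable
    finally show ?thesis by (simp add: nn_integral_cmult_indicator)
  qed
  ultimately have "ennreal t * emeasure M F + (\<integral>\<^sup>+x. (h x - ennreal t) * indicator F x \<partial>M) \<le> ennreal t * emeasure M F + 0"
    by (simp only: add.commute add_0_left)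
  moreover have "ennreal t * emeasure M F \<noteq> top" using Ffin by (simp add: ennreal_mult_eq_top_iff)
  ultimately have "(\<integral>\<^sup>+x. (h x - ennreal t) * indicator F x \<partial>M) = 0"
    unfolding ennreal_add_left_cancel_le by (auto simp only: le_zero_eq infinity_ennreal_def)
  hence "AE x in M. (h x - ennreal t) * indicator F x = 0" by (subst (asm) nn_integral_0_iff_AE) auto
  hence ae: "AE x in M. x \<in> Q - \<Union>\<P> \<longrightarrow> h x \<le> ennreal t"
    using AE_space
    by eventually_elim (auto simp: F_def indicator_def diff_eq_0_iff_ennreal split: if_splits)
  have dj: "disjoint \<P>" unfolding \<P>_def by (rule nested_maximal_disjoint[OF nested_subset[OF nested_cubes GU]])
  show thesis
    by (rule that[OF PU dj _ _ _ ae]) (use PG up in \<open>auto simp: \<G>_def I_def\<close>)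
qed

end

section \<open>Calderon--Zygmund operators\<close>

context hom_space begin

text \<open>D times the geometric series of ratio 2^(-\<eta>), the sum over all dyadic annuli in
  \<open>tail_integral_le\<close>.\<close>

definition ctail :: "real \<Rightarrow> real" where "ctail \<eta> = D / (1 - 2 powr (- \<eta>))"

lemma two_powr_less_1: "0 < \<eta> \<Longrightarrow> 2 powr (- \<eta>) < (1::real)"
  by (simp add: powr_less_one)

lemma ctail_pos: "0 < \<eta> \<Longrightarrow> 0 < ctail \<eta>"
  unfolding ctail_def using D_ge_1 two_powr_less_1[of \<eta>] by simp

text \<open>Split into the annuli 2^n a <= \<rho> < 2^(n+1) a. On the n-th one the kernel is at most
  2^(-n \<eta>) / V c (2^n a), and integrating h over the ball of radius 2^(n+1) a costs m times its
  measure, hence one further factor D.\<close>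

lemma tail_integral_le:
  fixes h :: "'a \<Rightarrow> ennreal"
  assumes c: "c \<in> space M" and a: "0 < a" and eta: "0 < \<eta>" and h [measurable]: "h \<in> borel_measurable M"
    and avg: "\<And>R. a \<le> R \<Longrightarrow> (\<integral>\<^sup>+y\<in>ball c R. h y \<partial>M) \<le> m * emeasure M (ball c R)"
  shows "(\<integral>\<^sup>+y\<in>{y. a \<le> \<rho> c y}. ennreal ((a / \<rho> c y) powr \<eta> / V c (\<rho> c y)) * h y \<partial>M) \<le> ennreal (ctail \<eta>) * m"
proof -
  define q where "q = 2 powr (- \<eta>)"
  have q: "0 < q" "q < 1" unfolding q_def using two_powr_less_1[OF eta] by auto
  define G where "G n y = ennreal (q ^ n / V c (2 ^ n * a)) * (h y * indicator (ball c (2 ^ Suc n * a)) y)" for n :: nat and y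
  have Vp: "0 < V c (2 ^ n * a)" for n using c a by (intro V_pos) auto
  have pt: "ennreal ((a / \<rho> c y) powr \<eta> / V c (\<rho> c y)) * h y * indicator {y. a \<le> \<rho> c y} y \<le> (\<Sum>n. G n y)"
    if y: "y \<in> space M" for y
  proof (cases "a \<le> \<rho> c y")
    case True
    obtain k where k: "\<rho> c y / a < 2 ^ k" using real_arch_pow[of 2 "\<rho> c y / a"] by auto
    \<comment> \<open>As \<rho> c y >= a, the exponent l is positive, and y lies in the annulus of
      index l - 1.\<close>
    define l where "l = (LEAST k. \<rho> c y / a < 2 ^ k)"
    have l: "\<rho> c y / a < 2 ^ l" unfolding l_def using k by (rule LeastI)
    have "l \<noteq> 0" using l a True by (auto simp: field_simps intro: ccontr)
    then obtain n where n: "l = Suc n" by (cases l) auto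
    have "\<not> \<rho> c y / a < 2 ^ n" using not_less_Least[of n "\<lambda>k. \<rho> c y / a < 2 ^ k"] n unfolding l_def by auto
    hence lo: "2 ^ n * a \<le> \<rho> c y" using a by (simp add: field_simps)
    have hi: "\<rho> c y < 2 ^ Suc n * a" using l n a by (simp add: field_simps)
    have pos: "0 < \<rho> c y" using True a by simp
    have "a / \<rho> c y \<le> 1 / 2 ^ n" using lo pos by (simp add: field_simps)
    hence "(a / \<rho> c y) powr \<eta> \<le> (1 / 2 ^ n) powr \<eta>" using a pos eta by (intro powr_mono2) auto
    also have "(1 / 2 ^ n) powr \<eta> = q ^ n"
      unfolding q_def by (simp add: powr_divide powr_minus powr_realpow[symmetric] powr_powr mult.commute inverse_eq_divide powr_power power_one_over)
    finally have 1: "(a / \<rho> c y) powr \<eta> \<le> q ^ n" .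
    have "(a / \<rho> c y) powr \<eta> / V c (\<rho> c y) \<le> q ^ n / V c (2 ^ n * a)"
      using 1 V_mono[OF c _ lo] a q Vp by (intro frac_le) auto
    hence "ennreal ((a / \<rho> c y) powr \<eta> / V c (\<rho> c y)) * h y \<le> G n y"
      unfolding G_def using hi y by (auto simp: mem_ball intro!: mult_right_mono ennreal_leI)
    also have "G n y \<le> (\<Sum>n. G n y)"
      using sum_le_suminf[of "\<lambda>n. G n y" "{n}"] by simp
    finally show ?thesis using True by simp
  qed simp
  have "(\<integral>\<^sup>+y\<in>{y. a \<le> \<rho> c y}. ennreal ((a / \<rho> c y) powr \<eta> / V c (\<rho> c y)) * h y \<partial>M) \<le> (\<integral>\<^sup>+y. (\<Sum>n. G n y) \<partial>M)"
    by (intro nn_integral_mono pt)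
  also have "\<dots> = (\<Sum>n. \<integral>\<^sup>+y. G n y \<partial>M)"
    unfolding G_def using c by (intro nn_integral_suminf) measurable
  also have "\<dots> \<le> (\<Sum>n. ennreal (D * q ^ n) * m)"
  proof (intro suminf_le allI)
    fix n
    have "(\<integral>\<^sup>+y. G n y \<partial>M) = ennreal (q ^ n / V c (2 ^ n * a)) * (\<integral>\<^sup>+y\<in>ball c (2 ^ Suc n * a). h y \<partial>M)"
      unfolding G_def using c by (intro nn_integral_cmult) measurable
    also have "\<dots> \<le> ennreal (q ^ n / V c (2 ^ n * a)) * (m * emeasure M (ball c (2 ^ Suc n * a)))"
      using a mult_right_mono[of 1 "2 ^ Suc n" a] one_le_power[of "2::real" "Suc n"] by (intro mult_left_mono avg) auto
    also have "\<dots> \<le> ennreal (q ^ n / V c (2 ^ n * a)) * (m * ennreal (D * V c (2 ^ n * a)))"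
      using c a V_double[of c "2 ^ n * a"]
      by (intro mult_left_mono) (auto simp: emeasure_ball ac_simps intro: ennreal_leI)
    also have "\<dots> = ennreal (q ^ n / V c (2 ^ n * a) * (D * V c (2 ^ n * a))) * m"
      using q Vp[of n] D_ge_1 by (subst ennreal_mult) (auto simp: ac_simps)
    also have "q ^ n / V c (2 ^ n * a) * (D * V c (2 ^ n * a)) = D * q ^ n" using Vp[of n] by simp
    finally show "(\<integral>\<^sup>+y. G n y \<partial>M) \<le> ennreal (D * q ^ n) * m" .
  qed auto
  also have "\<dots> = (\<Sum>n. ennreal (D * q ^ n)) * m" by (rule ennreal_suminf_multc)
  also have "(\<Sum>n. ennreal (D * q ^ n)) = ennreal (ctail \<eta>)"
  proof (rule suminf_ennreal_eq)
    show "(\<lambda>n. D * q ^ n) sums ctail \<eta>"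
      using sums_mult[OF geometric_sums, of q D] q by (simp add: ctail_def q_def)
  qed (use q D_ge_1 in auto)
  finally show ?thesis .
qed

end

locale kernel = hom_space +
  fixes K :: "'a \<Rightarrow> 'a \<Rightarrow> real" and \<eta> C\<^sub>K :: real
  assumes eta_pos: "0 < \<eta>" and CK_nonneg: "0 \<le> C\<^sub>K"
    and kernel_size: "x \<in> space M \<Longrightarrow> y \<in> space M \<Longrightarrow> x \<noteq> y \<Longrightarrow> \<bar>K x y\<bar> \<le> C\<^sub>K / V x (\<rho> x y)"
    and kernel_smooth1: "c \<in> space M \<Longrightarrow> y \<in> space M \<Longrightarrow> x \<in> space M \<Longrightarrow> c \<noteq> y \<Longrightarrow> x \<noteq> y \<Longrightarrow> \<rho> c x \<le> \<eta> * \<rho> c y \<Longrightarrow>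
      \<bar>K x y - K c y\<bar> \<le> (\<rho> x c / \<rho> c y) powr \<eta> / V c (\<rho> c y)"
    and kernel_smooth2: "c \<in> space M \<Longrightarrow> y \<in> space M \<Longrightarrow> x \<in> space M \<Longrightarrow> c \<noteq> y \<Longrightarrow> x \<noteq> y \<Longrightarrow> \<rho> c x \<le> \<eta> * \<rho> c y \<Longrightarrow>
      \<bar>K y x - K y c\<bar> \<le> (\<rho> x c / \<rho> c y) powr \<eta> / V c (\<rho> c y)"
begin

lemma rho_pos: "x \<in> space M \<Longrightarrow> y \<in> space M \<Longrightarrow> x \<noteq> y \<Longrightarrow> 0 < \<rho> x y"
  using rho_nonneg[of x y] rho_eq_0_iff[of x y] by linarith

text \<open>The source of measurability of the kernel: by regularity in the second variable, K x is
  continuous off the point x.\<close>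

lemma kernel_superlevel_qopen:
  assumes x: "x \<in> space M"
  shows "qopen M \<rho> {y \<in> space M. y \<noteq> x \<and> a < K x y}"
  unfolding qopen_def
proof (intro conjI ballI)
  fix z assume "z \<in> {y \<in> space M. y \<noteq> x \<and> a < K x y}"
  hence z: "z \<in> space M" "z \<noteq> x" "a < K x z" by auto
  define d where "d = \<rho> z x"
  have d: "0 < d" unfolding d_def using rho_pos z x by blast
  define W where "W = V z d"
  have W: "0 < W" unfolding W_def using V_pos z d by blast
  \<comment> \<open>Chosen so that \<rho> z y < d u makes the regularity bound at most half of the
    gap K x z - a.\<close>
  define u where "u = ((K x z - a) * W / 2) powr (1 / \<eta>)"
  have pos: "0 < (K x z - a) * W / 2" using z W by simp
  have u: "0 < u" "u powr \<eta> = (K x z - a) * W / 2"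
    unfolding u_def using pos eta_pos by (auto simp: powr_powr)
  define r where "r = min (min (\<eta> * d) d) (d * u)"
  show "\<exists>r>0. ball z r \<subseteq> {y \<in> space M. y \<noteq> x \<and> a < K x y}"
  proof (intro exI conjI subsetI)
    show "0 < r" unfolding r_def using d u eta_pos by simp
    fix y assume "y \<in> ball z r"
    hence y: "y \<in> space M" "\<rho> z y < \<eta> * d" "\<rho> z y < d" "\<rho> z y < d * u" by (auto simp: mem_ball r_def)
    have yx: "y \<noteq> x" using y(3) d_def by auto
    have "\<bar>K x y - K x z\<bar> \<le> (\<rho> y z / d) powr \<eta> / W"
      using kernel_smooth2[of z x y] z x y yx unfolding d_def W_def by auto
    also have "(\<rho> y z / d) powr \<eta> \<le> u powr \<eta>"
      using y z d u eta_pos rho_sym[of y z] rho_nonneg[of y z] by (intro powr_mono2) (auto simp: field_simps)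
    hence "(\<rho> y z / d) powr \<eta> / W \<le> u powr \<eta> / W" using W by (intro divide_right_mono) auto
    also have "\<dots> = (K x z - a) / 2" using W by (simp add: u)
    finally have "\<bar>K x y - K x z\<bar> \<le> (K x z - a) / 2" .
    hence "- (K x y - K x z) \<le> (K x z - a) / 2" by (rule abs_le_D2)
    hence "a < K x y" using z(3) by (simp add: field_simps)
    thus "y \<in> {y \<in> space M. y \<noteq> x \<and> a < K x y}" using y yx by simp
  qed
qed auto

text \<open>The condition f x = 0 removes the arbitrary diagonal value K x x from the
  product.\<close>

lemma kernel_measurable:
  assumes x: "x \<in> space M" and f [measurable]: "f \<in> borel_measurable M" and "f x = 0"
  shows "(\<lambda>y. K x y * f y) \<in> borel_measurable M"
proof -
  have *: "{y \<in> space M. y \<noteq> x \<and> a < K x y} \<in> sets M" for a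
    using qopen_sets[OF kernel_superlevel_qopen[OF x]] .
  have "qopen M \<rho> (space M - {x})"
    unfolding qopen_def
  proof (intro conjI ballI)
    fix y assume y: "y \<in> space M - {x}"
    show "\<exists>r>0. ball y r \<subseteq> space M - {x}"
      using y x rho_pos[of y x] by (intro exI[of _ "\<rho> y x"]) (auto simp: mem_ball)
  qed auto
  hence "space M - (space M - {x}) \<in> sets M" using qopen_sets by blast
  moreover have "space M - (space M - {x}) = {x}" using x by blast
  ultimately have sx: "{x} \<in> sets M" by simp
  have "(\<lambda>y. if y = x then 0 else K x y) \<in> borel_measurable M"
  proof (subst borel_measurable_iff_greater, intro allI)
    fix a
    have "{y \<in> space M. a < (if y = x then 0 else K x y)} = {y \<in> space M. y \<noteq> x \<and> a < K x y} \<union> (if a < 0 then {x} else {})"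
      using x by (auto split: if_splits)
    moreover have "(if a < 0 then {x} else {}) \<in> sets M" using sx by simp
    ultimately show "{y \<in> space M. a < (if y = x then 0 else K x y)} \<in> sets M"
      using *[of a] by (simp only: sets.Un)
  qed
  hence "(\<lambda>y. (if y = x then 0 else K x y) * f y) \<in> borel_measurable M" by measurable
  moreover have "(\<lambda>y. (if y = x then 0 else K x y) * f y) = (\<lambda>y. K x y * f y)" using assms(3) by auto
  ultimately show ?thesis by simp
qed

end

section \<open>Markov's inequality and square integrable functions\<close>

lemma emeasure_superlevel_le:
  fixes u :: "'a \<Rightarrow> ennreal"
  assumes u [measurable]: "u \<in> borel_measurable M" and t: "0 < t"
  shows "emeasure M {x \<in> space M. ennreal t < u x} \<le> ennreal (1 / t) * (\<integral>\<^sup>+x. u x \<partial>M)"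
proof -
  have "emeasure M {x \<in> space M. ennreal t < u x} \<le> emeasure M {x \<in> space M. 1 \<le> ennreal (1 / t) * u x}"
  proof (rule emeasure_mono)
    show "{x \<in> space M. ennreal t < u x} \<subseteq> {x \<in> space M. 1 \<le> ennreal (1 / t) * u x}"
    proof safe
      fix x assume "ennreal t < u x"
      hence "ennreal (1 / t) * ennreal t \<le> ennreal (1 / t) * u x" by (intro mult_left_mono) auto
      thus "1 \<le> ennreal (1 / t) * u x" using t by (simp add: ennreal_mult[symmetric])
    qed
  qed measurable
  also have "\<dots> \<le> ennreal (1 / t) * (\<integral>\<^sup>+x. u x * indicator (space M) x \<partial>M)"
    by (rule nn_integral_Markov_inequality) auto
  also have "(\<integral>\<^sup>+x. u x * indicator (space M) x \<partial>M) = (\<integral>\<^sup>+x. u x \<partial>M)"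
    by (intro nn_integral_cong) simp
  finally show ?thesis .
qed

lemma in_L2_iff: "in_L2 M f \<longleftrightarrow> f \<in> borel_measurable M \<and> (\<integral>\<^sup>+x. ennreal ((f x)\<^sup>2) \<partial>M) < \<infinity>"
  unfolding in_L2_def by (auto simp: integrable_iff_bounded)

lemma in_L2_measurable [measurable_dest]: "in_L2 M f \<Longrightarrow> f \<in> borel_measurable M"
  unfolding in_L2_def by blast

lemma in_L2_bound:
  assumes "in_L2 M f" "g \<in> borel_measurable M" "AE x in M. \<bar>g x\<bar> \<le> \<bar>f x\<bar>"
  shows "in_L2 M g"
  unfolding in_L2_iff
proof
  have "(\<integral>\<^sup>+x. ennreal ((g x)\<^sup>2) \<partial>M) \<le> (\<integral>\<^sup>+x. ennreal ((f x)\<^sup>2) \<partial>M)"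
    using assms(3) by (intro nn_integral_mono_AE, eventually_elim) (auto intro: ennreal_leI simp: abs_le_square_iff)
  thus "(\<integral>\<^sup>+x. ennreal ((g x)\<^sup>2) \<partial>M) < \<infinity>" using assms(1) unfolding in_L2_iff by (auto intro: le_less_trans)
qed (fact assms)

lemma in_L2_scale: "in_L2 M f \<Longrightarrow> in_L2 M (\<lambda>x. c * f x)"
  unfolding in_L2_def by (auto simp: power_mult_distrib)

lemma in_L2_add:
  assumes "in_L2 M f" "in_L2 M g"
  shows "in_L2 M (\<lambda>x. f x + g x)"
  unfolding in_L2_def
proof
  note assms[THEN in_L2_measurable, measurable]
  show "(\<lambda>x. f x + g x) \<in> borel_measurable M" by measurable
  have "integrable M (\<lambda>x. 2 * (f x)\<^sup>2 + 2 * (g x)\<^sup>2)" using assms unfolding in_L2_def by auto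
  thus "integrable M (\<lambda>x. (f x + g x)\<^sup>2)"
  proof (rule Bochner_Integration.integrable_bound)
    show "AE x in M. norm ((f x + g x)\<^sup>2) \<le> norm (2 * (f x)\<^sup>2 + 2 * (g x)\<^sup>2)"
    proof (rule AE_I2)
      fix x
      have "0 \<le> (f x - g x)\<^sup>2" by simp
      hence "(f x + g x)\<^sup>2 \<le> 2 * (f x)\<^sup>2 + 2 * (g x)\<^sup>2" by (simp add: power2_eq_square algebra_simps)
      thus "norm ((f x + g x)\<^sup>2) \<le> norm (2 * (f x)\<^sup>2 + 2 * (g x)\<^sup>2)" by simp
    qed
  qed measurable
qed

lemma in_L2_diff: "in_L2 M f \<Longrightarrow> in_L2 M g \<Longrightarrow> in_L2 M (\<lambda>x. f x - g x)"
  using in_L2_add[of M f "\<lambda>x. (-1) * g x"] in_L2_scale[of M g "-1"] by simp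

lemma in_L2_zero: "in_L2 M (\<lambda>x. 0)"
  unfolding in_L2_def by simp

lemma in_L2_sum:
  assumes "\<And>i. i \<in> I \<Longrightarrow> in_L2 M (f i)"
  shows "in_L2 M (\<lambda>x. \<Sum>i\<in>I. f i x)"
  using assms by (induction I rule: infinite_finite_induct) (auto intro: in_L2_zero in_L2_add)

lemma in_L2_indicator:
  assumes "in_L2 M f" "S \<in> sets M"
  shows "in_L2 M (\<lambda>x. f x * indicator S x)"
proof -
  note assms(2)[measurable] in_L2_measurable[OF assms(1), measurable]
  show ?thesis by (rule in_L2_bound[OF assms(1)]) (auto simp: indicator_def)
qed

lemma in_L2_const_indicator:
  assumes "S \<in> sets M" "emeasure M S < \<infinity>"
  shows "in_L2 M (\<lambda>x. c * indicator S x)"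
  unfolding in_L2_iff
proof
  have "(\<integral>\<^sup>+x. ennreal ((c * indicator S x)\<^sup>2) \<partial>M) = (\<integral>\<^sup>+x. ennreal (c\<^sup>2) * indicator S x \<partial>M)"
    by (intro nn_integral_cong) (auto simp: indicator_def)
  thus "(\<integral>\<^sup>+x. ennreal ((c * indicator S x)\<^sup>2) \<partial>M) < \<infinity>"
    using assms by (simp add: nn_integral_cmult_indicator ennreal_mult_less_top)
qed (use assms in measurable)

text \<open>By |f| <= 1 + f^2 on a set of finite measure.\<close>

lemma in_L2_integrable:
  assumes f: "in_L2 M f" and S: "S \<in> sets M" "emeasure M S < \<infinity>" and off: "\<And>x. x \<in> space M \<Longrightarrow> x \<notin> S \<Longrightarrow> f x = 0"
  shows "integrable M f"
proof -
  note S(1)[measurable] in_L2_measurable[OF f, measurable]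
  have "integrable M (\<lambda>x. indicator S x + (f x)\<^sup>2)" using S f unfolding in_L2_def by (auto simp: integrable_real_indicator)
  thus ?thesis
  proof (rule Bochner_Integration.integrable_bound)
    show "AE x in M. norm (f x) \<le> norm (indicator S x + (f x)\<^sup>2)"
    proof (rule AE_I2)
      fix x assume x: "x \<in> space M"
      have "0 \<le> (\<bar>f x\<bar> - 1/2)\<^sup>2" by simp
      hence "\<bar>f x\<bar> \<le> 1 + (f x)\<^sup>2" by (simp add: power2_eq_square algebra_simps)
      thus "norm (f x) \<le> norm (indicator S x + (f x)\<^sup>2)" using off[OF x] by (cases "x \<in> S") auto
    qed
  qed measurable
qed

section \<open>Calderon-Zygmund operators: additivity, atoms and oscillation\<close>

locale cz_op = kernel +
  fixes T :: "('a \<Rightarrow> real) \<Rightarrow> 'a \<Rightarrow> real" and \<beta> :: real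
  assumes T_L2: "in_L2 M f \<Longrightarrow> in_L2 M (T f)"
    and T_linear: "in_L2 M f \<Longrightarrow> in_L2 M g \<Longrightarrow> AE x in M. T (\<lambda>y. a * f y + b * g y) x = a * T f x + b * T g x"
    and beta_nonneg: "0 \<le> \<beta>"
    and T_bound: "in_L2 M f \<Longrightarrow> (\<integral>\<^sup>+x. ennreal ((T f x)\<^sup>2) \<partial>M) \<le> ennreal \<beta> * (\<integral>\<^sup>+x. ennreal ((f x)\<^sup>2) \<partial>M)"
    and T_kernel: "in_L2 M f \<Longrightarrow> AE x in M. x \<notin> ess_support M \<rho> f \<longrightarrow> T f x = (\<integral>y. K x y * f y \<partial>M)"
begin

lemma T_add: "in_L2 M f \<Longrightarrow> in_L2 M g \<Longrightarrow> AE x in M. T (\<lambda>y. f y + g y) x = T f x + T g x"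
  using T_linear[of f g 1 1] by simp

lemma T_diff: "in_L2 M f \<Longrightarrow> in_L2 M g \<Longrightarrow> AE x in M. T (\<lambda>y. f y - g y) x = T f x - T g x"
  using T_linear[of f g 1 "-1"] by simp

lemma T_AE_zero:
  assumes "in_L2 M f" "AE x in M. f x = 0"
  shows "AE x in M. T f x = 0"
proof -
  have "(\<integral>\<^sup>+x. ennreal ((f x)\<^sup>2) \<partial>M) = (\<integral>\<^sup>+x. 0 \<partial>M)"
    using assms(2) by (intro nn_integral_cong_AE, eventually_elim) simp
  hence "(\<integral>\<^sup>+x. ennreal ((T f x)\<^sup>2) \<partial>M) = 0" using T_bound[OF assms(1)] by simp
  moreover note in_L2_measurable[OF T_L2[OF assms(1)], measurable]
  ultimately have "AE x in M. ennreal ((T f x)\<^sup>2) = 0" by (subst (asm) nn_integral_0_iff_AE) auto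
  thus ?thesis by eventually_elim simp
qed

lemma T_sum:
  assumes "finite I" "\<And>i. i \<in> I \<Longrightarrow> in_L2 M (f i)"
  shows "AE x in M. T (\<lambda>y. \<Sum>i\<in>I. f i y) x = (\<Sum>i\<in>I. T (f i) x)"
  using assms
proof (induction I)
  case empty
  show ?case using T_AE_zero[OF in_L2_zero] by simp
next
  case (insert i I)
  hence *: "in_L2 M (f i)" "in_L2 M (\<lambda>y. \<Sum>i\<in>I. f i y)" by (auto intro: in_L2_sum)
  have "AE x in M. T (\<lambda>y. \<Sum>i\<in>I. f i y) x = (\<Sum>i\<in>I. T (f i) x)" using insert by simp
  with T_add[OF *] show ?case by eventually_elim (use insert in simp)
qed

lemma T_Chebyshev:
  assumes f: "in_L2 M f" and t: "0 < t"
  shows "emeasure M {x \<in> space M. t < \<bar>T f x\<bar>} \<le> ennreal (\<beta> / t\<^sup>2) * (\<integral>\<^sup>+x. ennreal ((f x)\<^sup>2) \<partial>M)"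
proof -
  note in_L2_measurable[OF T_L2[OF f], measurable]
  have "{x \<in> space M. t < \<bar>T f x\<bar>} \<subseteq> {x \<in> space M. ennreal (t\<^sup>2) < ennreal ((T f x)\<^sup>2)}"
  proof safe
    fix x assume "t < \<bar>T f x\<bar>"
    hence "t\<^sup>2 < \<bar>T f x\<bar>\<^sup>2" using t by (intro power_strict_mono) auto
    thus "ennreal (t\<^sup>2) < ennreal ((T f x)\<^sup>2)" by (simp add: ennreal_less_iff)
  qed
  hence "emeasure M {x \<in> space M. t < \<bar>T f x\<bar>} \<le> emeasure M {x \<in> space M. ennreal (t\<^sup>2) < ennreal ((T f x)\<^sup>2)}"
    by (rule emeasure_mono) measurable
  also have "\<dots> \<le> ennreal (1 / t\<^sup>2) * (\<integral>\<^sup>+x. ennreal ((T f x)\<^sup>2) \<partial>M)"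
    using t by (intro emeasure_superlevel_le) auto
  also have "ennreal (1 / t\<^sup>2) * (\<integral>\<^sup>+x. ennreal ((T f x)\<^sup>2) \<partial>M) \<le> ennreal (1 / t\<^sup>2) * (ennreal \<beta> * (\<integral>\<^sup>+x. ennreal ((f x)\<^sup>2) \<partial>M))"
    by (intro mult_left_mono T_bound f) auto
  also have "\<dots> = ennreal (\<beta> / t\<^sup>2) * (\<integral>\<^sup>+x. ennreal ((f x)\<^sup>2) \<partial>M)"
    using beta_nonneg by (simp add: mult.assoc[symmetric] ennreal_mult[symmetric])
  finally show ?thesis .
qed

text \<open>Off the ball of radius \<open>A2 * s\<close> the kernel regularity applies to all points of the concentric ball
  of radius \<open>s\<close>.\<close>

definition A2 :: real where "A2 = 2 * \<kappa> + 1 / \<eta>"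

lemma A2_ge: "2 * \<kappa> \<le> A2" "1 \<le> A2" "1 \<le> \<eta> * A2" "0 < A2"
  unfolding A2_def using kappa_ge_1 eta_pos by (auto simp: field_simps add_increasing add_pos_pos)

lemma not_in_ess_support:
  assumes "0 < r" "\<And>y. y \<in> ball x r \<Longrightarrow> f y = 0"
  shows "x \<notin> ess_support M \<rho> f"
  unfolding ess_support_def using assms by auto

text \<open>As b has mean zero, the constant K x c may be subtracted from the kernel. Regularity in
  the second variable then yields decay of order \<eta> away from c, which
  \<open>tail_integral_le\<close> integrates.\<close>

lemma atom_bound:
  assumes c: "c \<in> space M" and s: "0 < s" and b: "in_L2 M b" and supp: "\<And>y. y \<notin> ball c s \<Longrightarrow> b y = 0"
    and mean: "(\<integral>y. b y \<partial>M) = 0"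
  shows "(\<integral>\<^sup>+x\<in>{x. A2 * s \<le> \<rho> c x}. ennreal \<bar>T b x\<bar> \<partial>M) \<le> ennreal (ctail \<eta>) * (\<integral>\<^sup>+y. ennreal \<bar>b y\<bar> \<partial>M)"
proof -
  define a where "a = A2 * s"
  have a: "0 < a" "s \<le> a" "s \<le> \<eta> * a" "2 * \<kappa> * s \<le> a"
    unfolding a_def using A2_ge s mult_right_mono[of 1 "\<eta> * A2" s] by (auto simp: ac_simps)
  note in_L2_measurable[OF b, measurable] in_L2_measurable[OF T_L2[OF b], measurable]
  have ib: "integrable M b" by (rule in_L2_integrable[OF b ball_sets[OF c] ball_finite[OF c s]]) (use supp in auto)
  define m where "m = (\<integral>\<^sup>+y. ennreal \<bar>b y\<bar> \<partial>M)"
  have m: "m = ennreal (\<integral>y. \<bar>b y\<bar> \<partial>M)" unfolding m_def using ib by (intro nn_integral_eq_integral) auto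
  have "AE x in M. a \<le> \<rho> c x \<longrightarrow> ennreal \<bar>T b x\<bar> \<le> ennreal ((a / \<rho> c x) powr \<eta> / V c (\<rho> c x)) * m"
    using T_kernel[OF b] AE_space
  proof eventually_elim
    case (elim x)
    show ?case
    proof
      assume x: "a \<le> \<rho> c x"
      have xs: "x \<in> space M" by fact
      \<comment> \<open>The ball of radius s about x misses the ball that carries b, because 2
        \<kappa> s <= a. Hence x is outside the support of b and the kernel formula holds
        there.\<close>
      have far: "y \<notin> ball c s" if "y \<in> ball x s" for y
      proof
        assume y: "y \<in> ball c s"
        have "\<rho> c x \<le> \<kappa> * (\<rho> c y + \<rho> y x)" using c xs y by (intro rho_triangle) (auto simp: mem_ball)
        also have "\<dots> < \<kappa> * (s + s)" using y that xs rho_sym[of x y] kappa_ge_1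
          by (intro mult_strict_left_mono add_strict_mono) (auto simp: mem_ball)
        finally show False using x a by simp
      qed
      have "x \<notin> ess_support M \<rho> b" by (rule not_in_ess_support[OF s]) (use far supp in blast)
      hence Tb: "T b x = (\<integral>y. K x y * b y \<partial>M)" using elim by blast
      have bx: "b x = 0" using supp far center_mem_ball[OF xs s] by blast
      note kernel_measurable[OF xs in_L2_measurable[OF b] bx, measurable]
      define G where "G = (a / \<rho> c x) powr \<eta> / V c (\<rho> c x)"
      have cx: "c \<noteq> x" using x a rho_eq_0_iff[OF c c] by auto
      have G0: "0 \<le> G" unfolding G_def V_def by simp
      have Kd: "\<bar>K x y * b y - K x c * b y\<bar> \<le> G * \<bar>b y\<bar>" for y
      proof (cases "y \<in> ball c s")
        case True
        hence y: "y \<in> space M" "\<rho> c y < s" by (auto simp: mem_ball)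
        have "\<bar>K x y - K x c\<bar> \<le> (\<rho> y c / \<rho> c x) powr \<eta> / V c (\<rho> c x)"
        proof (rule kernel_smooth2[OF c xs y(1) cx])
          show "y \<noteq> x" using y x a by auto
          have "s \<le> \<eta> * \<rho> c x" using a x eta_pos mult_left_mono[of a "\<rho> c x" \<eta>] by linarith
          thus "\<rho> c y \<le> \<eta> * \<rho> c x" using y by linarith
        qed
        also have "\<dots> \<le> G" unfolding G_def
          using y a x rho_sym[OF y(1) c] rho_nonneg[OF y(1) c] eta_pos
          by (intro divide_right_mono powr_mono2) (auto simp: V_def)
        finally have "\<bar>K x y - K x c\<bar> * \<bar>b y\<bar> \<le> G * \<bar>b y\<bar>" by (rule mult_right_mono) simp
        thus ?thesis by (simp add: abs_mult[symmetric] left_diff_distrib)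
      qed (use supp in simp)
      have i1: "integrable M (\<lambda>y. K x c * b y)" using ib by simp
      have i2: "integrable M (\<lambda>y. K x y * b y - K x c * b y)"
      proof (rule Bochner_Integration.integrable_bound)
        show "integrable M (\<lambda>y. G * \<bar>b y\<bar>)" using ib by simp
      qed (use Kd G0 in \<open>auto simp: abs_mult\<close>)
      have "(\<integral>y. K x y * b y - K x c * b y \<partial>M) = (\<integral>y. K x y * b y \<partial>M) - (\<integral>y. K x c * b y \<partial>M)"
        using Bochner_Integration.integrable_add[OF i1 i2] i1 by (intro Bochner_Integration.integral_diff) simp_all
      hence "T b x = (\<integral>y. K x y * b y - K x c * b y \<partial>M)" using mean Tb by simp
      hence "\<bar>T b x\<bar> \<le> (\<integral>y. \<bar>K x y * b y - K x c * b y\<bar> \<partial>M)"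
        using integral_norm_bound[of M "\<lambda>y. K x y * b y - K x c * b y"] by simp
      also have "\<dots> \<le> (\<integral>y. G * \<bar>b y\<bar> \<partial>M)"
        using i2 ib Kd by (intro integral_mono) auto
      also have "\<dots> = G * (\<integral>y. \<bar>b y\<bar> \<partial>M)" by simp
      finally show "ennreal \<bar>T b x\<bar> \<le> ennreal ((a / \<rho> c x) powr \<eta> / V c (\<rho> c x)) * m"
        unfolding m G_def[symmetric] using G0 by (simp add: ennreal_mult[symmetric] ennreal_leI)
    qed
  qed
  hence "(\<integral>\<^sup>+x\<in>{x. a \<le> \<rho> c x}. ennreal \<bar>T b x\<bar> \<partial>M)
    \<le> (\<integral>\<^sup>+x\<in>{x. a \<le> \<rho> c x}. ennreal ((a / \<rho> c x) powr \<eta> / V c (\<rho> c x)) * m \<partial>M)"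
    by (intro nn_integral_mono_AE) (auto elim!: eventually_mono simp: indicator_def)
  \<comment> \<open>The tail estimate is applied to the constant function m, all of whose averages
    equal m.\<close>
  also have "\<dots> \<le> ennreal (ctail \<eta>) * m"
    using c a eta_pos by (intro tail_integral_le) (auto simp: nn_integral_cmult_indicator)
  finally show ?thesis unfolding a_def m_def .
qed

text \<open>The counterpart of \<open>atom_bound\<close> with the roles of the variables exchanged:
  F vanishes near c, so T F is a kernel integral on the whole small ball, and regularity in the
  first variable compares it with the kernel integral at c.\<close>

lemma oscillation_bound:
  fixes m :: ennreal
  assumes c: "c \<in> space M" and s: "0 < s" and F: "in_L2 M F" "integrable M F" and supp: "\<And>y. y \<in> ball c (A2 * s) \<Longrightarrow> F y = 0"
    and avg: "\<And>R. A2 * s \<le> R \<Longrightarrow> (\<integral>\<^sup>+y\<in>ball c R. ennreal \<bar>F y\<bar> \<partial>M) \<le> m * emeasure M (ball c R)"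
  obtains k where "AE x in M. x \<in> ball c s \<longrightarrow> ennreal \<bar>T F x - k\<bar> \<le> ennreal (ctail \<eta>) * m"
proof -
  define a where "a = A2 * s"
  have a: "0 < a" "s \<le> a" "s \<le> \<eta> * a" "2 * \<kappa> * s \<le> a"
    unfolding a_def using A2_ge s mult_right_mono[of 1 "\<eta> * A2" s] by (auto simp: ac_simps)
  note in_L2_measurable[OF F(1), measurable] in_L2_measurable[OF T_L2[OF F(1)], measurable]
  \<comment> \<open>F vanishes near x, and off the ball of radius r the size condition bounds the
    kernel by a constant.\<close>
  have KF: "integrable M (\<lambda>y. K x y * F y)" if x: "x \<in> space M" and r: "0 < r" "\<And>y. y \<in> ball x r \<Longrightarrow> F y = 0" for x r
  proof -
    have "F x = 0" using r center_mem_ball[OF x r(1)] by blast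
    note kernel_measurable[OF x in_L2_measurable[OF F(1)] this, measurable]
    show ?thesis
    proof (rule Bochner_Integration.integrable_bound)
      show "integrable M (\<lambda>y. C\<^sub>K / V x r * \<bar>F y\<bar>)" using F by simp
      show "AE y in M. norm (K x y * F y) \<le> norm (C\<^sub>K / V x r * \<bar>F y\<bar>)"
      proof (rule AE_I2)
        fix y assume y: "y \<in> space M"
        show "norm (K x y * F y) \<le> norm (C\<^sub>K / V x r * \<bar>F y\<bar>)"
        proof (cases "y \<in> ball x r")
          case False
          hence ge: "r \<le> \<rho> x y" using y by (simp add: mem_ball)
          have "x \<noteq> y" using False center_mem_ball[OF x r(1)] by auto
          from kernel_size[OF x y this] have "\<bar>K x y\<bar> \<le> C\<^sub>K / V x (\<rho> x y)" .
          also have "\<dots> \<le> C\<^sub>K / V x r" using V_mono[OF x r(1) ge] V_pos[OF x r(1)] CK_nonneg by (intro divide_left_mono) auto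
          finally have "\<bar>K x y\<bar> * \<bar>F y\<bar> \<le> C\<^sub>K / V x r * \<bar>F y\<bar>" by (rule mult_right_mono) simp
          thus ?thesis using CK_nonneg V_pos[OF x r(1)] by (simp add: abs_mult)
        qed (use r in simp)
      qed
    qed measurable
  qed
  \<comment> \<open>The kernel integral at the centre is used in place of the value of T F at c,
    since T F is determined only almost everywhere.\<close>
  define k where "k = (\<integral>y. K c y * F y \<partial>M)"
  have Kc: "integrable M (\<lambda>y. K c y * F y)" using KF[OF c a(1)] supp unfolding a_def by blast
  have "AE x in M. x \<in> ball c s \<longrightarrow> ennreal \<bar>T F x - k\<bar> \<le> ennreal (ctail \<eta>) * m"
    using T_kernel[OF F(1)] AE_space
  proof eventually_elim
    case (elim x)
    show ?case
    proof
      assume "x \<in> ball c s"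
      hence x: "x \<in> space M" "\<rho> c x < s" by (auto simp: mem_ball)
      have near: "y \<in> ball c a" if "y \<in> ball x s" for y
      proof -
        have "\<rho> c y \<le> \<kappa> * (\<rho> c x + \<rho> x y)" using c x that by (intro rho_triangle) (auto simp: mem_ball)
        also have "\<dots> < \<kappa> * (s + s)" using x that kappa_ge_1
          by (intro mult_strict_left_mono add_strict_mono) (auto simp: mem_ball)
        finally show ?thesis using a that by (auto simp: mem_ball)
      qed
      have z: "F y = 0" if "y \<in> ball x s" for y using near[OF that] supp unfolding a_def by blast
      have "x \<notin> ess_support M \<rho> F" by (rule not_in_ess_support[OF s z])
      hence TF: "T F x = (\<integral>y. K x y * F y \<partial>M)" using elim by blast
      have Kx: "integrable M (\<lambda>y. K x y * F y)" by (rule KF[OF x(1) s z])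
      have "T F x - k = (\<integral>y. K x y * F y - K c y * F y \<partial>M)" unfolding TF k_def using Kx Kc by simp
      hence "ennreal \<bar>T F x - k\<bar> \<le> (\<integral>\<^sup>+y. ennreal \<bar>K x y * F y - K c y * F y\<bar> \<partial>M)"
        using integral_norm_bound_ennreal[of M "\<lambda>y. K x y * F y - K c y * F y"] Kx Kc by simp
      also have "\<dots> \<le> (\<integral>\<^sup>+y\<in>{y. a \<le> \<rho> c y}. ennreal ((a / \<rho> c y) powr \<eta> / V c (\<rho> c y)) * ennreal \<bar>F y\<bar> \<partial>M)"
      proof (rule nn_integral_mono)
        fix y assume y: "y \<in> space M"
        show "ennreal \<bar>K x y * F y - K c y * F y\<bar>
          \<le> ennreal ((a / \<rho> c y) powr \<eta> / V c (\<rho> c y)) * ennreal \<bar>F y\<bar> * indicator {y. a \<le> \<rho> c y} y"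
        proof (cases "y \<in> ball c a")
          case False
          hence ge: "a \<le> \<rho> c y" using y by (simp add: mem_ball)
          have cy: "c \<noteq> y" using False center_mem_ball[OF c a(1)] by auto
          have xy: "x \<noteq> y" using x ge a by auto
          have "\<rho> c x \<le> \<eta> * \<rho> c y" using a x ge eta_pos mult_left_mono[of a "\<rho> c y" \<eta>] by linarith
          from kernel_smooth1[OF c y x(1) cy xy this]
          have "\<bar>K x y - K c y\<bar> \<le> (\<rho> x c / \<rho> c y) powr \<eta> / V c (\<rho> c y)" .
          also have "\<dots> \<le> (a / \<rho> c y) powr \<eta> / V c (\<rho> c y)"
            using x a ge rho_sym[OF x(1) c] rho_nonneg[OF x(1) c] eta_pos
            by (intro divide_right_mono powr_mono2) (auto simp: V_def)
          finally have "\<bar>K x y - K c y\<bar> * \<bar>F y\<bar> \<le> (a / \<rho> c y) powr \<eta> / V c (\<rho> c y) * \<bar>F y\<bar>"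
            by (rule mult_right_mono) simp
          hence "ennreal \<bar>K x y * F y - K c y * F y\<bar> \<le> ennreal ((a / \<rho> c y) powr \<eta> / V c (\<rho> c y) * \<bar>F y\<bar>)"
            by (intro ennreal_leI) (simp add: abs_mult[symmetric] left_diff_distrib)
          also have "\<dots> = ennreal ((a / \<rho> c y) powr \<eta> / V c (\<rho> c y)) * ennreal \<bar>F y\<bar>"
            by (rule ennreal_mult) (auto simp: V_def)
          finally show ?thesis using ge by simp
        qed (use supp in \<open>simp add: a_def\<close>)
      qed
      also have "\<dots> \<le> ennreal (ctail \<eta>) * m"
        using c a eta_pos avg unfolding a_def by (intro tail_integral_le) auto
      finally show "ennreal \<bar>T F x - k\<bar> \<le> ennreal (ctail \<eta>) * m" .
    qed
  qed
  thus thesis by (rule that)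
qed

end

section \<open>The weak type (1,1) inequality\<close>

lemma countable_finite_exhaustion:
  assumes "countable \<P>"
  obtains F :: "nat \<Rightarrow> 'b set" where "\<And>n. finite (F n)" "\<And>n. F n \<subseteq> \<P>" "incseq F" "(\<Union>n. F n) = \<P>"
proof (cases "\<P> = {}")
  case True
  thus thesis using that[of "\<lambda>_. {}"] by simp
next
  case False
  have r: "range (from_nat_into \<P>) = \<P>" by (rule range_from_nat_into[OF False assms])
  define F where "F n = from_nat_into \<P> ` {..n}" for n :: nat
  have "F n \<subseteq> \<P>" for n unfolding F_def using r by blast
  moreover have "incseq F" unfolding F_def incseq_def by (auto intro!: image_mono)
  moreover have "(\<Union>n. F n) = \<P>" unfolding F_def using r by blast
  moreover have "finite (F n)" for n unfolding F_def by simp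
  ultimately show thesis using that by blast
qed

lemma emeasure_UN_le_finite:
  assumes "countable \<P>" "\<And>P. P \<in> \<P> \<Longrightarrow> X P \<in> sets M"
    and le: "\<And>F. finite F \<Longrightarrow> F \<subseteq> \<P> \<Longrightarrow> emeasure M (\<Union>P\<in>F. X P) \<le> c"
  shows "emeasure M (\<Union>P\<in>\<P>. X P) \<le> c"
proof -
  obtain F where F: "\<And>n. finite (F n)" "\<And>n. F n \<subseteq> \<P>" "incseq F" "(\<Union>n::nat. F n) = \<P>"
    using countable_finite_exhaustion[OF assms(1)] by metis
  define A where "A n = (\<Union>P\<in>F n. X P)" for n :: nat
  have U: "(\<Union>P\<in>\<P>. X P) = (\<Union>n. A n)" unfolding A_def F(4)[symmetric] by blast
  have XF: "X P \<in> sets M" if "P \<in> F n" for n P using assms(2) F(2)[of n] that by blast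
  have AM: "A n \<in> sets M" for n unfolding A_def using XF F(1) by (intro sets.finite_UN) auto
  have "incseq A" using F(3) unfolding A_def incseq_def by (intro allI impI UN_mono) auto
  hence "emeasure M (\<Union>P\<in>\<P>. X P) = (SUP n. emeasure M (A n))"
    unfolding U using AM by (intro SUP_emeasure_incseq[symmetric]) auto
  also have "\<dots> \<le> c" unfolding A_def using le F(1,2) by (intro SUP_least) auto
  finally show ?thesis .
qed

text \<open>Applied to the measure with density f^2: all but finitely many stopping cubes contribute
  little to the L2 norm of f.\<close>

lemma finite_subfamily_approx:
  assumes "countable \<P>" "\<P> \<subseteq> sets M" "emeasure M (space M) < \<infinity>" "0 < e"
  obtains F where "finite F" "F \<subseteq> \<P>" "emeasure M (\<Union>\<P> - \<Union>F) < e"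
proof -
  obtain F where F: "\<And>n. finite (F n)" "\<And>n. F n \<subseteq> \<P>" "incseq F" "(\<Union>n::nat. F n) = \<P>"
    using countable_finite_exhaustion[OF assms(1)] by metis
  define r where "r n = \<Union>\<P> - \<Union>(F n)" for n
  have FM: "\<Union>(F n) \<in> sets M" for n using F(1,2) assms(2) by (intro sets.finite_Union) blast+
  have rs: "r n \<in> sets M" for n
    unfolding r_def by (intro sets.Diff FM sets.countable_Union[OF assms(1,2)])
  have "(\<lambda>n. emeasure M (r n)) \<longlonglongrightarrow> emeasure M (\<Inter>n. r n)"
  proof (rule Lim_emeasure_decseq)
    show "range r \<subseteq> sets M" using rs by auto
    show "decseq r" using F(3) unfolding r_def decseq_def incseq_def by blast
    show "emeasure M (r i) \<noteq> \<infinity>" for i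
      using emeasure_space[of M "r i"] assms(3) by (auto simp: top_unique)
  qed
  moreover have "(\<Inter>n. r n) = {}" unfolding r_def F(4)[symmetric] by blast
  ultimately have "(\<lambda>n. emeasure M (r n)) \<longlonglongrightarrow> 0" by simp
  hence "\<forall>\<^sub>F n in sequentially. emeasure M (r n) < e" using assms(4) by (intro order_tendstoD) auto
  then obtain n where "emeasure M (r n) < e" by (auto simp: eventually_sequentially)
  thus thesis using that F(1,2) unfolding r_def by blast
qed

lemma sum_set_nn_integral:
  assumes "finite F" "disjoint F" "F \<subseteq> sets M" and h [measurable]: "h \<in> borel_measurable M"
  shows "(\<Sum>P\<in>F. \<integral>\<^sup>+x\<in>P. h x \<partial>M) = (\<integral>\<^sup>+x\<in>\<Union>F. h x \<partial>M)"
proof -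
  have P: "P \<in> sets M" if "P \<in> F" for P using assms(3) that by blast
  have U: "\<Union>F \<in> sets M" using assms(1) P by (intro sets.finite_Union) auto
  have "(\<Sum>P\<in>F. \<integral>\<^sup>+x\<in>P. h x \<partial>M) = (\<Sum>P\<in>F. emeasure (density M h) P)"
    using P by (intro sum.cong) (auto simp: emeasure_density)
  also have "\<dots> = emeasure (density M h) (\<Union>F)"
    using assms by (intro emeasure_Union_disjoint_finite[symmetric]) auto
  also have "\<dots> = (\<integral>\<^sup>+x\<in>\<Union>F. h x \<partial>M)" using U by (simp add: emeasure_density)
  finally show ?thesis .
qed

text \<open>This is \<open>emeasure_nested_le\<close> for t times \<open>M\<close> against
  \<open>density M h\<close>; overlaps cost nothing within one system.\<close>

lemma (in dyadic_system) nested_cubes_weak_type: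
  assumes "\<Q> \<subseteq> \<U>" and h [measurable]: "h \<in> borel_measurable M"
    and le: "\<And>Q. Q \<in> \<Q> \<Longrightarrow> t * emeasure M Q \<le> (\<integral>\<^sup>+x\<in>Q. h x \<partial>M)"
  shows "t * emeasure M (\<Union>\<Q>) \<le> (\<integral>\<^sup>+x\<in>\<Union>\<Q>. h x \<partial>M)"
proof -
  have cQ: "countable \<Q>" by (rule countable_subset[OF assms(1) countable_cubes])
  have QM: "Q \<in> sets M" if "Q \<in> \<Q>" for Q using that assms(1) cube_sets by blast
  have U: "\<Union>\<Q> \<in> sets M" using cQ QM by (intro sets.countable_Union) auto
  have "emeasure (density M (\<lambda>_. t)) (\<Union>\<Q>) \<le> emeasure (density M h) (\<Union>\<Q>)"
    by (rule emeasure_nested_le[OF cQ nested_subset[OF nested_cubes assms(1)]])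
      (use QM le in \<open>auto simp: emeasure_density nn_integral_cmult_indicator\<close>)
  thus ?thesis using U by (simp add: emeasure_density nn_integral_cmult_indicator)
qed

text \<open>The three summands pay for the good part, for the dilated stopping cubes and for the bad
  part. The factors 16 and 8 come from the level t/4: 16 = 4^2 by Chebyshev's inequality, and 8 = 4
  * 2 because an atom has norm at most twice the integral of |f| over its cube.\<close>

definition (in cz_op) weak_const :: "real \<Rightarrow> real \<Rightarrow> real" where
  "weak_const C e = 16 * \<beta> / e + dbl (A2 * C) + 8 * ctail \<eta>"

locale cz_dyadic = dyadic_system M \<rho> \<kappa> D \<delta> C\<^sub>0 \<epsilon> \<D> + cz_op M \<rho> \<kappa> D K \<eta> C\<^sub>K T \<beta>
  for M :: "'a measure" and \<rho> \<kappa> D \<delta> C\<^sub>0 \<epsilon> \<D> K \<eta> C\<^sub>K T \<beta>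
begin

abbreviation "cW \<equiv> weak_const C\<^sub>0 \<epsilon>"

definition average :: "('a \<Rightarrow> real) \<Rightarrow> 'a set \<Rightarrow> real" where
  "average f P = (\<integral>x. f x * indicator P x \<partial>M) / measure M P"

lemma average_bound:
  assumes P: "P \<in> \<U>" and f: "integrable M f"
  shows "ennreal \<bar>average f P\<bar> * emeasure M P \<le> (\<integral>\<^sup>+x\<in>P. ennreal \<bar>f x\<bar> \<partial>M)"
proof -
  note cube_sets[OF P, measurable]
  have "ennreal \<bar>average f P\<bar> * emeasure M P = ennreal (\<bar>average f P\<bar> * measure M P)"
    using emeasure_cube[OF P] by (simp add: ennreal_mult)
  also have "\<bar>average f P\<bar> * measure M P = norm (\<integral>x. f x * indicator P x \<partial>M)"
    unfolding average_def using measure_cube_pos[OF P] by (simp add: abs_mult)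
  also have "ennreal \<dots> \<le> (\<integral>\<^sup>+x. ennreal (norm (f x * indicator P x)) \<partial>M)"
    using f by (intro integral_norm_bound_ennreal integrable_mult_indicator[of P M f, simplified, unfolded mult.commute[of "indicator P _"]]) auto
  also have "\<dots> = (\<integral>\<^sup>+x\<in>P. ennreal \<bar>f x\<bar> \<partial>M)"
    by (intro nn_integral_cong) (auto simp: indicator_def)
  finally show ?thesis .
qed

text \<open>T is additive over finite sums, but there may be infinitely many stopping cubes.
  Therefore only finitely many atoms \<open>b P\<close> are split off; on the remaining cubes f is
  small in L2 and is handled by Chebyshev's inequality with an arbitrary error e. The hypothesis
  \<open>avg\<close> places the initial cube R below the stopping level.\<close>

lemma weak_type_11:
  assumes R: "R \<in> \<U>" and f: "in_L2 M f" and supp: "\<And>x. x \<notin> R \<Longrightarrow> f x = 0" and t: "0 < t"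
    and avg: "(\<integral>\<^sup>+x. ennreal \<bar>f x\<bar> \<partial>M) \<le> ennreal t * emeasure M R"
  shows "emeasure M {x \<in> space M. t < \<bar>T f x\<bar>} \<le> ennreal (cW / t) * (\<integral>\<^sup>+x. ennreal \<bar>f x\<bar> \<partial>M)"
proof -
  note in_L2_measurable[OF f, measurable] cube_sets[OF R, measurable]
  have fi: "integrable M f" by (rule in_L2_integrable[OF f cube_sets[OF R] cube_finite[OF R]]) (use supp in auto)
  define h where "h x = ennreal \<bar>f x\<bar>" for x
  have h [measurable]: "h \<in> borel_measurable M" unfolding h_def by measurable
  define I where "I P = (\<integral>\<^sup>+x\<in>P. h x \<partial>M)" for P
  define I0 where "I0 = (\<integral>\<^sup>+x. h x \<partial>M)"
  have I_le: "I P \<le> I0" for P unfolding I_def I0_def by (intro nn_integral_mono) (auto simp: indicator_def)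
  have IR: "I R = I0" unfolding I_def I0_def h_def using supp by (intro nn_integral_cong) (auto simp: indicator_def)
  obtain \<P> where \<P>: "\<P> \<subseteq> \<U>" "disjoint \<P>" "\<And>P. P \<in> \<P> \<Longrightarrow> P \<subseteq> R"
    "\<And>P. P \<in> \<P> \<Longrightarrow> ennreal t * emeasure M P \<le> I P"
    "\<And>P. P \<in> \<P> \<Longrightarrow> I P \<le> ennreal (t / \<epsilon>) * emeasure M P"
    "AE x in M. x \<in> R - \<Union>\<P> \<longrightarrow> h x \<le> ennreal t"
    using cz_decomposition[OF R h t] avg IR unfolding I_def I0_def h_def by auto
  have cP: "countable \<P>" by (rule countable_subset[OF \<P>(1) countable_cubes])
  have PM [measurable]: "P \<in> sets M" if "P \<in> \<P>" for P using \<P>(1) cube_sets that by blast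
  have UPM [measurable]: "\<Union>\<P> \<in> sets M" using cP PM by (intro sets.countable_Union) auto
  have sumI: "(\<Sum>P\<in>F. I P) = I (\<Union>F)" if "finite F" "F \<subseteq> \<P>" for F
    unfolding I_def using that PM \<P>(2) by (intro sum_set_nn_integral) (auto simp: disjoint_def)
  define X where "X P = ball (cen P) (A2 * (C\<^sub>0 * rad P))" for P
  have XM: "X P \<in> sets M" if "P \<in> \<P>" for P unfolding X_def using \<P>(1) that by (intro ball_sets cen_space) auto
  \<comment> \<open>Off \<Omega> a point is far enough from the centres of all stopping cubes for
    \<open>atom_bound\<close> to apply to every atom.\<close>
  define \<Omega> where "\<Omega> = (\<Union>P\<in>\<P>. X P)"
  have OM [measurable]: "\<Omega> \<in> sets M" unfolding \<Omega>_def using cP XM by (intro sets.countable_UN') auto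
  have Omega: "emeasure M \<Omega> \<le> ennreal (dbl (A2 * C\<^sub>0) / t) * I0"
    unfolding \<Omega>_def
  proof (rule emeasure_UN_le_finite[OF cP XM])
    fix F assume F: "finite F" "F \<subseteq> \<P>"
    have "emeasure M (\<Union>P\<in>F. X P) \<le> (\<Sum>P\<in>F. emeasure M (X P))"
      using F XM by (intro emeasure_subadditive_finite) auto
    also have "\<dots> \<le> (\<Sum>P\<in>F. ennreal (dbl (A2 * C\<^sub>0) / t) * I P)"
    proof (rule sum_mono)
      fix P assume "P \<in> F"
      hence P: "P \<in> \<P>" "P \<in> \<U>" using F \<P>(1) by auto
      have "emeasure M (X P) = ennreal (V (cen P) ((A2 * C\<^sub>0) * rad P))"
        unfolding X_def using cen_space[OF P(2)] rad_pos[of P] C0_pos A2_ge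
        by (subst emeasure_ball) (auto simp: mult.assoc)
      also have "\<dots> \<le> ennreal (dbl (A2 * C\<^sub>0) * measure M P)"
      proof (rule ennreal_leI)
        have "V (cen P) ((A2 * C\<^sub>0) * rad P) \<le> dbl (A2 * C\<^sub>0) * V (cen P) (rad P)"
          using C0_pos A2_ge by (intro V_scale cen_space P rad_pos) auto
        also have "\<dots> \<le> dbl (A2 * C\<^sub>0) * measure M P"
          using V_le_cube[OF P(2)] dbl_pos by (intro mult_left_mono) (auto intro: less_imp_le)
        finally show "V (cen P) ((A2 * C\<^sub>0) * rad P) \<le> dbl (A2 * C\<^sub>0) * measure M P" .
      qed
      also have "\<dots> = ennreal (dbl (A2 * C\<^sub>0) / t) * (ennreal t * emeasure M P)"
        unfolding emeasure_cube[OF P(2)] using t dbl_pos[of "A2 * C\<^sub>0"] by (simp add: ennreal_mult[symmetric])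
      also have "\<dots> \<le> ennreal (dbl (A2 * C\<^sub>0) / t) * I P" by (intro mult_left_mono \<P> P) auto
      finally show "emeasure M (X P) \<le> ennreal (dbl (A2 * C\<^sub>0) / t) * I P" .
    qed
    also have "\<dots> = ennreal (dbl (A2 * C\<^sub>0) / t) * I (\<Union>F)" unfolding sum_distrib_left[symmetric] sumI[OF F] ..
    also have "\<dots> \<le> ennreal (dbl (A2 * C\<^sub>0) / t) * I0" by (intro mult_left_mono I_le) auto
    finally show "emeasure M (\<Union>P\<in>F. X P) \<le> ennreal (dbl (A2 * C\<^sub>0) / t) * I0" .
  qed
  define b where "b P x = (f x - average f P) * indicator P x" for P x
  have bL2: "in_L2 M (b P)" if P: "P \<in> \<P>" for P
  proof -
    have "in_L2 M (\<lambda>x. f x * indicator P x - average f P * indicator P x)"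
      using P \<P>(1) by (intro in_L2_diff in_L2_indicator in_L2_const_indicator f PM cube_finite) auto
    thus ?thesis unfolding b_def by (simp add: left_diff_distrib)
  qed
  have av: "ennreal \<bar>average f P\<bar> * emeasure M P \<le> I P" if P: "P \<in> \<P>" for P
    using average_bound[OF _ fi, of P] P \<P>(1) unfolding I_def h_def by auto
  have b_atom: "(\<integral>\<^sup>+x\<in>{x. A2 * (C\<^sub>0 * rad P) \<le> \<rho> (cen P) x}. ennreal \<bar>T (b P) x\<bar> \<partial>M) \<le> ennreal (2 * ctail \<eta>) * I P"
    if P: "P \<in> \<P>" for P
  proof -
    have PU: "P \<in> \<U>" using P \<P>(1) by blast
    note PM[OF P, measurable]
    have ifP: "integrable M (\<lambda>x. f x * indicator P x)"
      using fi PM[OF P] by (rule integrable_real_mult_indicator[rotated])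
    have iP: "integrable M (\<lambda>x. average f P * indicator P x)"
      using PM[OF P] cube_finite[OF PU] by (intro integrable_mult_right) (auto simp: integrable_real_indicator)
    have "(\<integral>x. b P x \<partial>M) = (\<integral>x. f x * indicator P x \<partial>M) - (\<integral>x. average f P * indicator P x \<partial>M)"
      unfolding b_def left_diff_distrib using ifP iP by (rule Bochner_Integration.integral_diff)
    also have "\<dots> = 0" using measure_cube_pos[OF PU] sets.sets_into_space[OF PM[OF P]]
      by (simp add: average_def Int_absorb2)
    finally have mean: "(\<integral>x. b P x \<partial>M) = 0" .
    have "(\<integral>\<^sup>+x\<in>{x. A2 * (C\<^sub>0 * rad P) \<le> \<rho> (cen P) x}. ennreal \<bar>T (b P) x\<bar> \<partial>M) \<le> ennreal (ctail \<eta>) * (\<integral>\<^sup>+x. ennreal \<bar>b P x\<bar> \<partial>M)"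
    proof (rule atom_bound[OF cen_space[OF PU] _ bL2[OF P] _ mean])
      show "0 < C\<^sub>0 * rad P" using C0_pos rad_pos by simp
      show "b P y = 0" if "y \<notin> ball (cen P) (C\<^sub>0 * rad P)" for y
        using cube_subset_ball[OF PU] that by (auto simp: b_def indicator_def)
    qed
    also have "(\<integral>\<^sup>+x. ennreal \<bar>b P x\<bar> \<partial>M) \<le> (\<integral>\<^sup>+x. h x * indicator P x + ennreal \<bar>average f P\<bar> * indicator P x \<partial>M)"
    proof (rule nn_integral_mono)
      fix x
      have "ennreal \<bar>f x - average f P\<bar> \<le> ennreal \<bar>f x\<bar> + ennreal \<bar>average f P\<bar>"
        by (simp add: ennreal_plus[symmetric] del: ennreal_plus)
      thus "ennreal \<bar>b P x\<bar> \<le> h x * indicator P x + ennreal \<bar>average f P\<bar> * indicator P x"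
        by (simp add: b_def h_def indicator_def)
    qed
    also have "\<dots> = I P + ennreal \<bar>average f P\<bar> * emeasure M P"
      unfolding I_def by (subst nn_integral_add) (auto simp: nn_integral_cmult_indicator)
    also have "\<dots> \<le> I P + I P" by (intro add_left_mono av P)
    also have "ennreal (ctail \<eta>) * (I P + I P) = ennreal (2 * ctail \<eta>) * I P"
      using ctail_pos[OF eta_pos] by (simp add: ennreal_mult mult_2[symmetric] ac_simps)
    finally show ?thesis by (simp add: mult_left_mono)
  qed
  define E where "E = {x \<in> space M. t < \<bar>T f x\<bar>}"
  have main: "emeasure M E \<le> ennreal (cW / t) * I0 + ennreal e" if e: "0 < e" for e
  proof -
    \<comment> \<open>Then (\<beta> / (t/4)^2) * e' = e * \<beta> / (\<beta> + 1) <= e; the summand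
      1 allows \<beta> = 0.\<close>
    define e' where "e' = e * (t / 4)\<^sup>2 / (\<beta> + 1)"
    have e': "0 < e'" unfolding e'_def using e t beta_nonneg by simp
    obtain F where F: "finite F" "F \<subseteq> \<P>" "emeasure (density M (\<lambda>x. ennreal ((f x)\<^sup>2))) (\<Union>\<P> - \<Union>F) < ennreal e'"
    proof (rule finite_subfamily_approx[OF cP])
      show "\<P> \<subseteq> sets (density M (\<lambda>x. ennreal ((f x)\<^sup>2)))" using PM by auto
      have "emeasure (density M (\<lambda>x. ennreal ((f x)\<^sup>2))) (space M) = (\<integral>\<^sup>+x. ennreal ((f x)\<^sup>2) \<partial>M)"
        by (subst emeasure_density) (auto intro!: nn_integral_cong)
      thus "emeasure (density M (\<lambda>x. ennreal ((f x)\<^sup>2))) (space (density M (\<lambda>x. ennreal ((f x)\<^sup>2)))) < \<infinity>"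
        using f by (simp add: in_L2_iff)
      show "0 < ennreal e'" using e' by simp
    qed
    have FM [measurable]: "\<Union>F \<in> sets M" using F PM by (intro sets.finite_Union) auto
    define r where "r x = f x * indicator (\<Union>\<P> - \<Union>F) x" for x
    have rL2: "in_L2 M r" unfolding r_def by (intro in_L2_indicator f) measurable
    define bF where "bF x = (\<Sum>P\<in>F. b P x)" for x
    have bFL2: "in_L2 M bF" unfolding bF_def using F bL2 by (intro in_L2_sum) auto
    \<comment> \<open>g is f off all stopping cubes, the average of f on a cube of F, and 0 on the
      other stopping cubes. Hence |g| <= t / \<epsilon> almost everywhere, and g^2 <= (t /
      \<epsilon>) |g| turns the L2 bound into an L1 bound.\<close>
    define g where "g x = f x - bF x - r x" for x
    have gL2: "in_L2 M g" unfolding g_def by (intro in_L2_diff f bFL2 rL2)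
    have bF_in: "bF x = f x - average f P" if "P \<in> F" "x \<in> P" for x P
    proof -
      have "bF x = (\<Sum>Q\<in>F. if Q = P then b P x else 0)"
        unfolding bF_def
      proof (rule sum.cong[OF refl])
        fix Q assume "Q \<in> F"
        thus "b Q x = (if Q = P then b P x else 0)"
          using F(2) \<P>(2) that unfolding b_def disjoint_def by (auto simp: indicator_def)
      qed
      also have "\<dots> = b P x" using F(1) that by simp
      finally show ?thesis using that by (simp add: b_def)
    qed
    have bF_out: "bF x = 0" if "x \<notin> \<Union>F" for x
      unfolding bF_def b_def using that by (intro sum.neutral) (auto simp: indicator_def)
    have avt: "\<bar>average f P\<bar> \<le> t / \<epsilon>" if P: "P \<in> \<P>" for P
    proof -
      have PU: "P \<in> \<U>" using P \<P>(1) by blast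
      have "ennreal \<bar>average f P\<bar> * emeasure M P \<le> ennreal (t / \<epsilon>) * emeasure M P"
        using av[OF P] \<P>(5)[OF P] by (rule order_trans)
      hence "ennreal (\<bar>average f P\<bar> * measure M P) \<le> ennreal (t / \<epsilon> * measure M P)"
        unfolding emeasure_cube[OF PU] using t eps_pos by (simp add: ennreal_mult[symmetric])
      hence "\<bar>average f P\<bar> * measure M P \<le> t / \<epsilon> * measure M P"
        using t eps_pos by (subst (asm) ennreal_le_iff) auto
      thus ?thesis using measure_cube_pos[OF PU] by (rule mult_right_le_imp_le)
    qed
    have tt: "t \<le> t / \<epsilon>" using t eps_pos eps_less_1 by (simp add: field_simps)
    have g2: "(\<integral>\<^sup>+x. ennreal ((g x)\<^sup>2) \<partial>M) \<le> ennreal (t / \<epsilon>) * I0"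
    proof -
      have "(\<integral>\<^sup>+x. ennreal ((g x)\<^sup>2) \<partial>M)
        \<le> (\<integral>\<^sup>+x. ennreal (t / \<epsilon>) * (h x * indicator (R - \<Union>\<P>) x) + (\<Sum>P\<in>F. ennreal (t / \<epsilon> * \<bar>average f P\<bar>) * indicator P x) \<partial>M)"
      proof (rule nn_integral_mono_AE)
        show "AE x in M. ennreal ((g x)\<^sup>2)
          \<le> ennreal (t / \<epsilon>) * (h x * indicator (R - \<Union>\<P>) x) + (\<Sum>P\<in>F. ennreal (t / \<epsilon> * \<bar>average f P\<bar>) * indicator P x)"
          using \<P>(6)
        proof eventually_elim
          case (elim x)
          consider P where "P \<in> F" "x \<in> P" | "x \<in> \<Union>\<P> - \<Union>F" | "x \<in> R - \<Union>\<P>" | "x \<notin> \<Union>\<P>" "x \<notin> R" by blast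
          thus ?case
          proof cases
            case 1
            have "r x = 0" using 1 by (auto simp: r_def indicator_def)
            hence "g x = average f P" unfolding g_def using bF_in[OF 1] by simp
            hence "(g x)\<^sup>2 \<le> t / \<epsilon> * \<bar>average f P\<bar>"
              using avt[of P] 1 F(2) mult_right_mono[of "\<bar>average f P\<bar>" "t / \<epsilon>" "\<bar>average f P\<bar>"]
              by (auto simp: power2_eq_square abs_mult[symmetric] simp del: times_divide_eq_left)
            hence "ennreal ((g x)\<^sup>2) \<le> ennreal (t / \<epsilon> * \<bar>average f P\<bar>) * indicator P x"
              using 1 by (simp add: ennreal_leI)
            also have "\<dots> \<le> (\<Sum>P\<in>F. ennreal (t / \<epsilon> * \<bar>average f P\<bar>) * indicator P x)"
              using F(1) 1 by (intro member_le_sum) auto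
            finally show ?thesis by (simp add: add_increasing)
          next
            case 2
            hence "g x = 0" unfolding g_def using bF_out[of x] by (simp add: r_def)
            thus ?thesis by simp
          next
            case 3
            hence "x \<notin> \<Union>F" using F(2) by blast
            hence "g x = f x" unfolding g_def using 3 bF_out[of x] by (simp add: r_def)
            moreover have "\<bar>f x\<bar> \<le> t / \<epsilon>" using elim 3 tt t by (auto simp: h_def ennreal_le_iff)
            ultimately have "(g x)\<^sup>2 \<le> t / \<epsilon> * \<bar>f x\<bar>"
              using mult_right_mono[of "\<bar>f x\<bar>" "t / \<epsilon>" "\<bar>f x\<bar>"]
              by (auto simp: power2_eq_square abs_mult[symmetric] simp del: times_divide_eq_left)
            hence "ennreal ((g x)\<^sup>2) \<le> ennreal (t / \<epsilon>) * (h x * indicator (R - \<Union>\<P>) x)"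
              using 3 t eps_pos by (simp add: h_def ennreal_mult[symmetric] ennreal_leI)
            thus ?thesis by (simp add: add_increasing2)
          next
            case 4
            hence "x \<notin> \<Union>F" using F(2) by blast
            hence "g x = 0" unfolding g_def using 4 bF_out[of x] supp by (simp add: r_def)
            thus ?thesis by simp
          qed
        qed
      qed
      also have "\<dots> = ennreal (t / \<epsilon>) * I (R - \<Union>\<P>) + (\<Sum>P\<in>F. ennreal (t / \<epsilon> * \<bar>average f P\<bar>) * emeasure M P)"
      proof -
        have m: "(\<lambda>x. ennreal (t / \<epsilon> * \<bar>average f P\<bar>) * indicator P x) \<in> borel_measurable M" if "P \<in> F" for P
        proof -
          have [measurable]: "P \<in> sets M" using PM that F(2) by blast
          show ?thesis by measurable
        qed
        show ?thesis
          unfolding I_def using m F(2) PM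
          by (subst nn_integral_add)
            (auto intro!: borel_measurable_sum simp: nn_integral_cmult nn_integral_sum nn_integral_cmult_indicator subset_iff intro!: sum.cong)
      qed
      also have "\<dots> \<le> ennreal (t / \<epsilon>) * I (R - \<Union>\<P>) + ennreal (t / \<epsilon>) * I (\<Union>F)"
      proof (rule add_left_mono)
        have "(\<Sum>P\<in>F. ennreal (t / \<epsilon> * \<bar>average f P\<bar>) * emeasure M P) \<le> (\<Sum>P\<in>F. ennreal (t / \<epsilon>) * I P)"
        proof (rule sum_mono)
          fix P assume "P \<in> F"
          hence P: "P \<in> \<P>" using F by auto
          have "ennreal (t / \<epsilon> * \<bar>average f P\<bar>) * emeasure M P = ennreal (t / \<epsilon>) * (ennreal \<bar>average f P\<bar> * emeasure M P)"
            using t eps_pos by (subst ennreal_mult) (auto simp: mult.assoc)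
          also have "\<dots> \<le> ennreal (t / \<epsilon>) * I P" by (intro mult_left_mono av P) auto
          finally show "ennreal (t / \<epsilon> * \<bar>average f P\<bar>) * emeasure M P \<le> ennreal (t / \<epsilon>) * I P" .
        qed
        thus "(\<Sum>P\<in>F. ennreal (t / \<epsilon> * \<bar>average f P\<bar>) * emeasure M P) \<le> ennreal (t / \<epsilon>) * I (\<Union>F)"
          unfolding sum_distrib_left[symmetric] sumI[OF F(1,2)] .
      qed
      also have "\<dots> = ennreal (t / \<epsilon>) * (I (R - \<Union>\<P>) + I (\<Union>F))" by (simp add: distrib_left)
      also have "I (R - \<Union>\<P>) + I (\<Union>F) \<le> I0"
      proof -
        have "I (R - \<Union>\<P>) + I (\<Union>F) = (\<integral>\<^sup>+x. h x * indicator (R - \<Union>\<P>) x + h x * indicator (\<Union>F) x \<partial>M)"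
          unfolding I_def by (subst nn_integral_add) auto
        also have "\<dots> \<le> I0" unfolding I0_def using F(2) by (intro nn_integral_mono) (auto simp: indicator_def)
        finally show ?thesis .
      qed
      finally show ?thesis by (simp add: mult_left_mono)
    qed
    \<comment> \<open>Three terms of absolute value at most t/4 cannot add up to more than
      t.\<close>
    define Eg where "Eg = {x \<in> space M. t/4 < \<bar>T g x\<bar>}"
    define Er where "Er = {x \<in> space M. t/4 < \<bar>T r x\<bar>}"
    define Eb where "Eb = {x \<in> space M. ennreal (t/4) < ennreal \<bar>T bF x\<bar> * indicator (- \<Omega>) x}"
    note in_L2_measurable[OF T_L2[OF gL2], measurable] in_L2_measurable[OF T_L2[OF rL2], measurable]
      in_L2_measurable[OF T_L2[OF bFL2], measurable]
    have coO [measurable]: "{x \<in> space M. x \<in> - \<Omega>} \<in> sets M"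
    proof -
      have "{x \<in> space M. x \<in> - \<Omega>} = space M - \<Omega>" by auto
      thus ?thesis using OM by auto
    qed
    have EM [measurable]: "Eg \<in> sets M" "Er \<in> sets M" "Eb \<in> sets M" unfolding Eg_def Er_def Eb_def by measurable
    have f_eq: "f = (\<lambda>x. (g x + bF x) + r x)" unfolding g_def by auto
    have "AE x in M. T f x = T g x + T bF x + T r x"
      using T_add[OF in_L2_add[OF gL2 bFL2] rL2] T_add[OF gL2 bFL2]
      unfolding f_eq[symmetric] by eventually_elim simp
    hence ae: "AE x in M. x \<in> E \<longrightarrow> x \<in> (Eg \<union> Er) \<union> (Eb \<union> \<Omega>)"
    proof eventually_elim
      case (elim x)
      show ?case
      proof (rule impI, rule ccontr)
        assume x: "x \<in> E" and n: "x \<notin> (Eg \<union> Er) \<union> (Eb \<union> \<Omega>)"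
        have xs: "x \<in> space M" "t < \<bar>T f x\<bar>" using x unfolding E_def by auto
        have "\<bar>T g x\<bar> \<le> t/4" "\<bar>T r x\<bar> \<le> t/4" using n xs unfolding Eg_def Er_def by auto
        moreover have "\<bar>T bF x\<bar> \<le> t/4"
          using n xs t unfolding Eb_def by (auto simp: ennreal_less_iff not_less)
        ultimately show False using xs elim t by linarith
      qed
    qed
    have "emeasure M E \<le> emeasure M ((Eg \<union> Er) \<union> (Eb \<union> \<Omega>))" by (rule emeasure_mono_AE[OF ae]) measurable
    also have "\<dots> \<le> (emeasure M Eg + emeasure M Er) + (emeasure M Eb + emeasure M \<Omega>)"
      by (intro order_trans[OF emeasure_subadditive] add_mono emeasure_subadditive) auto
    also have "\<dots> \<le> (ennreal (16 * \<beta> / \<epsilon> / t) * I0 + ennreal e) + (ennreal (8 * ctail \<eta> / t) * I0 + ennreal (dbl (A2 * C\<^sub>0) / t) * I0)"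
    proof (intro add_mono)
      have "emeasure M Eg \<le> ennreal (\<beta> / (t/4)\<^sup>2) * (ennreal (t / \<epsilon>) * I0)"
        unfolding Eg_def using t by (intro order_trans[OF T_Chebyshev[OF gL2]] mult_left_mono g2) auto
      also have "\<dots> = ennreal (\<beta> / (t/4)\<^sup>2 * (t / \<epsilon>)) * I0"
        using beta_nonneg t eps_pos by (subst ennreal_mult) (auto simp: mult.assoc)
      also have "\<beta> / (t/4)\<^sup>2 * (t / \<epsilon>) = 16 * \<beta> / \<epsilon> / t" using t by (simp add: field_simps power2_eq_square)
      finally show "emeasure M Eg \<le> ennreal (16 * \<beta> / \<epsilon> / t) * I0" .
      have "(\<integral>\<^sup>+x. ennreal ((r x)\<^sup>2) \<partial>M) = emeasure (density M (\<lambda>x. ennreal ((f x)\<^sup>2))) (\<Union>\<P> - \<Union>F)"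
        by (subst emeasure_density) (auto simp: r_def indicator_def intro!: nn_integral_cong)
      hence r2: "(\<integral>\<^sup>+x. ennreal ((r x)\<^sup>2) \<partial>M) \<le> ennreal e'" using F(3) by simp
      have "emeasure M Er \<le> ennreal (\<beta> / (t/4)\<^sup>2) * ennreal e'"
        unfolding Er_def using t by (intro order_trans[OF T_Chebyshev[OF rL2]] mult_left_mono r2) auto
      also have "\<dots> = ennreal (\<beta> / (t/4)\<^sup>2 * e')" using beta_nonneg e' by (subst ennreal_mult) auto
      also have "\<beta> / (t/4)\<^sup>2 * e' = e * (\<beta> / (\<beta> + 1))"
        unfolding e'_def using t by simp
      also have "\<dots> \<le> e" using beta_nonneg e by (simp add: field_simps)
      finally show "emeasure M Er \<le> ennreal e" by (simp add: ennreal_leI)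
      show "emeasure M \<Omega> \<le> ennreal (dbl (A2 * C\<^sub>0) / t) * I0" by (rule Omega)
      have "emeasure M Eb \<le> ennreal (1 / (t/4)) * (\<integral>\<^sup>+x. ennreal \<bar>T bF x\<bar> * indicator (- \<Omega>) x \<partial>M)"
        unfolding Eb_def using t by (intro emeasure_superlevel_le) auto
      also have "(\<integral>\<^sup>+x. ennreal \<bar>T bF x\<bar> * indicator (- \<Omega>) x \<partial>M)
        \<le> (\<integral>\<^sup>+x. (\<Sum>P\<in>F. ennreal \<bar>T (b P) x\<bar> * indicator {x. A2 * (C\<^sub>0 * rad P) \<le> \<rho> (cen P) x} x) \<partial>M)"
      proof (rule nn_integral_mono_AE)
        have Ts: "AE x in M. T bF x = (\<Sum>P\<in>F. T (b P) x)"
          unfolding bF_def using F bL2 by (intro T_sum) auto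
        show "AE x in M. ennreal \<bar>T bF x\<bar> * indicator (- \<Omega>) x
          \<le> (\<Sum>P\<in>F. ennreal \<bar>T (b P) x\<bar> * indicator {x. A2 * (C\<^sub>0 * rad P) \<le> \<rho> (cen P) x} x)"
          using Ts AE_space
        proof eventually_elim
          case (elim x)
          show ?case
          proof (cases "x \<in> \<Omega>")
            case False
            have "x \<in> {x. A2 * (C\<^sub>0 * rad P) \<le> \<rho> (cen P) x}" if "P \<in> F" for P
              using False F(2) that elim unfolding \<Omega>_def X_def by (auto simp: mem_ball not_less)
            hence "(\<Sum>P\<in>F. ennreal \<bar>T (b P) x\<bar> * indicator {x. A2 * (C\<^sub>0 * rad P) \<le> \<rho> (cen P) x} x) = (\<Sum>P\<in>F. ennreal \<bar>T (b P) x\<bar>)"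
              by (intro sum.cong) auto
            also have "\<dots> = ennreal (\<Sum>P\<in>F. \<bar>T (b P) x\<bar>)" by (rule sum_ennreal) auto
            finally show ?thesis using elim by (auto simp: indicator_def intro!: ennreal_leI sum_abs)
          qed simp
        qed
      qed
      also have "\<dots> = (\<Sum>P\<in>F. \<integral>\<^sup>+x\<in>{x. A2 * (C\<^sub>0 * rad P) \<le> \<rho> (cen P) x}. ennreal \<bar>T (b P) x\<bar> \<partial>M)"
      proof (rule nn_integral_sum)
        fix P assume "P \<in> F"
        hence P: "P \<in> \<P>" "P \<in> \<U>" using F(2) \<P>(1) by auto
        note in_L2_measurable[OF T_L2[OF bL2[OF P(1)]], measurable]
        have [measurable]: "\<rho> (cen P) \<in> borel_measurable M" by (rule rho_measurable[OF cen_space[OF P(2)]])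
        show "(\<lambda>x. ennreal \<bar>T (b P) x\<bar> * indicator {x. A2 * (C\<^sub>0 * rad P) \<le> \<rho> (cen P) x} x) \<in> borel_measurable M"
          by measurable
      qed
      also have "\<dots> \<le> (\<Sum>P\<in>F. ennreal (2 * ctail \<eta>) * I P)" using F(2) by (intro sum_mono b_atom) auto
      also have "\<dots> = ennreal (2 * ctail \<eta>) * I (\<Union>F)" unfolding sum_distrib_left[symmetric] sumI[OF F(1,2)] ..
      also have "\<dots> \<le> ennreal (2 * ctail \<eta>) * I0" by (intro mult_left_mono I_le) auto
      also have "ennreal (1 / (t/4)) * (ennreal (2 * ctail \<eta>) * I0) = ennreal (1 / (t/4) * (2 * ctail \<eta>)) * I0"
        using t ctail_pos[OF eta_pos] by (subst ennreal_mult) (auto simp: mult.assoc)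
      also have "1 / (t/4) * (2 * ctail \<eta>) = 8 * ctail \<eta> / t" by simp
      finally show "emeasure M Eb \<le> ennreal (8 * ctail \<eta> / t) * I0" by (simp add: mult_left_mono)
    qed
    also have "\<dots> = ennreal (cW / t) * I0 + ennreal e"
    proof -
      have "cW / t = 16 * \<beta> / \<epsilon> / t + (8 * ctail \<eta> / t + dbl (A2 * C\<^sub>0) / t)"
        unfolding weak_const_def by (simp add: add_divide_distrib)
      hence "ennreal (cW / t) = ennreal (16 * \<beta> / \<epsilon> / t) + (ennreal (8 * ctail \<eta> / t) + ennreal (dbl (A2 * C\<^sub>0) / t))"
        using t beta_nonneg eps_pos ctail_pos[OF eta_pos] dbl_pos[of "A2 * C\<^sub>0"]
        by (simp add: ennreal_plus[symmetric] del: ennreal_plus)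
      thus ?thesis by (simp only: distrib_right) (simp only: add.assoc add.commute add.left_commute)
    qed
    finally show ?thesis .
  qed
  have "emeasure M E \<le> ennreal (cW / t) * I0" by (rule ennreal_le_epsilon) (use main in blast)
  thus ?thesis unfolding E_def I0_def h_def .
qed

end

section \<open>Adjacent dyadic systems\<close>

lemma ennreal_divide_mult_cancel: "b \<noteq> 0 \<Longrightarrow> b < top \<Longrightarrow> a / b * b = (a :: ennreal)"
  by (simp add: ennreal_divide_times)

locale adjacent = hom_space +
  fixes N :: nat and \<delta> C\<^sub>0 \<epsilon> A :: real and \<DD> :: "(int \<Rightarrow> 'a set set) set"
  assumes adj: "adjacent_dyadic_systems M \<rho> N \<delta> C\<^sub>0 \<epsilon> A \<DD>" and nonempty: "space M \<noteq> {}"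
begin

lemma finite_systems: "finite \<DD>" and card_systems: "card \<DD> = N"
  and cover: "\<forall>x\<in>space M. \<forall>r>0. \<exists>Q\<in>cubes \<DD>. ball x r \<subseteq> Q \<and> emeasure M Q \<le> ennreal A * emeasure M (ball x r)"
  using adj unfolding adjacent_dyadic_systems_def by simp_all

lemma dyadic_system: "\<D> \<in> \<DD> \<Longrightarrow> dyadic_system M \<rho> \<kappa> D \<delta> C\<^sub>0 \<epsilon> \<D>"
  using adj unfolding adjacent_dyadic_systems_def
  by (intro dyadic_system.intro hom_space_axioms dyadic_system_axioms.intro) blast

lemma cubes_eq: "cubes \<DD> = (\<Union>\<D>\<in>\<DD>. dyadic_system.\<U> \<D>)"
  unfolding cubes_def using dyadic_system.\<U>_def[OF dyadic_system] by blast

lemma in_cubesE: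
  assumes "Q \<in> cubes \<DD>"
  obtains \<D> where "\<D> \<in> \<DD>" "Q \<in> dyadic_system.\<U> \<D>"
  using assms unfolding cubes_eq by blast

lemma cubes_sets [measurable]: "Q \<in> cubes \<DD> \<Longrightarrow> Q \<in> sets M"
  by (erule in_cubesE) (rule dyadic_system.cube_sets[OF dyadic_system])

lemma cubes_pos: "Q \<in> cubes \<DD> \<Longrightarrow> 0 < emeasure M Q"
  by (erule in_cubesE) (rule dyadic_system.cube_pos[OF dyadic_system])

lemma cubes_finite: "Q \<in> cubes \<DD> \<Longrightarrow> emeasure M Q < \<infinity>"
  by (erule in_cubesE) (rule dyadic_system.cube_finite[OF dyadic_system])

lemma emeasure_cubes: "Q \<in> cubes \<DD> \<Longrightarrow> emeasure M Q = ennreal (measure M Q)"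
  by (erule in_cubesE) (rule dyadic_system.emeasure_cube[OF dyadic_system])

lemma measure_cubes_pos: "Q \<in> cubes \<DD> \<Longrightarrow> 0 < measure M Q"
  by (erule in_cubesE) (rule dyadic_system.measure_cube_pos[OF dyadic_system])

lemma countable_cubes_all: "countable (cubes \<DD>)"
  unfolding cubes_eq using finite_systems dyadic_system.countable_cubes[OF dyadic_system]
  by (intro countable_UN[OF countable_finite]) auto

lemma ball_in_cube:
  assumes "x \<in> space M" "0 < r"
  obtains Q where "Q \<in> cubes \<DD>" "ball x r \<subseteq> Q" "emeasure M Q \<le> ennreal A * emeasure M (ball x r)"
  using bspec[OF cover assms(1)] assms(2) by blast

lemma systems_nonempty: "\<DD> \<noteq> {}"
proof -
  obtain x where "x \<in> space M" using nonempty by blast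
  from ball_in_cube[OF this, of 1] obtain Q where "Q \<in> cubes \<DD>" by auto
  thus ?thesis unfolding cubes_def by blast
qed

lemma N_ge_1: "1 \<le> N"
  using systems_nonempty finite_systems unfolding card_systems[symmetric] by (simp add: Suc_le_eq card_gt_0_iff)

lemma A_ge_1: "1 \<le> A"
proof -
  obtain x where x: "x \<in> space M" using nonempty by blast
  from ball_in_cube[OF this, of 1] obtain Q where Q: "Q \<in> cubes \<DD>" "ball x 1 \<subseteq> Q"
    "emeasure M Q \<le> ennreal A * emeasure M (ball x 1)" by auto
  have "emeasure M (ball x 1) \<le> ennreal A * emeasure M (ball x 1)"
    using emeasure_mono[OF Q(2) cubes_sets[OF Q(1)]] Q(3) by (rule order_trans)
  hence *: "ennreal (V x 1) \<le> ennreal A * ennreal (V x 1)" using x by (simp add: emeasure_ball)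
  have V: "0 < V x 1" using x by (intro V_pos) auto
  have "0 \<le> A" using * V by (cases "0 \<le> A") (auto simp: ennreal_neg)
  hence "V x 1 \<le> A * V x 1" using * V by (simp add: ennreal_mult[symmetric])
  thus ?thesis using V by simp
qed

text \<open>The maximal operator on functions with values in [0, \<infinity>], so that it applies to
  extended nonnegative functions without absolute values.\<close>

definition Mx :: "('a \<Rightarrow> ennreal) \<Rightarrow> 'a \<Rightarrow> ennreal" where
  "Mx h x = (SUP Q\<in>{Q \<in> cubes \<DD>. x \<in> Q}. (\<integral>\<^sup>+y\<in>Q. h y \<partial>M) / emeasure M Q)"

lemma maximal_eq_Mx: "maximal M \<DD> f = Mx (\<lambda>y. ennreal \<bar>f y\<bar>)"
  unfolding maximal_def Mx_def by simp

lemma Mx_ge: "Q \<in> cubes \<DD> \<Longrightarrow> x \<in> Q \<Longrightarrow> (\<integral>\<^sup>+y\<in>Q. h y \<partial>M) / emeasure M Q \<le> Mx h x"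
  unfolding Mx_def by (intro SUP_upper) auto

lemma integral_le_Mx:
  assumes "Q \<in> cubes \<DD>" "x \<in> Q" "Mx h x \<le> t"
  shows "(\<integral>\<^sup>+y\<in>Q. h y \<partial>M) \<le> t * emeasure M Q"
proof -
  have "(\<integral>\<^sup>+y\<in>Q. h y \<partial>M) = (\<integral>\<^sup>+y\<in>Q. h y \<partial>M) / emeasure M Q * emeasure M Q"
    using cubes_pos[OF assms(1)] cubes_finite[OF assms(1)] by (intro ennreal_divide_mult_cancel[symmetric]) auto
  also have "\<dots> \<le> t * emeasure M Q"
    using Mx_ge[OF assms(1,2)] assms(3) by (intro mult_right_mono) (auto intro: order_trans)
  finally show ?thesis .
qed

text \<open>Indicators make the index set independent of x; what remains is a countable
  supremum.\<close>

lemma Mx_measurable [measurable]: "Mx h \<in> borel_measurable M"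
proof -
  have "Mx h x = (SUP Q\<in>cubes \<DD>. (\<integral>\<^sup>+y\<in>Q. h y \<partial>M) / emeasure M Q * indicator Q x)" for x
  proof (rule antisym)
    show "Mx h x \<le> (SUP Q\<in>cubes \<DD>. (\<integral>\<^sup>+y\<in>Q. h y \<partial>M) / emeasure M Q * indicator Q x)"
      unfolding Mx_def
    proof (rule SUP_least)
      fix Q assume "Q \<in> {Q \<in> cubes \<DD>. x \<in> Q}"
      thus "(\<integral>\<^sup>+y\<in>Q. h y \<partial>M) / emeasure M Q \<le> (SUP Q\<in>cubes \<DD>. (\<integral>\<^sup>+y\<in>Q. h y \<partial>M) / emeasure M Q * indicator Q x)"
        by (intro SUP_upper2[of Q]) auto
    qed
    show "(SUP Q\<in>cubes \<DD>. (\<integral>\<^sup>+y\<in>Q. h y \<partial>M) / emeasure M Q * indicator Q x) \<le> Mx h x"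
    proof (rule SUP_least)
      fix Q assume "Q \<in> cubes \<DD>"
      thus "(\<integral>\<^sup>+y\<in>Q. h y \<partial>M) / emeasure M Q * indicator Q x \<le> Mx h x"
        by (cases "x \<in> Q") (simp_all add: Mx_ge)
    qed
  qed
  hence "Mx h = (\<lambda>x. SUP Q\<in>cubes \<DD>. (\<integral>\<^sup>+y\<in>Q. h y \<partial>M) / emeasure M Q * indicator Q x)" by blast
  also have "\<dots> \<in> borel_measurable M"
  proof (rule borel_measurable_SUP[OF countable_cubes_all])
    fix Q assume "Q \<in> cubes \<DD>"
    from cubes_sets[OF this] show "(\<lambda>x. (\<integral>\<^sup>+y\<in>Q. h y \<partial>M) / emeasure M Q * indicator Q x) \<in> borel_measurable M"
      by measurable
  qed
  finally show ?thesis .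
qed

text \<open>Cubes of different systems are not nested, so each system is treated separately. This is
  where the factor N arises.\<close>

lemma cubes_weak_type:
  assumes "\<Q> \<subseteq> cubes \<DD>" and h [measurable]: "h \<in> borel_measurable M"
    and le: "\<And>Q. Q \<in> \<Q> \<Longrightarrow> t * emeasure M Q \<le> (\<integral>\<^sup>+x\<in>Q. h x \<partial>M)"
  shows "t * emeasure M (\<Union>\<Q>) \<le> of_nat N * (\<integral>\<^sup>+x. h x \<partial>M)"
proof -
  define S where "S \<D> = \<Q> \<inter> dyadic_system.\<U> \<D>" for \<D>
  have U: "\<Union>\<Q> = (\<Union>\<D>\<in>\<DD>. \<Union>(S \<D>))" using assms(1) unfolding S_def cubes_eq by blast
  have cS: "countable (S \<D>)" if "\<D> \<in> \<DD>" for \<D>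
    unfolding S_def using dyadic_system.countable_cubes[OF dyadic_system[OF that]] by (rule countable_subset[rotated]) auto
  have SM: "\<Union>(S \<D>) \<in> sets M" if "\<D> \<in> \<DD>" for \<D>
    using cS[OF that] assms(1) cubes_sets unfolding S_def by (intro sets.countable_Union) auto
  have "t * emeasure M (\<Union>\<Q>) \<le> t * (\<Sum>\<D>\<in>\<DD>. emeasure M (\<Union>(S \<D>)))"
    unfolding U using finite_systems SM by (intro mult_left_mono emeasure_subadditive_finite) auto
  also have "\<dots> = (\<Sum>\<D>\<in>\<DD>. t * emeasure M (\<Union>(S \<D>)))" by (rule sum_distrib_left)
  also have "\<dots> \<le> (\<Sum>\<D>\<in>\<DD>. \<integral>\<^sup>+x. h x \<partial>M)"
  proof (rule sum_mono)
    fix \<D> assume d: "\<D> \<in> \<DD>"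
    have "t * emeasure M (\<Union>(S \<D>)) \<le> (\<integral>\<^sup>+x\<in>\<Union>(S \<D>). h x \<partial>M)"
      by (rule dyadic_system.nested_cubes_weak_type[OF dyadic_system[OF d] _ h le]) (auto simp: S_def)
    also have "\<dots> \<le> (\<integral>\<^sup>+x. h x \<partial>M)" by (intro nn_integral_mono) (auto simp: indicator_def)
    finally show "t * emeasure M (\<Union>(S \<D>)) \<le> (\<integral>\<^sup>+x. h x \<partial>M)" .
  qed
  also have "\<dots> = of_nat N * (\<integral>\<^sup>+x. h x \<partial>M)" using card_systems by simp
  finally show ?thesis .
qed

lemma Mx_weak_type:
  assumes h [measurable]: "h \<in> borel_measurable M"
  shows "t * emeasure M {x \<in> space M. t < Mx h x} \<le> of_nat N * (\<integral>\<^sup>+x. h x \<partial>M)"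
proof -
  let ?Q = "{Q \<in> cubes \<DD>. t < (\<integral>\<^sup>+y\<in>Q. h y \<partial>M) / emeasure M Q}"
  have c: "countable ?Q" using countable_cubes_all by (rule countable_subset[rotated]) auto
  have "{x \<in> space M. t < Mx h x} \<subseteq> \<Union>?Q"
    unfolding Mx_def less_SUP_iff by blast
  hence "emeasure M {x \<in> space M. t < Mx h x} \<le> emeasure M (\<Union>?Q)"
    using c by (intro emeasure_mono sets.countable_Union) auto
  hence "t * emeasure M {x \<in> space M. t < Mx h x} \<le> t * emeasure M (\<Union>?Q)" by (rule mult_left_mono) simp
  also have "\<dots> \<le> of_nat N * (\<integral>\<^sup>+x. h x \<partial>M)"
  proof (rule cubes_weak_type[OF _ h])
    fix Q assume Q: "Q \<in> ?Q"
    hence q: "Q \<in> cubes \<DD>" by blast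
    have "t * emeasure M Q \<le> (\<integral>\<^sup>+y\<in>Q. h y \<partial>M) / emeasure M Q * emeasure M Q"
      using Q by (intro mult_right_mono) auto
    also have "\<dots> = (\<integral>\<^sup>+x\<in>Q. h x \<partial>M)"
      using cubes_pos[OF q] cubes_finite[OF q] by (intro ennreal_divide_mult_cancel) auto
    finally show "t * emeasure M Q \<le> (\<integral>\<^sup>+x\<in>Q. h x \<partial>M)" .
  qed auto
  finally show ?thesis .
qed

end

section \<open>Sparse domination\<close>

text \<open>Stopping cubes are taken from the one system \<D>, whereas the cubes on which |f| is
  averaged may come from any member of \<DD>.\<close>

locale cz_main = adjacent M \<rho> \<kappa> D N \<delta> C\<^sub>0 \<epsilon> A \<DD> + cz_op M \<rho> \<kappa> D K \<eta> C\<^sub>K T \<beta>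
  for M :: "'a measure" and \<rho> \<kappa> D N \<delta> C\<^sub>0 \<epsilon> A \<DD> K \<eta> C\<^sub>K T \<beta> +
  fixes \<D> assumes system: "\<D> \<in> \<DD>"

sublocale cz_main \<subseteq> cz_dyadic M \<rho> \<kappa> D \<delta> C\<^sub>0 \<epsilon> \<D> K \<eta> C\<^sub>K T \<beta>
  by (intro cz_dyadic.intro dyadic_system[OF system] cz_op_axioms)

text \<open>If \<open>P \<subseteq> Q\<close> are cubes, the balls dilated by \<open>dilation C\<^sub>0\<close> around both contain the ball of radius
  \<open>A2 * C\<^sub>0 * rad P\<close> around \<open>P\<close>, and both are contained in the ball dilated by \<open>dilation2 C\<^sub>0\<close> around \<open>Q\<close>.
  All constants are functions of the parameters of the decompositions, so that they do not depend on
  the decompositions themselves.\<close>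

definition (in cz_op) dilation :: "real \<Rightarrow> real" where "dilation C = \<kappa> * C * (A2 + 1)"

definition (in cz_op) dilation2 :: "real \<Rightarrow> real" where "dilation2 C = \<kappa> * (dilation C + C)"

definition (in cz_op) hat_const :: "real \<Rightarrow> real \<Rightarrow> real" where "hat_const C a = a * dbl (dilation2 C)"

text \<open>Solves (weak_const + n) * hat_const / stop_const = \<epsilon> / 8, the proportion of Q
  that the exceptional set in \<open>sparse_step\<close> may fill.\<close>

definition (in cz_op) stop_const :: "real \<Rightarrow> real \<Rightarrow> real \<Rightarrow> nat \<Rightarrow> real" where
  "stop_const C e a n = 8 * (weak_const C e + real n) * hat_const C a / e"

definition (in cz_op) sparse_const :: "real \<Rightarrow> real \<Rightarrow> real \<Rightarrow> nat \<Rightarrow> real" where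
  "sparse_const C e a n = stop_const C e a n *
     (2 * ctail \<eta> * a + 1 + 4 * weak_const C e * dbl (dilation C) * a)"

context cz_main begin

abbreviation "\<alpha> \<equiv> dilation C\<^sub>0"
abbreviation "\<gamma> \<equiv> dilation2 C\<^sub>0"
abbreviation "H \<equiv> hat_const C\<^sub>0 A"
abbreviation "cE \<equiv> stop_const C\<^sub>0 \<epsilon> A N"
abbreviation "cS \<equiv> sparse_const C\<^sub>0 \<epsilon> A N"

lemma U_subset_cubes: "\<U> \<subseteq> cubes \<DD>"
  using system unfolding cubes_eq by blast

lemma alpha_ge: "C\<^sub>0 \<le> \<alpha>" "A2 * C\<^sub>0 \<le> \<alpha>" "0 < \<alpha>"
proof -
  have "C\<^sub>0 * (A2 + 1) \<le> \<kappa> * (C\<^sub>0 * (A2 + 1))"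
    using mult_right_mono[OF kappa_ge_1, of "C\<^sub>0 * (A2 + 1)"] C0_pos A2_ge by simp
  hence "C\<^sub>0 * A2 + C\<^sub>0 \<le> \<alpha>" unfolding dilation_def by (simp add: algebra_simps)
  moreover have "0 < C\<^sub>0 * A2" using C0_pos A2_ge by simp
  ultimately show "C\<^sub>0 \<le> \<alpha>" "A2 * C\<^sub>0 \<le> \<alpha>" "0 < \<alpha>" using C0_pos by (auto simp: mult.commute)
qed

lemma gamma_ge: "\<alpha> \<le> \<gamma>" "0 < \<gamma>"
proof -
  have "0 \<le> \<alpha> + C\<^sub>0" using C0_pos alpha_ge(3) by linarith
  from mult_right_mono[OF kappa_ge_1 this] have "\<alpha> + C\<^sub>0 \<le> \<gamma>" unfolding dilation2_def by simp
  thus "\<alpha> \<le> \<gamma>" "0 < \<gamma>" using C0_pos alpha_ge(3) by linarith+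
qed

lemma cW_ge_1: "1 \<le> cW"
proof -
  have "0 \<le> 16 * \<beta> / \<epsilon>" using beta_nonneg eps_pos by simp
  thus ?thesis unfolding weak_const_def using dbl_ge_1[of "A2 * C\<^sub>0"] ctail_pos[OF eta_pos] by linarith
qed

lemma H_ge_1: "1 \<le> H"
  unfolding hat_const_def using mult_mono[OF A_ge_1 dbl_ge_1[of \<gamma>]] A_ge_1 by simp

lemma cE_ge_1: "1 \<le> cE"
proof -
  have "1 * 1 \<le> (cW + real N) * H" using cW_ge_1 H_ge_1 by (intro mult_mono) auto
  hence "\<epsilon> \<le> 8 * (cW + real N) * H" using eps_less_1 unfolding mult.assoc by linarith
  thus ?thesis unfolding stop_const_def using eps_pos by (simp add: field_simps)
qed

lemma cS_ge: "0 < cS" "cE \<le> cS"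
proof -
  have "0 \<le> 2 * ctail \<eta> * A + 4 * cW * dbl \<alpha> * A"
    using ctail_pos[OF eta_pos] A_ge_1 cW_ge_1 dbl_pos[of \<alpha>] by (intro add_nonneg_nonneg mult_nonneg_nonneg) auto
  hence "cE * 1 \<le> cS" unfolding sparse_const_def using cE_ge_1 by (intro mult_left_mono) auto
  thus "0 < cS" "cE \<le> cS" using cE_ge_1 by auto
qed

definition dil :: "'a set \<Rightarrow> 'a set" where "dil Q = ball (cen Q) (\<alpha> * rad Q)"

text \<open>A cube rather than a ball, so that the average over it is one of those in the maximal
  operator. The radius with \<gamma> makes it contain the dilates of all cubes inside Q.\<close>

definition hat :: "'a set \<Rightarrow> 'a set" where
  "hat Q = (SOME S. S \<in> cubes \<DD> \<and> ball (cen Q) (\<gamma> * rad Q) \<subseteq> S \<and>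
     emeasure M S \<le> ennreal A * emeasure M (ball (cen Q) (\<gamma> * rad Q)))"

lemma
  assumes "Q \<in> \<U>"
  shows hat_cubes: "hat Q \<in> cubes \<DD>" and ball_subset_hat: "ball (cen Q) (\<gamma> * rad Q) \<subseteq> hat Q"
    and emeasure_hat_le: "emeasure M (hat Q) \<le> ennreal A * emeasure M (ball (cen Q) (\<gamma> * rad Q))"
proof -
  have "0 < \<gamma> * rad Q" using gamma_ge rad_pos by simp
  from ball_in_cube[OF cen_space[OF assms] this]
  have "\<exists>S. S \<in> cubes \<DD> \<and> ball (cen Q) (\<gamma> * rad Q) \<subseteq> S \<and> emeasure M S \<le> ennreal A * emeasure M (ball (cen Q) (\<gamma> * rad Q))"
    by blast
  from someI_ex[OF this, folded hat_def]
  show "hat Q \<in> cubes \<DD>" "ball (cen Q) (\<gamma> * rad Q) \<subseteq> hat Q"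
    "emeasure M (hat Q) \<le> ennreal A * emeasure M (ball (cen Q) (\<gamma> * rad Q))" by auto
qed

lemma hat_measure: "Q \<in> \<U> \<Longrightarrow> emeasure M (hat Q) \<le> ennreal H * emeasure M Q"
proof -
  assume Q: "Q \<in> \<U>"
  have "emeasure M (hat Q) \<le> ennreal A * ennreal (V (cen Q) (\<gamma> * rad Q))"
    using emeasure_hat_le[OF Q] cen_space[OF Q] gamma_ge rad_pos[of Q] by (simp add: emeasure_ball)
  also have "\<dots> \<le> ennreal A * ennreal (dbl \<gamma> * measure M Q)"
  proof (intro mult_left_mono ennreal_leI)
    have "V (cen Q) (\<gamma> * rad Q) \<le> dbl \<gamma> * V (cen Q) (rad Q)" by (intro V_scale cen_space Q rad_pos gamma_ge)
    also have "\<dots> \<le> dbl \<gamma> * measure M Q" using V_le_cube[OF Q] dbl_pos[of \<gamma>] by (intro mult_left_mono) auto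
    finally show "V (cen Q) (\<gamma> * rad Q) \<le> dbl \<gamma> * measure M Q" .
  qed auto
  also have "\<dots> = ennreal H * emeasure M Q"
    unfolding hat_const_def emeasure_cube[OF Q] using A_ge_1 dbl_pos[of \<gamma>] by (simp add: ennreal_mult[symmetric] mult.assoc)
  finally show ?thesis .
qed

lemma dil_sets [measurable]: "Q \<in> \<U> \<Longrightarrow> dil Q \<in> sets M"
  unfolding dil_def by (intro ball_sets cen_space)

lemma dil_subset_hat: "Q \<in> \<U> \<Longrightarrow> dil Q \<subseteq> hat Q"
  using ball_subset_hat[of Q] ball_mono[of "\<alpha> * rad Q" "\<gamma> * rad Q" "cen Q"] gamma_ge rad_pos[of Q]
  unfolding dil_def by (auto intro: mult_right_mono)

lemma cube_subset_dil: "Q \<in> \<U> \<Longrightarrow> Q \<subseteq> dil Q"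
  using cube_subset_ball[of Q] ball_mono[of "C\<^sub>0 * rad Q" "\<alpha> * rad Q" "cen Q"] alpha_ge rad_pos[of Q]
  unfolding dil_def by (auto intro: mult_right_mono)

lemma cube_subset_hat: "Q \<in> \<U> \<Longrightarrow> Q \<subseteq> hat Q"
  using cube_subset_dil dil_subset_hat by blast

definition Tloc :: "('a \<Rightarrow> real) \<Rightarrow> 'a set \<Rightarrow> 'a \<Rightarrow> real" where
  "Tloc f Q = T (\<lambda>y. f y * indicator (dil Q) y)"

definition avg :: "('a \<Rightarrow> real) \<Rightarrow> 'a set \<Rightarrow> real" where
  "avg f S = (\<integral>x. \<bar>f x\<bar> * indicator S x \<partial>M) / measure M S"

lemma in_L2_set_integrable:
  assumes "in_L2 M f" "S \<in> cubes \<DD>"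
  shows "integrable M (\<lambda>x. \<bar>f x\<bar> * indicator S x)"
proof -
  have "integrable M (\<lambda>x. f x * indicator S x)"
    by (rule in_L2_integrable[OF in_L2_indicator[OF assms(1) cubes_sets[OF assms(2)]] cubes_sets[OF assms(2)] cubes_finite[OF assms(2)]]) auto
  hence "integrable M (\<lambda>x. \<bar>f x * indicator S x\<bar>)" by (rule integrable_abs)
  thus ?thesis by (simp add: abs_mult)
qed

lemma avg_nonneg: "0 \<le> avg f S"
  unfolding avg_def by (intro divide_nonneg_nonneg integral_nonneg_AE) auto

lemma avg_eq:
  assumes "in_L2 M f" "S \<in> cubes \<DD>"
  shows "(\<integral>\<^sup>+x\<in>S. ennreal \<bar>f x\<bar> \<partial>M) = ennreal (avg f S) * emeasure M S"
proof -
  have "(\<integral>\<^sup>+x\<in>S. ennreal \<bar>f x\<bar> \<partial>M) = (\<integral>\<^sup>+x. ennreal (\<bar>f x\<bar> * indicator S x) \<partial>M)"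
    by (intro nn_integral_cong) (auto simp: indicator_def)
  also have "\<dots> = ennreal (\<integral>x. \<bar>f x\<bar> * indicator S x \<partial>M)"
    using in_L2_set_integrable[OF assms] by (intro nn_integral_eq_integral) auto
  also have "(\<integral>x. \<bar>f x\<bar> * indicator S x \<partial>M) = avg f S * measure M S"
    unfolding avg_def using measure_cubes_pos[OF assms(2)] by simp
  finally show ?thesis using avg_nonneg emeasure_cubes[OF assms(2)] by (simp add: ennreal_mult)
qed

text \<open>\<open>E\<close> is the part of Q where |T(f \<chi>)| or the maximal function of f on
  \<open>hat Q\<close> exceeds a large multiple of the average. Decomposing
  \<open>indicator E\<close> at height \<epsilon>/4 selects cubes in which E has density between
  \<epsilon>/4 and 1/4. The lower bound limits their total measure; the upper bound leaves good
  points in each of them, and one good point controls the whole cube.\<close>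

lemma sparse_step:
  assumes f: "in_L2 M f" and Q: "Q \<in> \<U>"
  shows "\<exists>\<P>\<subseteq>\<U>. disjoint \<P> \<and> \<Union>\<P> \<subseteq> Q \<and> emeasure M (\<Union>\<P>) \<le> ennreal (1/2) * emeasure M Q \<and>
    (AE x in M. x \<in> Q \<longrightarrow> (x \<notin> \<Union>\<P> \<longrightarrow> \<bar>Tloc f Q x\<bar> \<le> cS * avg f (hat Q)) \<and>
      (\<forall>P\<in>\<P>. x \<in> P \<longrightarrow> \<bar>Tloc f Q x\<bar> \<le> cS * avg f (hat Q) + \<bar>Tloc f P x\<bar>))"
proof -
  note in_L2_measurable[OF f, measurable] cube_sets[OF Q, measurable] dil_sets[OF Q, measurable]
  have hQ: "hat Q \<in> cubes \<DD>" by (rule hat_cubes[OF Q])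
  note cubes_sets[OF hQ, measurable]
  define a where "a = avg f (hat Q)"
  have a0: "0 \<le> a" unfolding a_def by (rule avg_nonneg)
  have fdL2: "in_L2 M (\<lambda>y. f y * indicator (dil S) y)" if "S \<in> \<U>" for S
    by (intro in_L2_indicator f dil_sets that)
  define h where "h y = ennreal \<bar>f y\<bar> * indicator (hat Q) y" for y
  have h [measurable]: "h \<in> borel_measurable M" unfolding h_def by measurable
  have Ih: "(\<integral>\<^sup>+y. h y \<partial>M) = ennreal a * emeasure M (hat Q)"
    unfolding h_def a_def by (rule avg_eq[OF f hQ])
  have Id: "(\<integral>\<^sup>+y. ennreal \<bar>f y * indicator (dil Q) y\<bar> \<partial>M) \<le> ennreal a * emeasure M (hat Q)"
    unfolding Ih[symmetric] h_def using dil_subset_hat[OF Q]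
    by (intro nn_integral_mono) (auto simp: indicator_def)
  show ?thesis
  proof (cases "a = 0")
    \<comment> \<open>Here f vanishes almost everywhere on \<open>dil Q\<close> and no stopping cube
      is required. The other case divides by \<open>a\<close>.\<close>
    case True
    hence "(\<integral>\<^sup>+y. ennreal \<bar>f y * indicator (dil Q) y\<bar> \<partial>M) = 0" using Id by simp
    hence "AE y in M. ennreal \<bar>f y * indicator (dil Q) y\<bar> = 0" by (subst (asm) nn_integral_0_iff_AE) auto
    hence "AE y in M. f y * indicator (dil Q) y = 0" by eventually_elim simp
    from T_AE_zero[OF fdL2[OF Q] this] have "AE x in M. Tloc f Q x = 0" unfolding Tloc_def .
    hence "AE x in M. x \<in> Q \<longrightarrow> (x \<notin> \<Union>{} \<longrightarrow> \<bar>Tloc f Q x\<bar> \<le> cS * avg f (hat Q)) \<and>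
      (\<forall>P\<in>{}. x \<in> P \<longrightarrow> \<bar>Tloc f Q x\<bar> \<le> cS * avg f (hat Q) + \<bar>Tloc f P x\<bar>)"
      by eventually_elim (use True in \<open>simp add: a_def\<close>)
    thus ?thesis by (intro exI[of _ "{}"]) auto
  next
    case False
    hence a: "0 < a" using a0 by simp
    define c where "c = cE"
    have c: "1 \<le> c" unfolding c_def by (rule cE_ge_1)
    have ca: "0 < c * a" using c a by simp
    \<comment> \<open>\<open>hat Q\<close> may belong to another system than \<D>, so the weak type
      inequality is taken in the system of the given cube S.\<close>
    have weak: "emeasure M {x \<in> space M. t < \<bar>T g x\<bar>} \<le> ennreal (cW / t) * (\<integral>\<^sup>+x. ennreal \<bar>g x\<bar> \<partial>M)"
      if "S \<in> cubes \<DD>" "in_L2 M g" "\<And>x. x \<notin> S \<Longrightarrow> g x = 0" "0 < t"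
        "(\<integral>\<^sup>+x. ennreal \<bar>g x\<bar> \<partial>M) \<le> ennreal t * emeasure M S" for S g t
    proof -
      obtain \<D>' where sys: "\<D>' \<in> \<DD>" "S \<in> dyadic_system.\<U> \<D>'" using \<open>S \<in> cubes \<DD>\<close> by (rule in_cubesE)
      have "cz_dyadic M \<rho> \<kappa> D \<delta> C\<^sub>0 \<epsilon> \<D>' K \<eta> C\<^sub>K T \<beta>"
        by (intro cz_dyadic.intro dyadic_system[OF sys(1)] cz_op_axioms)
      from cz_dyadic.weak_type_11[OF this sys(2) that(2-5)] show ?thesis .
    qed
    define E1 where "E1 = {x \<in> space M. c * a < \<bar>Tloc f Q x\<bar>}"
    define E2 where "E2 = {x \<in> space M. ennreal (c * a) < Mx h x}"
    define E where "E = (E1 \<union> E2) \<inter> Q"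
    have TM [measurable]: "Tloc f S \<in> borel_measurable M" if "S \<in> \<U>" for S
      unfolding Tloc_def by (rule in_L2_measurable[OF T_L2[OF fdL2[OF that]]])
    note TM[OF Q, measurable]
    have E12 [measurable]: "E1 \<in> sets M" "E2 \<in> sets M" unfolding E1_def E2_def by measurable
    have EM [measurable]: "E \<in> sets M" unfolding E_def by measurable
    have e1: "emeasure M E1 \<le> ennreal (cW / c) * emeasure M (hat Q)"
    proof -
      have "emeasure M E1 \<le> ennreal (cW / (c * a)) * (\<integral>\<^sup>+y. ennreal \<bar>f y * indicator (dil Q) y\<bar> \<partial>M)"
        unfolding E1_def Tloc_def
      proof (rule weak[OF hQ fdL2[OF Q] _ ca])
        show "f x * indicator (dil Q) x = 0" if "x \<notin> hat Q" for x
          using that dil_subset_hat[OF Q] by (auto simp: indicator_def)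
        have "ennreal a * emeasure M (hat Q) \<le> ennreal (c * a) * emeasure M (hat Q)"
          using c a mult_right_mono[of 1 c a] by (intro mult_right_mono ennreal_leI) auto
        with Id show "(\<integral>\<^sup>+y. ennreal \<bar>f y * indicator (dil Q) y\<bar> \<partial>M) \<le> ennreal (c * a) * emeasure M (hat Q)"
          by (rule order_trans)
      qed
      also have "\<dots> \<le> ennreal (cW / (c * a)) * (ennreal a * emeasure M (hat Q))" by (intro mult_left_mono Id) auto
      also have "\<dots> = ennreal (cW / (c * a) * a) * emeasure M (hat Q)"
        using a c cW_ge_1 by (subst ennreal_mult) (auto simp: mult.assoc)
      finally show ?thesis using a by simp
    qed
    have e2: "emeasure M E2 \<le> ennreal (real N / c) * emeasure M (hat Q)"
    proof -
      have "emeasure M E2 = ennreal (1 / (c * a)) * (ennreal (c * a) * emeasure M E2)"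
        using a c by (simp add: mult.assoc[symmetric] ennreal_mult[symmetric])
      also have "\<dots> \<le> ennreal (1 / (c * a)) * (of_nat N * (ennreal a * emeasure M (hat Q)))"
        unfolding E2_def Ih[symmetric] by (intro mult_left_mono Mx_weak_type h) auto
      also have "\<dots> = ennreal (1 / (c * a) * (real N * a)) * emeasure M (hat Q)"
        using a c by (simp add: ennreal_mult[symmetric] ennreal_of_nat_eq_real_of_nat mult.assoc[symmetric])
      also have "1 / (c * a) * (real N * a) = real N / c" using a by simp
      finally show ?thesis .
    qed
    \<comment> \<open>The bound \<epsilon>/8 is half of the height \<epsilon>/4 used below, whence
      the factor 1/2 in \<open>size\<close>.\<close>
    have eE: "emeasure M E \<le> ennreal (\<epsilon> / 8) * emeasure M Q"
    proof -
      have "emeasure M E \<le> emeasure M (E1 \<union> E2)" unfolding E_def by (intro emeasure_mono) auto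
      also have "\<dots> \<le> emeasure M E1 + emeasure M E2" by (rule emeasure_subadditive) auto
      also have "\<dots> \<le> ennreal (cW / c) * emeasure M (hat Q) + ennreal (real N / c) * emeasure M (hat Q)"
        by (intro add_mono e1 e2)
      also have "\<dots> = ennreal ((cW + real N) / c) * emeasure M (hat Q)"
        using c cW_ge_1 by (simp add: distrib_right[symmetric] ennreal_plus[symmetric] add_divide_distrib del: ennreal_plus)
      also have "\<dots> \<le> ennreal ((cW + real N) / c) * (ennreal H * emeasure M Q)"
        by (intro mult_left_mono hat_measure Q) auto
      also have "\<dots> = ennreal ((cW + real N) / c * H) * emeasure M Q"
        using c cW_ge_1 H_ge_1 by (subst ennreal_mult) (auto simp: mult.assoc)
      also have "(cW + real N) / c * H = \<epsilon> / 8"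
      proof -
        have "W / (8 * W * Z / \<epsilon>) * Z = \<epsilon> / 8" if "0 < W" "0 < Z" for W Z
          using that by simp
        moreover have "0 < cW + real N" "0 < H" using H_ge_1 cW_ge_1 by auto
        ultimately show ?thesis unfolding c_def stop_const_def .
      qed
      finally show ?thesis .
    qed
    have IE: "(\<integral>\<^sup>+x\<in>S. indicator E x \<partial>M) = emeasure M (E \<inter> S)" if "S \<in> sets M" for S
    proof -
      have "(\<integral>\<^sup>+x\<in>S. indicator E x \<partial>M) = (\<integral>\<^sup>+x. indicator (E \<inter> S) x \<partial>M)"
        by (intro nn_integral_cong) (auto split: split_indicator)
      thus ?thesis using that EM by (simp only: nn_integral_indicator sets.Int)
    qed
    obtain \<P> where \<P>: "\<P> \<subseteq> \<U>" "disjoint \<P>" "\<And>P. P \<in> \<P> \<Longrightarrow> P \<subseteq> Q"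
      "\<And>P. P \<in> \<P> \<Longrightarrow> ennreal (\<epsilon>/4) * emeasure M P \<le> (\<integral>\<^sup>+x\<in>P. indicator E x \<partial>M)"
      "\<And>P. P \<in> \<P> \<Longrightarrow> (\<integral>\<^sup>+x\<in>P. indicator E x \<partial>M) \<le> ennreal (\<epsilon>/4 / \<epsilon>) * emeasure M P"
      "AE x in M. x \<in> Q - \<Union>\<P> \<longrightarrow> indicator E x \<le> ennreal (\<epsilon>/4)"
    proof (rule cz_decomposition[OF Q, of "indicator E" "\<epsilon>/4"])
      have "(\<integral>\<^sup>+x\<in>Q. indicator E x \<partial>M) = emeasure M (E \<inter> Q)" by (rule IE) measurable
      also have "\<dots> \<le> emeasure M E" by (intro emeasure_mono) auto
      also have "\<dots> \<le> ennreal (\<epsilon>/4) * emeasure M Q"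
        using eps_pos by (intro order_trans[OF eE] mult_right_mono ennreal_leI) auto
      finally show "(\<integral>\<^sup>+x\<in>Q. indicator E x \<partial>M) \<le> ennreal (\<epsilon>/4) * emeasure M Q" .
    qed (use eps_pos in auto)
    have cP: "countable \<P>" by (rule countable_subset[OF \<P>(1) countable_cubes])
    have PM: "P \<in> sets M" if "P \<in> \<P>" for P using \<P>(1) cube_sets that by blast
    have UPQ: "\<Union>\<P> \<subseteq> Q" using \<P>(3) by blast
    have size: "emeasure M (\<Union>\<P>) \<le> ennreal (1/2) * emeasure M Q"
    proof -
      have "ennreal (\<epsilon>/4) * emeasure M (\<Union>\<P>) \<le> (\<integral>\<^sup>+x\<in>\<Union>\<P>. indicator E x \<partial>M)"
        by (rule nested_cubes_weak_type[OF \<P>(1) _ \<P>(4)]) auto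
      also have "\<dots> \<le> (\<integral>\<^sup>+x. indicator E x \<partial>M)" by (intro nn_integral_mono) (auto simp: indicator_def)
      also have "\<dots> = emeasure M E" by simp
      also note eE
      finally have *: "ennreal (\<epsilon>/4) * emeasure M (\<Union>\<P>) \<le> ennreal (\<epsilon> / 8) * emeasure M Q" .
      have "emeasure M (\<Union>\<P>) = ennreal (4/\<epsilon>) * (ennreal (\<epsilon>/4) * emeasure M (\<Union>\<P>))"
        using eps_pos by (simp add: mult.assoc[symmetric] ennreal_mult[symmetric])
      also have "\<dots> \<le> ennreal (4/\<epsilon>) * (ennreal (\<epsilon> / 8) * emeasure M Q)" by (intro mult_left_mono *) auto
      also have "\<dots> = ennreal (1/2) * emeasure M Q"
        using eps_pos by (simp add: mult.assoc[symmetric] ennreal_mult[symmetric])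
      finally show ?thesis .
    qed
    have off: "AE x in M. x \<in> Q \<longrightarrow> x \<notin> \<Union>\<P> \<longrightarrow> \<bar>Tloc f Q x\<bar> \<le> cS * a"
      using \<P>(6) AE_space
    proof eventually_elim
      case (elim x)
      show ?case
      proof (intro impI)
        assume x: "x \<in> Q" "x \<notin> \<Union>\<P>"
        have "x \<notin> E"
        proof
          \<comment> \<open>The value 1 of the indicator would be at most \<epsilon>/4, which is
            less than 1.\<close>
          assume "x \<in> E"
          hence "1 \<le> ennreal (\<epsilon>/4)" using elim x by auto
          thus False using eps_less_1 by (simp add: ennreal_1[symmetric] ennreal_le_iff2 del: ennreal_1)
        qed
        hence "\<bar>Tloc f Q x\<bar> \<le> c * a" using x elim unfolding E_def E1_def by auto
        also have "\<dots> \<le> cS * a" unfolding c_def using cS_ge a by (intro mult_right_mono) auto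
        finally show "\<bar>Tloc f Q x\<bar> \<le> cS * a" .
      qed
    qed
    have "AE x in M. x \<in> P \<longrightarrow> \<bar>Tloc f Q x\<bar> \<le> cS * a + \<bar>Tloc f P x\<bar>" if PP: "P \<in> \<P>" for P
    proof -
      have P: "P \<in> \<U>" using PP \<P>(1) by blast
      have PQ: "P \<subseteq> Q" by (rule \<P>(3)[OF PP])
      note PM[OF PP, measurable] dil_sets[OF P, measurable] TM[OF P, measurable]
      have cP: "cen P \<in> space M" and cQ: "cen Q \<in> space M" using cen_space P Q by auto
      have rP: "0 < rad P" by (rule rad_pos)
      have rPQ: "rad P \<le> rad Q" by (rule rad_mono[OF P Q PQ])
      have "cen P \<in> ball (cen Q) (C\<^sub>0 * rad Q)" using cen_in_cube[OF P] PQ cube_subset_ball[OF Q] by blast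
      hence dist: "\<rho> (cen Q) (cen P) < C\<^sub>0 * rad Q" by (simp add: mem_ball)
      have in_hat: "dil P \<subseteq> hat Q"
      proof -
        have "\<kappa> * (\<rho> (cen Q) (cen P) + \<alpha> * rad P) \<le> \<kappa> * (C\<^sub>0 * rad Q + \<alpha> * rad Q)"
          using dist rPQ alpha_ge kappa_ge_1 by (intro mult_left_mono add_mono) auto
        also have "\<dots> = \<gamma> * rad Q" unfolding dilation2_def by (simp add: algebra_simps)
        finally have "dil P \<subseteq> ball (cen Q) (\<gamma> * rad Q)" unfolding dil_def by (rule ball_subset_ball[OF cQ cP])
        thus ?thesis using ball_subset_hat[OF Q] by blast
      qed
      define s where "s = C\<^sub>0 * rad P"
      have s: "0 < s" unfolding s_def using C0_pos rP by simp
      have PB: "P \<subseteq> ball (cen P) s" unfolding s_def by (rule cube_subset_ball[OF P])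
      have core1: "ball (cen P) (A2 * s) \<subseteq> dil P"
        unfolding dil_def s_def using alpha_ge(2) rP mult_right_mono[of "A2 * C\<^sub>0" \<alpha> "rad P"]
        by (intro ball_mono) (simp add: mult.assoc)
      have core2: "ball (cen P) (A2 * s) \<subseteq> dil Q"
        unfolding dil_def
      proof (rule ball_subset_ball[OF cQ cP])
        have "A2 * s \<le> A2 * (C\<^sub>0 * rad Q)" unfolding s_def using rPQ C0_pos A2_ge by (intro mult_left_mono) auto
        hence "\<rho> (cen Q) (cen P) + A2 * s \<le> C\<^sub>0 * rad Q + A2 * (C\<^sub>0 * rad Q)" using dist by linarith
        hence "\<kappa> * (\<rho> (cen Q) (cen P) + A2 * s) \<le> \<kappa> * (C\<^sub>0 * rad Q + A2 * (C\<^sub>0 * rad Q))"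
          using kappa_ge_1 by (intro mult_left_mono) auto
        also have "\<dots> = \<alpha> * rad Q" unfolding dilation_def by (simp add: algebra_simps)
        finally show "\<kappa> * (\<rho> (cen Q) (cen P) + A2 * s) \<le> \<alpha> * rad Q" .
      qed
      have EP: "emeasure M (E \<inter> P) \<le> ennreal (1/4) * emeasure M P"
        using \<P>(5)[OF PP] IE[OF PM[OF PP]] eps_pos by simp
      have quarter: "ennreal (1/4) * emeasure M P < emeasure M P"
        unfolding emeasure_cube[OF P] using measure_cube_pos[OF P] by (simp add: ennreal_mult[symmetric] ennreal_less_iff)
      have "\<exists>x\<in>P. x \<notin> E"
      proof (rule ccontr)
        assume "\<not> ?thesis"
        hence "E \<inter> P = P" by blast
        thus False using EP quarter by simp
      qed
      then obtain x1 where x1: "x1 \<in> P" "x1 \<notin> E" by blast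
      have x1M: "Mx h x1 \<le> ennreal (c * a)"
        using x1 PQ sets.sets_into_space[OF PM[OF PP]] unfolding E_def E2_def by (auto simp: not_less)
      \<comment> \<open>A cube S containing the ball also contains the good point \<open>x1\<close>,
        where the maximal function is at most c a. Passing from S back to the ball costs A.\<close>
      have big: "(\<integral>\<^sup>+y\<in>ball (cen P) R. h y \<partial>M) \<le> ennreal (c * a * A) * emeasure M (ball (cen P) R)" if R: "s \<le> R" for R
      proof -
        have "0 < R" using s R by simp
        from ball_in_cube[OF cP this] obtain S where S: "S \<in> cubes \<DD>" "ball (cen P) R \<subseteq> S"
          "emeasure M S \<le> ennreal A * emeasure M (ball (cen P) R)" .
        have "x1 \<in> S" using x1 PB S(2) ball_mono[OF R, of "cen P"] by blast
        have "(\<integral>\<^sup>+y\<in>ball (cen P) R. h y \<partial>M) \<le> (\<integral>\<^sup>+y\<in>S. h y \<partial>M)"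
          using S(2) by (intro nn_integral_mono) (auto simp: indicator_def)
        also have "\<dots> \<le> ennreal (c * a) * emeasure M S" by (rule integral_le_Mx[OF S(1) \<open>x1 \<in> S\<close> x1M])
        also have "\<dots> \<le> ennreal (c * a) * (ennreal A * emeasure M (ball (cen P) R))" by (intro mult_left_mono S) auto
        also have "\<dots> = ennreal (c * a * A) * emeasure M (ball (cen P) R)"
          using ca A_ge_1 by (subst ennreal_mult) (auto simp: mult.assoc)
        finally show ?thesis .
      qed
      \<comment> \<open>Solves (cW / t) * (c a A) * dbl \<alpha> = 1/4, so that
        \<open>Tloc f P\<close> exceeds t only on a set of at most a quarter of the measure of
        P.\<close>
      define c2 where "c2 = 4 * cW * dbl \<alpha>"
      have c2: "1 \<le> c2" unfolding c2_def using mult_mono[OF cW_ge_1 dbl_ge_1[of \<alpha>]] cW_ge_1 by simp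
      define t where "t = c2 * (c * a * A)"
      have caA: "0 < c * a * A" using ca A_ge_1 by simp
      have t: "0 < t" unfolding t_def using c2 caA by simp
      have If: "(\<integral>\<^sup>+y. ennreal \<bar>f y * indicator (dil P) y\<bar> \<partial>M) \<le> ennreal (c * a * A) * emeasure M (dil P)"
      proof -
        have "(\<integral>\<^sup>+y. ennreal \<bar>f y * indicator (dil P) y\<bar> \<partial>M) \<le> (\<integral>\<^sup>+y\<in>dil P. h y \<partial>M)"
          unfolding h_def using in_hat by (intro nn_integral_mono) (auto simp: indicator_def)
        also have "\<dots> \<le> ennreal (c * a * A) * emeasure M (dil P)"
          unfolding dil_def s_def using alpha_ge rP by (intro big) (auto simp: s_def)
        finally show ?thesis .
      qed
      define Bd where "Bd = {x \<in> space M. t < \<bar>Tloc f P x\<bar>}"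
      have BdM [measurable]: "Bd \<in> sets M" unfolding Bd_def by measurable
      have Bd: "emeasure M Bd \<le> ennreal (1/4) * emeasure M P"
      proof -
        have hP: "hat P \<in> cubes \<DD>" by (rule hat_cubes[OF P])
        have "emeasure M Bd \<le> ennreal (cW / t) * (\<integral>\<^sup>+y. ennreal \<bar>f y * indicator (dil P) y\<bar> \<partial>M)"
          unfolding Bd_def Tloc_def
        proof (rule weak[OF hP fdL2[OF P] _ t])
          show "f x * indicator (dil P) x = 0" if "x \<notin> hat P" for x
            using that dil_subset_hat[OF P] by (auto simp: indicator_def)
          have "ennreal (c * a * A) * emeasure M (dil P) \<le> ennreal t * emeasure M (hat P)"
          proof (rule mult_mono)
            show "ennreal (c * a * A) \<le> ennreal t"
              unfolding t_def using mult_right_mono[OF c2, of "c * a * A"] caA by (intro ennreal_leI) simp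
            show "emeasure M (dil P) \<le> emeasure M (hat P)"
              by (intro emeasure_mono dil_subset_hat P cubes_sets hP)
          qed auto
          with If show "(\<integral>\<^sup>+y. ennreal \<bar>f y * indicator (dil P) y\<bar> \<partial>M) \<le> ennreal t * emeasure M (hat P)"
            by (rule order_trans)
        qed
        also have "\<dots> \<le> ennreal (cW / t) * (ennreal (c * a * A) * emeasure M (dil P))" by (intro mult_left_mono If) auto
        also have "emeasure M (dil P) = ennreal (V (cen P) (\<alpha> * rad P))"
          unfolding dil_def using alpha_ge rP by (intro emeasure_ball cP) auto
        also have "ennreal (cW / t) * (ennreal (c * a * A) * ennreal (V (cen P) (\<alpha> * rad P)))
          \<le> ennreal (cW / t) * (ennreal (c * a * A) * ennreal (dbl \<alpha> * measure M P))"
        proof (intro mult_left_mono ennreal_leI)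
          have "V (cen P) (\<alpha> * rad P) \<le> dbl \<alpha> * V (cen P) (rad P)" by (intro V_scale cP rP alpha_ge)
          also have "\<dots> \<le> dbl \<alpha> * measure M P" using V_le_cube[OF P] dbl_pos[of \<alpha>] by (intro mult_left_mono) auto
          finally show "V (cen P) (\<alpha> * rad P) \<le> dbl \<alpha> * measure M P" .
        qed auto
        also have "\<dots> = ennreal (cW / t * (c * a * A) * dbl \<alpha>) * emeasure M P"
        proof -
          have "ennreal u * (ennreal v * ennreal (w * z)) = ennreal (u * v * w) * ennreal z"
            if "0 \<le> u" "0 \<le> v" "0 \<le> w" "0 \<le> z" for u v w z :: real
            using that by (simp add: ennreal_mult mult.assoc)
          from this[of "cW / t" "c * a * A" "dbl \<alpha>" "measure M P"] show ?thesis
            unfolding emeasure_cube[OF P] using cW_ge_1 t caA dbl_pos[of \<alpha>] by simp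
        qed
        also have "cW / t * (c * a * A) * dbl \<alpha> = 1/4"
        proof -
          have "W / (4 * W * d * Y) * Y * d = 1/4" if "0 < W" "0 < d" "0 < Y" for W d Y :: real
            using that by simp
          from this[of cW "dbl \<alpha>" "c * a * A"] show ?thesis
            unfolding t_def c2_def using caA cW_ge_1 dbl_pos[of \<alpha>] by linarith
        qed
        finally show ?thesis .
      qed
      \<comment> \<open>Both dilates contain the ball of radius A2 s about the centre of P, so their
        difference vanishes there and \<open>oscillation_bound\<close> applies to F on P.\<close>
      define F where "F y = f y * indicator (dil Q) y - f y * indicator (dil P) y" for y
      have FL2: "in_L2 M F" unfolding F_def by (intro in_L2_diff fdL2 P Q)
      have Fh: "ennreal \<bar>F y\<bar> \<le> h y" for y
        unfolding F_def h_def using in_hat dil_subset_hat[OF Q] by (auto simp: indicator_def)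
      have Fi: "integrable M F"
      proof (rule in_L2_integrable[OF FL2 cubes_sets[OF hQ] cubes_finite[OF hQ]])
        show "F x = 0" if "x \<notin> hat Q" for x
          using that in_hat dil_subset_hat[OF Q] by (auto simp: F_def indicator_def)
      qed
      have F0: "F y = 0" if "y \<in> ball (cen P) (A2 * s)" for y
        using that core1 core2 by (auto simp: F_def indicator_def)
      have sA: "s \<le> A2 * s" using A2_ge s by simp
      have FI: "(\<integral>\<^sup>+y\<in>ball (cen P) R. ennreal \<bar>F y\<bar> \<partial>M) \<le> ennreal (c * a * A) * emeasure M (ball (cen P) R)" if "A2 * s \<le> R" for R
        using that sA by (intro order_trans[OF _ big] nn_integral_mono mult_right_mono Fh) auto
      obtain k where k: "AE x in M. x \<in> ball (cen P) s \<longrightarrow> ennreal \<bar>T F x - k\<bar> \<le> ennreal (ctail \<eta>) * ennreal (c * a * A)"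
        using oscillation_bound[OF cP s FL2 Fi F0 FI] by blast
      have TF: "AE x in M. T F x = Tloc f Q x - Tloc f P x"
        unfolding Tloc_def F_def by (intro T_diff fdL2 P Q)
      define L where "L = ctail \<eta> * (c * a * A)"
      have L: "0 < L" unfolding L_def using ctail_pos[OF eta_pos] caA by simp
      have both: "AE x in M. x \<in> P \<longrightarrow> \<bar>Tloc f Q x - Tloc f P x - k\<bar> \<le> L"
        using k TF
      proof eventually_elim
        case (elim x)
        show ?case
        proof
          assume "x \<in> P"
          hence "ennreal \<bar>T F x - k\<bar> \<le> ennreal L"
            using elim PB ctail_pos[OF eta_pos] caA by (auto simp: L_def ennreal_mult)
          thus "\<bar>Tloc f Q x - Tloc f P x - k\<bar> \<le> L" using elim L by (auto simp: ennreal_le_iff)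
        qed
      qed
      \<comment> \<open>Two exceptional sets of at most a quarter each cannot fill P. Keeping the
        almost everywhere bound as an implication inside the existence claim ensures that it holds
        at the chosen point \<open>x2\<close>.\<close>
      have "\<exists>x. (x \<in> P \<longrightarrow> \<bar>Tloc f Q x - Tloc f P x - k\<bar> \<le> L) \<and> x \<in> P \<and> x \<notin> E \<union> Bd"
      proof (rule ccontr)
        assume neg: "\<not> ?thesis"
        have "AE x in M. x \<in> P \<longrightarrow> x \<in> (E \<inter> P) \<union> Bd"
          using both by eventually_elim (use neg in auto)
        hence "emeasure M P \<le> emeasure M ((E \<inter> P) \<union> Bd)" by (rule emeasure_mono_AE) measurable
        also have "\<dots> \<le> emeasure M (E \<inter> P) + emeasure M Bd" by (rule emeasure_subadditive) auto
        also have "\<dots> \<le> ennreal (1/4) * emeasure M P + ennreal (1/4) * emeasure M P" by (intro add_mono EP Bd)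
        also have "\<dots> = ennreal (1/2 * measure M P)"
          unfolding emeasure_cube[OF P] by (simp add: ennreal_mult[symmetric] ennreal_plus[symmetric] del: ennreal_plus)
        finally show False
          unfolding emeasure_cube[OF P] using measure_cube_pos[OF P] by (simp add: ennreal_le_iff)
      qed
      then obtain x2 where x2: "\<bar>Tloc f Q x2 - Tloc f P x2 - k\<bar> \<le> L" "x2 \<in> P" "x2 \<notin> E" "x2 \<notin> Bd" by blast
      have x2s: "x2 \<in> space M" using x2(2) sets.sets_into_space[OF PM[OF PP]] by blast
      have "\<bar>Tloc f Q x2\<bar> \<le> c * a" using x2 PQ x2s unfolding E_def E1_def by (auto simp: not_less)
      moreover have "\<bar>Tloc f P x2\<bar> \<le> t" using x2(4) x2s unfolding Bd_def by (auto simp: not_less)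
      ultimately have k_le: "\<bar>k\<bar> \<le> L + c * a + t" using x2(1) by linarith
      \<comment> \<open>The bound of k through \<open>x2\<close> uses L + c a + t; the second L
        leads from k to an arbitrary point of P.\<close>
      have cSa: "cS * a = 2 * L + c * a + t"
        unfolding sparse_const_def L_def t_def c2_def c_def by (simp add: algebra_simps)
      show ?thesis using both
      proof eventually_elim
        case (elim x)
        thus ?case using k_le cSa by linarith
      qed
    qed
    hence on: "AE x in M. \<forall>P\<in>\<P>. x \<in> P \<longrightarrow> \<bar>Tloc f Q x\<bar> \<le> cS * a + \<bar>Tloc f P x\<bar>"
      using cP by (subst AE_ball_countable) auto
    show ?thesis
    proof (intro exI[of _ \<P>] conjI)
      show "AE x in M. x \<in> Q \<longrightarrow> (x \<notin> \<Union>\<P> \<longrightarrow> \<bar>Tloc f Q x\<bar> \<le> cS * avg f (hat Q)) \<and>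
        (\<forall>P\<in>\<P>. x \<in> P \<longrightarrow> \<bar>Tloc f Q x\<bar> \<le> cS * avg f (hat Q) + \<bar>Tloc f P x\<bar>)"
        using off on unfolding a_def by eventually_elim blast
    qed (use \<P>(1,2) UPQ size in auto)
  qed
qed

end

section \<open>Iteration of the stopping time\<close>

context cz_main begin

text \<open>Each generation of stopping cubes has at most half the measure of the preceding one, so
  almost every x leaves them after finitely many steps. Adding the bounds of
  \<open>sparse_step\<close> along this finite chain gives the sum over J, and J therefore depends
  on x.\<close>

theorem sparse_domination:
  assumes f: "in_L2 M f" and Q0: "Q0 \<in> \<U>"
  obtains \<S> E where "\<S> \<subseteq> \<U>" "\<And>Q. Q \<in> \<S> \<Longrightarrow> E Q \<in> sets M" "\<And>Q. Q \<in> \<S> \<Longrightarrow> E Q \<subseteq> Q"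
    "disjoint_family_on E \<S>" "\<And>Q. Q \<in> \<S> \<Longrightarrow> emeasure M Q \<le> 2 * emeasure M (E Q)"
    "AE x in M. x \<in> Q0 \<longrightarrow> (\<exists>J\<subseteq>\<S>. finite J \<and> \<bar>Tloc f Q0 x\<bar> \<le> cS * (\<Sum>Q\<in>J. avg f (hat Q) * indicator Q x))"
proof -
  define ok where "ok Q \<P> x \<longleftrightarrow> (x \<in> Q \<longrightarrow> (x \<notin> \<Union>\<P> \<longrightarrow> \<bar>Tloc f Q x\<bar> \<le> cS * avg f (hat Q)) \<and>
    (\<forall>P\<in>\<P>. x \<in> P \<longrightarrow> \<bar>Tloc f Q x\<bar> \<le> cS * avg f (hat Q) + \<bar>Tloc f P x\<bar>))" for Q \<P> x
  have "\<forall>Q\<in>\<U>. \<exists>\<P>. \<P> \<subseteq> \<U> \<and> disjoint \<P> \<and> \<Union>\<P> \<subseteq> Q \<and> emeasure M (\<Union>\<P>) \<le> ennreal (1/2) * emeasure M Q \<and> (AE x in M. ok Q \<P> x)"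
    using sparse_step[OF f] unfolding ok_def by blast
  from bchoice[OF this] obtain st where st: "\<And>Q. Q \<in> \<U> \<Longrightarrow> st Q \<subseteq> \<U>" "\<And>Q. Q \<in> \<U> \<Longrightarrow> disjoint (st Q)"
    "\<And>Q. Q \<in> \<U> \<Longrightarrow> \<Union>(st Q) \<subseteq> Q" "\<And>Q. Q \<in> \<U> \<Longrightarrow> emeasure M (\<Union>(st Q)) \<le> ennreal (1/2) * emeasure M Q"
    "\<And>Q. Q \<in> \<U> \<Longrightarrow> AE x in M. ok Q (st Q) x" by metis
  \<comment> \<open>The generations of stopping cubes that start from Q0. The set \<open>E Q\<close>
    below removes from Q the next generation and with it all later ones.\<close>
  define S :: "nat \<Rightarrow> 'a set set" where "S n = ((\<lambda>L. \<Union>(st ` L)) ^^ n) {Q0}" for n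
  have S0: "S 0 = {Q0}" and SS: "S (Suc n) = \<Union>(st ` S n)" for n unfolding S_def by auto
  have SU: "S n \<subseteq> \<U>" for n by (induction n) (use Q0 st(1) in \<open>auto simp: S0 SS\<close>)
  have Sdj: "disjoint (S n)" for n
  proof (induction n)
    case (Suc n)
    show ?case
    proof (rule disjointI)
      fix P R assume "P \<in> S (Suc n)" "R \<in> S (Suc n)" "P \<noteq> R"
      then obtain Q Q' where Q: "Q \<in> S n" "P \<in> st Q" "Q' \<in> S n" "R \<in> st Q'" by (auto simp: SS)
      have U: "Q \<in> \<U>" "Q' \<in> \<U>" using Q SU by auto
      show "P \<inter> R = {}"
      proof (cases "Q = Q'")
        case True
        thus ?thesis using st(2)[OF U(1)] Q \<open>P \<noteq> R\<close> by (auto simp: disjoint_def)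
      next
        case False
        hence "Q \<inter> Q' = {}" using Suc Q by (auto simp: disjoint_def)
        thus ?thesis using st(3)[OF U(1)] st(3)[OF U(2)] Q by blast
      qed
    qed
  qed (simp add: S0)
  have Sdec1: "\<Union>(S (Suc n)) \<subseteq> \<Union>(S n)" for n using st(3) SU[of n] unfolding SS by blast
  have Sdec: "\<Union>(S m) \<subseteq> \<Union>(S n)" if "n \<le> m" for n m
    using that by (induction rule: dec_induct) (use Sdec1 in blast)+
  have in_st: "x \<in> \<Union>(st Q)" if a: "Q \<in> S n" "x \<in> Q" "x \<in> \<Union>(S (Suc n))" for Q n x
  proof -
    obtain P Q' where P: "Q' \<in> S n" "P \<in> st Q'" "x \<in> P" using a(3) by (auto simp: SS)
    hence "x \<in> Q'" using st(3)[of Q'] SU[of n] by blast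
    hence "Q' = Q" using Sdj[of n] P(1) a by (auto simp: disjoint_def)
    thus ?thesis using P by blast
  qed
  define \<S> where "\<S> = (\<Union>n. S n)"
  define E where "E Q = Q - \<Union>(st Q)" for Q
  have SSU: "\<S> \<subseteq> \<U>" unfolding \<S>_def using SU by blast
  have cst: "countable (st Q)" if "Q \<in> \<U>" for Q using st(1)[OF that] countable_cubes by (rule countable_subset)
  have stM: "\<Union>(st Q) \<in> sets M" if "Q \<in> \<U>" for Q
    using cst[OF that] st(1)[OF that] cube_sets by (intro sets.countable_Union) auto
  have EM: "E Q \<in> sets M" if "Q \<in> \<S>" for Q
    unfolding E_def using that SSU by (intro sets.Diff cube_sets stM) auto
  have Elarge: "emeasure M Q \<le> 2 * emeasure M (E Q)" if "Q \<in> \<S>" for Q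
  proof -
    have QU: "Q \<in> \<U>" using that SSU by blast
    have "emeasure M Q = emeasure M (E Q) + emeasure M (\<Union>(st Q))"
      using st(3)[OF QU] EM[OF that] stM[OF QU] unfolding E_def
      by (subst plus_emeasure) (auto intro!: arg_cong[where f = "emeasure M"])
    also have "\<dots> \<le> emeasure M (E Q) + ennreal (1/2) * emeasure M Q" by (intro add_left_mono st QU)
    finally have *: "emeasure M Q \<le> emeasure M (E Q) + ennreal (1/2) * emeasure M Q" .
    have "emeasure M (E Q) < \<infinity>" using cube_finite[OF QU] emeasure_mono[OF _ cube_sets[OF QU], of "E Q"]
      unfolding E_def by (auto intro: le_less_trans)
    hence e: "emeasure M (E Q) = ennreal (measure M (E Q))" by (intro emeasure_eq_ennreal_measure) auto
    have h: "ennreal (1/2) * ennreal (measure M Q) = ennreal (measure M Q / 2)"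
      by (subst ennreal_mult[symmetric]) auto
    from * have "ennreal (measure M Q) \<le> ennreal (measure M (E Q) + measure M Q / 2)"
      unfolding e emeasure_cube[OF QU] h by (simp only: ennreal_plus measure_nonneg divide_nonneg_nonneg zero_le_numeral)
    hence "measure M Q \<le> measure M (E Q) + measure M Q / 2" by (subst (asm) ennreal_le_iff) auto
    hence "measure M Q \<le> 2 * measure M (E Q)" by simp
    hence "ennreal (measure M Q) \<le> ennreal (2 * measure M (E Q))" by (rule ennreal_leI)
    thus ?thesis unfolding e emeasure_cube[OF QU] by (simp add: ennreal_mult)
  qed
  have E_off: "x \<notin> \<Union>(S m)" if "Q \<in> S n" "n < m" "x \<in> E Q" for Q n m x
  proof
    assume "x \<in> \<Union>(S m)"
    hence "x \<in> \<Union>(S (Suc n))" using Sdec[of "Suc n" m] that(2) by (auto simp only: Suc_le_eq)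
    from in_st[OF that(1) _ this] that(3) show False unfolding E_def by blast
  qed
  have Edj: "disjoint_family_on E \<S>"
    unfolding disjoint_family_on_def
  proof (intro ballI impI equalityI subsetI)
    fix Q R x assume *: "Q \<in> \<S>" "R \<in> \<S>" "Q \<noteq> R" "x \<in> E Q \<inter> E R"
    then obtain n m where nm: "Q \<in> S n" "R \<in> S m" unfolding \<S>_def by blast
    have x: "x \<in> Q" "x \<in> R" using * unfolding E_def by auto
    consider "n < m" | "m < n" | "n = m" by linarith
    thus "x \<in> {}"
    proof cases
      case 1 thus ?thesis using E_off[OF nm(1), of m x] * x nm by blast
    next
      case 2 thus ?thesis using E_off[OF nm(2), of n x] * x nm by blast
    next
      case 3 thus ?thesis using Sdj[of n] nm * x by (auto simp: disjoint_def)
    qed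
  qed auto
  \<comment> \<open>J is a set, so a cube repeated along a chain would be counted only once.
    Repetition is impossible: it would make \<open>E Q\<close> empty, although it carries at least
    half of the measure of Q.\<close>
  have fresh: "Q \<notin> S k" if "Q \<in> S n" "k < n" for Q n k
  proof
    assume k: "Q \<in> S k"
    have "E Q = {}" using E_off[OF k that(2)] that(1) unfolding E_def by blast
    moreover have "Q \<in> \<S>" unfolding \<S>_def using k by blast
    ultimately show False using Elarge[of Q] cube_pos[of Q] SSU by auto
  qed
  have SnS: "S n \<subseteq> sets M" for n using SU cube_sets by blast
  have SnM: "\<Union>(S n) \<in> sets M" for n
    by (rule sets.countable_Union[OF countable_subset[OF SU countable_cubes] SnS])
  \<comment> \<open>The estimate holds on each cube of the generation, and
    \<open>emeasure_nested_le\<close> passes to the union.\<close>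
  have half: "emeasure M (\<Union>(S (Suc n))) \<le> ennreal (1/2) * emeasure M (\<Union>(S n))" for n
  proof -
    have "emeasure (density M (indicator (\<Union>(S (Suc n))))) (\<Union>(S n)) \<le> emeasure (density M (\<lambda>_. ennreal (1/2))) (\<Union>(S n))"
    proof (rule emeasure_nested_le[OF countable_subset[OF SU countable_cubes] nested_subset[OF nested_cubes SU]])
      fix Q assume Q: "Q \<in> S n"
      hence QU: "Q \<in> \<U>" using SU by blast
      note cube_sets[OF QU, measurable] SnM[measurable]
      have "emeasure (density M (indicator (\<Union>(S (Suc n))))) Q = (\<integral>\<^sup>+x. indicator (\<Union>(S (Suc n))) x * indicator Q x \<partial>M)"
        by (rule emeasure_density) measurable
      also have "\<dots> \<le> (\<integral>\<^sup>+x. indicator (\<Union>(st Q)) x \<partial>M)"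
        using in_st[OF Q] by (intro nn_integral_mono) (auto split: split_indicator)
      also have "\<dots> = emeasure M (\<Union>(st Q))" using stM[OF QU] by (rule nn_integral_indicator)
      also have "\<dots> \<le> ennreal (1/2) * emeasure M Q" by (rule st(4)[OF QU])
      also have "\<dots> = emeasure (density M (\<lambda>_. ennreal (1/2))) Q"
        by (subst emeasure_density) (auto simp: nn_integral_cmult_indicator)
      finally show "emeasure (density M (indicator (\<Union>(S (Suc n))))) Q \<le> emeasure (density M (\<lambda>_. ennreal (1/2))) Q" .
    qed (use SnS in auto)
    also have "\<dots> = ennreal (1/2) * emeasure M (\<Union>(S n))"
      using SnM[of n] by (subst emeasure_density) (auto simp: nn_integral_cmult_indicator)
    also have "emeasure (density M (indicator (\<Union>(S (Suc n))))) (\<Union>(S n)) = (\<integral>\<^sup>+x. indicator (\<Union>(S (Suc n))) x * indicator (\<Union>(S n)) x \<partial>M)"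
      by (intro emeasure_density borel_measurable_indicator SnM)
    also have "\<dots> = (\<integral>\<^sup>+x. indicator (\<Union>(S (Suc n))) x \<partial>M)"
      using Sdec1[of n] by (intro nn_integral_cong) (auto split: split_indicator)
    also have "\<dots> = emeasure M (\<Union>(S (Suc n)))" using SnM by (rule nn_integral_indicator)
    finally show ?thesis .
  qed
  have small: "emeasure M (\<Union>(S n)) \<le> ennreal ((1/2) ^ n * measure M Q0)" for n
  proof (induction n)
    case 0
    show ?case using emeasure_cube[OF Q0] by (simp add: S0)
  next
    case (Suc n)
    have "emeasure M (\<Union>(S (Suc n))) \<le> ennreal (1/2) * ennreal ((1/2) ^ n * measure M Q0)"
      using half[of n] Suc by (meson mult_left_mono order_trans zero_le)
    also have "\<dots> = ennreal (1/2 * ((1/2) ^ n * measure M Q0))" by (rule ennreal_mult[symmetric]) auto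
    finally show ?case by (simp only: power_Suc mult.assoc)
  qed
  have "emeasure M (\<Inter>n. \<Union>(S n)) \<le> 0"
  proof (rule LIMSEQ_le_const)
    have "(\<lambda>n. (1/2) ^ n * measure M Q0) \<longlonglongrightarrow> 0 * measure M Q0"
      by (intro tendsto_mult LIMSEQ_power_zero tendsto_const) auto
    thus "(\<lambda>n. ennreal ((1/2) ^ n * measure M Q0)) \<longlonglongrightarrow> 0"
      using tendsto_ennrealI by fastforce
    show "\<exists>N. \<forall>n\<ge>N. emeasure M (\<Inter>n. \<Union>(S n)) \<le> ennreal ((1/2) ^ n * measure M Q0)"
    proof (intro exI allI impI)
      fix n
      have "emeasure M (\<Inter>n. \<Union>(S n)) \<le> emeasure M (\<Union>(S n))" using SnM by (intro emeasure_mono) auto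
      thus "emeasure M (\<Inter>n. \<Union>(S n)) \<le> ennreal ((1/2) ^ n * measure M Q0)" using small order_trans by blast
    qed
  qed
  moreover have "(\<Inter>n. \<Union>(S n)) \<in> sets M" using SnM by (intro sets.countable_INT) auto
  ultimately have "(\<Inter>n. \<Union>(S n)) \<in> null_sets M" by (intro null_setsI) auto
  from AE_not_in[OF this] have lim: "AE x in M. \<exists>n. x \<notin> \<Union>(S n)" by eventually_elim blast
  have good: "AE x in M. \<forall>Q\<in>\<U>. ok Q (st Q) x"
    using st(5) countable_cubes by (subst AE_ball_countable) auto
  have "AE x in M. x \<in> Q0 \<longrightarrow> (\<exists>J\<subseteq>\<S>. finite J \<and> \<bar>Tloc f Q0 x\<bar> \<le> cS * (\<Sum>Q\<in>J. avg f (hat Q) * indicator Q x))"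
    using lim good
  proof eventually_elim
    case (elim x)
    define sm where "sm J = (\<Sum>Q\<in>J. avg f (hat Q) * indicator Q x)" for J
    have sm_insert: "sm (insert Q J) = avg f (hat Q) + sm J" if "finite J" "Q \<notin> J" "x \<in> Q" for Q J
      using that unfolding sm_def by (subst sum.insert) (simp_all only: indicator_simps mult_1_right not_False_eq_True)
    \<comment> \<open>J collects cubes of the generations below n, whose averages have already been
      paid for; the current cube Q still carries an operator term.\<close>
    have claim: "\<exists>Q J. Q \<in> S n \<and> x \<in> Q \<and> finite J \<and> J \<subseteq> (\<Union>k<n. S k) \<and> \<bar>Tloc f Q0 x\<bar> \<le> cS * sm J + \<bar>Tloc f Q x\<bar>"
      if "x \<in> \<Union>(S n)" for n
      using that
    proof (induction n)
      case 0
      show ?case using 0 by (intro exI[of _ Q0] exI[of _ "{}"]) (auto simp: S0 sm_def)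
    next
      case (Suc n)
      hence "x \<in> \<Union>(S n)" using Sdec1 by blast
      from Suc.IH[OF this] obtain Q J where QJ: "Q \<in> S n" "x \<in> Q" "finite J" "J \<subseteq> (\<Union>k<n. S k)"
        "\<bar>Tloc f Q0 x\<bar> \<le> cS * sm J + \<bar>Tloc f Q x\<bar>" by blast
      obtain P where P: "P \<in> st Q" "x \<in> P" using in_st[OF QJ(1,2) Suc.prems] by blast
      have "Q \<in> \<U>" using QJ(1) SU by blast
      hence "\<bar>Tloc f Q x\<bar> \<le> cS * avg f (hat Q) + \<bar>Tloc f P x\<bar>" using elim(2) P QJ(2) unfolding ok_def by blast
      moreover have "Q \<notin> J" using fresh[OF QJ(1)] QJ(4) by blast
      ultimately have "\<bar>Tloc f Q0 x\<bar> \<le> cS * sm (insert Q J) + \<bar>Tloc f P x\<bar>"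
        using QJ(5) sm_insert[OF QJ(3) _ QJ(2)] by (simp add: distrib_left)
      moreover have "P \<in> S (Suc n)" using P QJ by (auto simp: SS)
      moreover have "insert Q J \<subseteq> (\<Union>k<Suc n. S k)" using QJ(1,4) unfolding lessThan_Suc by blast
      ultimately show ?case using P(2) QJ(3) by (intro exI[of _ P] exI[of _ "insert Q J"]) auto
    qed
    show ?case
    proof
      assume "x \<in> Q0"
      hence x0: "x \<in> \<Union>(S 0)" by (simp add: S0)
      define l where "l = (LEAST n. x \<notin> \<Union>(S n))"
      have l: "x \<notin> \<Union>(S l)" unfolding l_def using elim(1) by (rule LeastI_ex)
      have "l \<noteq> 0" using x0 l by metis
      then obtain n where n: "l = Suc n" by (cases l) auto
      have "x \<in> \<Union>(S n)" using not_less_Least[of n "\<lambda>n. x \<notin> \<Union>(S n)"] n unfolding l_def by auto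
      from claim[OF this] obtain Q J where QJ: "Q \<in> S n" "x \<in> Q" "finite J" "J \<subseteq> (\<Union>k<n. S k)"
        "\<bar>Tloc f Q0 x\<bar> \<le> cS * sm J + \<bar>Tloc f Q x\<bar>" by blast
      have "x \<notin> \<Union>(st Q)" using l QJ unfolding n SS by blast
      moreover have "Q \<in> \<U>" using QJ(1) SU by blast
      ultimately have "\<bar>Tloc f Q x\<bar> \<le> cS * avg f (hat Q)" using elim(2) QJ(2) unfolding ok_def by blast
      moreover have "Q \<notin> J" using fresh[OF QJ(1)] QJ(4) by blast
      ultimately have "\<bar>Tloc f Q0 x\<bar> \<le> cS * sm (insert Q J)"
        using QJ(5) sm_insert[OF QJ(3) _ QJ(2)] by (simp add: distrib_left)
      moreover have "insert Q J \<subseteq> \<S>" unfolding \<S>_def using QJ by blast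
      ultimately show "\<exists>J\<subseteq>\<S>. finite J \<and> \<bar>Tloc f Q0 x\<bar> \<le> cS * (\<Sum>Q\<in>J. avg f (hat Q) * indicator Q x)"
        using QJ(3) unfolding sm_def by blast
    qed
  qed
  thus thesis using that[OF SSU EM _ Edj Elarge] unfolding E_def by blast
qed

end

section \<open>Weighted estimates for sparse sums\<close>

text \<open>Used with the exponents q and q - 1. The latter may be less than 1, and the density is
  then unbounded near 0.\<close>

lemma nn_integral_powr_layer:
  assumes s: "0 < s" and c: "0 \<le> (c::real)"
  shows "(\<integral>\<^sup>+t. ennreal (s * t powr (s - 1)) * indicator {0<..<c} t \<partial>lborel) = ennreal (c powr s)"
proof -
  have "((\<lambda>t. s * t powr (s - 1)) has_integral (s * (c powr (s - 1 + 1) / (s - 1 + 1)))) {0..c}"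
    using s c by (intro has_integral_mult_right has_integral_powr_from_0) auto
  hence "((\<lambda>t. s * t powr (s - 1)) has_integral (c powr s)) {0..c}" using s by simp
  hence "(\<integral>\<^sup>+t. ennreal (s * t powr (s - 1)) * indicator {0..c} t \<partial>lborel) = ennreal (c powr s)"
    using s by (intro nn_integral_has_integral_lebesgue') auto
  moreover have "(\<integral>\<^sup>+t. ennreal (s * t powr (s - 1)) * indicator {0<..<c} t \<partial>lborel)
    = (\<integral>\<^sup>+t. ennreal (s * t powr (s - 1)) * indicator {0..c} t \<partial>lborel)"
    using AE_lborel_singleton[of 0] AE_lborel_singleton[of c]
    by (intro nn_integral_cong_AE, eventually_elim) (auto split: split_indicator)
  ultimately show ?thesis by simp
qed

text \<open>A Marcinkiewicz interpolation argument: the weak type hypothesis only sees the part of \<open>g\<close> above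
  \<open>t/2\<close>, which makes the layer cake integral converge and produces the factor \<open>q/(q - 1)\<close>.\<close>

lemma layer_cake_sum_le:
  fixes g :: "'a \<Rightarrow> real" and v :: "'a \<Rightarrow> ennreal" and c m :: "'i \<Rightarrow> real"
  assumes "sigma_finite_measure M" and J: "finite J" and c: "\<And>i. i \<in> J \<Longrightarrow> 0 \<le> c i" and m: "\<And>i. i \<in> J \<Longrightarrow> 0 \<le> m i"
    and g [measurable]: "g \<in> borel_measurable M" and g0: "\<And>x. 0 \<le> g x" and v [measurable]: "v \<in> borel_measurable M"
    and q: "1 < q" and k: "0 \<le> k"
    and weak: "\<And>t. 0 < t \<Longrightarrow> ennreal (\<Sum>i\<in>{i\<in>J. t < c i}. m i)
      \<le> ennreal (k / t) * (\<integral>\<^sup>+x. (if t / 2 < g x then ennreal (g x) * v x else 0) \<partial>M)"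
  shows "ennreal (\<Sum>i\<in>J. m i * c i powr q) \<le> ennreal (k * 2 powr (q - 1) * (q / (q - 1))) * (\<integral>\<^sup>+x. ennreal (g x powr q) * v x \<partial>M)"
proof -
  interpret M: sigma_finite_measure M by fact
  interpret pair_sigma_finite lborel M ..
  define \<phi> where "\<phi> t = ennreal (q * t powr (q - 1))" for t :: real
  have [measurable]: "\<phi> \<in> borel_measurable borel" unfolding \<phi>_def by measurable
  \<comment> \<open>The density for the exponent q - 1. The factor k / t of the weak type bound
    turns \<open>\<phi>\<close> into \<open>cc * \<psi>\<close>, and the integral of \<psi> over (0,
    2 g) is (2 g)^(q-1), whence the factor 2^(q-1).\<close>
  define \<psi> where "\<psi> t = ennreal ((q - 1) * t powr (q - 1 - 1))" for t :: real
  have [measurable]: "\<psi> \<in> borel_measurable borel" unfolding \<psi>_def by measurable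
  define cc where "cc = k * (q / (q - 1))"
  have cc: "0 \<le> cc" unfolding cc_def using k q by simp
  have "ennreal (\<Sum>i\<in>J. m i * c i powr q) = (\<Sum>i\<in>J. ennreal (m i) * ennreal (c i powr q))"
    using m by (subst sum_ennreal[symmetric]) (auto simp: ennreal_mult)
  also have "\<dots> = (\<Sum>i\<in>J. ennreal (m i) * (\<integral>\<^sup>+t. \<phi> t * indicator {0<..<c i} t \<partial>lborel))"
    unfolding \<phi>_def using c q by (intro sum.cong) (auto simp: nn_integral_powr_layer)
  also have "\<dots> = (\<Sum>i\<in>J. (\<integral>\<^sup>+t. ennreal (m i) * (\<phi> t * indicator {0<..<c i} t) \<partial>lborel))"
    by (intro sum.cong refl nn_integral_cmult[symmetric]) measurable
  also have "\<dots> = (\<integral>\<^sup>+t. (\<Sum>i\<in>J. ennreal (m i) * (\<phi> t * indicator {0<..<c i} t)) \<partial>lborel)"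
    by (intro nn_integral_sum[symmetric]) measurable
  also have "\<dots> \<le> (\<integral>\<^sup>+t. (\<integral>\<^sup>+x. ennreal cc * ((if 0 < t \<and> t < 2 * g x then \<psi> t else 0) * (ennreal (g x) * v x)) \<partial>M) \<partial>lborel)"
  proof (rule nn_integral_mono)
    fix t :: real
    show "(\<Sum>i\<in>J. ennreal (m i) * (\<phi> t * indicator {0<..<c i} t))
      \<le> (\<integral>\<^sup>+x. ennreal cc * ((if 0 < t \<and> t < 2 * g x then \<psi> t else 0) * (ennreal (g x) * v x)) \<partial>M)"
    proof (cases "0 < t")
      case True
      have "(\<Sum>i\<in>J. ennreal (m i) * (\<phi> t * indicator {0<..<c i} t)) = (\<Sum>i\<in>J. if t < c i then \<phi> t * ennreal (m i) else 0)"
        using True by (intro sum.cong) (auto simp: mult.commute)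
      also have "\<dots> = (\<Sum>i\<in>{i\<in>J. t < c i}. \<phi> t * ennreal (m i))"
        using J by (simp add: sum.inter_filter)
      also have "\<dots> = \<phi> t * ennreal (\<Sum>i\<in>{i\<in>J. t < c i}. m i)"
        using m by (subst sum_ennreal[symmetric]) (auto simp: sum_distrib_left)
      also have "\<dots> \<le> \<phi> t * (ennreal (k / t) * (\<integral>\<^sup>+x. (if t / 2 < g x then ennreal (g x) * v x else 0) \<partial>M))"
        by (intro mult_left_mono weak True) auto
      also have "\<dots> = (\<phi> t * ennreal (k / t)) * (\<integral>\<^sup>+x. (if t / 2 < g x then ennreal (g x) * v x else 0) \<partial>M)"
        by (simp only: mult.assoc)
      also have "\<phi> t * ennreal (k / t) = ennreal cc * \<psi> t"
      proof -
        have "t powr (q - 1 - 1) = t powr (q - 1) / t" using True powr_diff[of t "q - 1" 1] by simp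
        hence "q * t powr (q - 1) * (k / t) = cc * ((q - 1) * t powr (q - 1 - 1))"
          unfolding cc_def using q by simp
        thus ?thesis unfolding \<phi>_def \<psi>_def using q k True cc
          by (simp only: ennreal_mult[symmetric] mult_nonneg_nonneg powr_ge_zero divide_nonneg_nonneg less_imp_le diff_ge_0_iff_ge)
      qed
      also have "ennreal cc * \<psi> t * (\<integral>\<^sup>+x. (if t / 2 < g x then ennreal (g x) * v x else 0) \<partial>M)
        = (\<integral>\<^sup>+x. ennreal cc * \<psi> t * (if t / 2 < g x then ennreal (g x) * v x else 0) \<partial>M)"
        by (intro nn_integral_cmult[symmetric]) measurable
      also have "\<dots> = (\<integral>\<^sup>+x. ennreal cc * ((if 0 < t \<and> t < 2 * g x then \<psi> t else 0) * (ennreal (g x) * v x)) \<partial>M)"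
        using True by (intro nn_integral_cong) (auto simp: mult.assoc)
      finally show ?thesis .
    qed simp
  qed
  also have "\<dots> = (\<integral>\<^sup>+x. (\<integral>\<^sup>+t. ennreal cc * ((if 0 < t \<and> t < 2 * g x then \<psi> t else 0) * (ennreal (g x) * v x)) \<partial>lborel) \<partial>M)"
    by (rule Fubini'[symmetric]) measurable
  also have "\<dots> = (\<integral>\<^sup>+x. ennreal (cc * 2 powr (q - 1)) * (ennreal (g x powr q) * v x) \<partial>M)"
  proof (rule nn_integral_cong)
    fix x
    have "(\<integral>\<^sup>+t. ennreal cc * ((if 0 < t \<and> t < 2 * g x then \<psi> t else 0) * (ennreal (g x) * v x)) \<partial>lborel)
      = (\<integral>\<^sup>+t. (ennreal cc * (ennreal (g x) * v x)) * (\<psi> t * indicator {0<..<2 * g x} t) \<partial>lborel)"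
      by (intro nn_integral_cong) (auto simp: ac_simps split: split_indicator)
    also have "\<dots> = (ennreal cc * (ennreal (g x) * v x)) * (\<integral>\<^sup>+t. \<psi> t * indicator {0<..<2 * g x} t \<partial>lborel)"
      by (intro nn_integral_cmult) measurable
    also have "(\<integral>\<^sup>+t. \<psi> t * indicator {0<..<2 * g x} t \<partial>lborel) = ennreal ((2 * g x) powr (q - 1))"
      unfolding \<psi>_def using q g0 by (intro nn_integral_powr_layer) auto
    also have "(ennreal cc * (ennreal (g x) * v x)) * \<dots> = ennreal (cc * (g x * (2 * g x) powr (q - 1))) * v x"
      using cc g0[of x] by (simp add: ennreal_mult ac_simps)
    also have "g x * (2 * g x) powr (q - 1) = 2 powr (q - 1) * g x powr q"
      using g0[of x] by (cases "g x = 0") (auto simp: powr_mult powr_diff)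
    also have "ennreal (cc * (2 powr (q - 1) * g x powr q)) * v x = ennreal (cc * 2 powr (q - 1)) * (ennreal (g x powr q) * v x)"
      using cc by (simp add: ennreal_mult mult.assoc)
    finally show "(\<integral>\<^sup>+t. ennreal cc * ((if 0 < t \<and> t < 2 * g x then \<psi> t else 0) * (ennreal (g x) * v x)) \<partial>lborel)
      = ennreal (cc * 2 powr (q - 1)) * (ennreal (g x powr q) * v x)" .
  qed
  also have "\<dots> = ennreal (cc * 2 powr (q - 1)) * (\<integral>\<^sup>+x. ennreal (g x powr q) * v x \<partial>M)"
    by (intro nn_integral_cmult) measurable
  also have "cc * 2 powr (q - 1) = k * 2 powr (q - 1) * (q / (q - 1))" unfolding cc_def by simp
  finally show ?thesis .
qed

section \<open>Weights on cubes and Carleson sums\<close>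

context adjacent begin

lemma integral_cube_pos:
  assumes w [measurable]: "w \<in> borel_measurable M" and pos: "AE x in M. 0 < w x" and Q: "Q \<in> cubes \<DD>"
  shows "0 < (\<integral>\<^sup>+x\<in>Q. ennreal (w x) \<partial>M)"
proof (rule ccontr)
  note cubes_sets[OF Q, measurable]
  assume "\<not> ?thesis"
  hence "(\<integral>\<^sup>+x\<in>Q. ennreal (w x) \<partial>M) = 0" by simp
  hence "AE x in M. ennreal (w x) * indicator Q x = 0" by (subst (asm) nn_integral_0_iff_AE) auto
  with pos have "AE x in M. x \<notin> Q"
    by eventually_elim (auto simp: indicator_def split: if_splits)
  hence "emeasure M Q = 0" using cubes_sets[OF Q] by (subst (asm) AE_iff_null_sets[symmetric]) auto
  thus False using cubes_pos[OF Q] by simp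
qed

text \<open>The part of R where g <= t/2 contributes at most t z / 2, a finite quantity that can be
  cancelled.\<close>

lemma truncation_le:
  fixes g :: "'a \<Rightarrow> real" and v :: "'a \<Rightarrow> ennreal"
  assumes [measurable]: "g \<in> borel_measurable M" "v \<in> borel_measurable M" "R \<in> sets M" and t: "0 < t"
    and fin: "(\<integral>\<^sup>+x\<in>R. v x \<partial>M) = ennreal z" "0 \<le> z"
    and gt: "ennreal t * ennreal z \<le> (\<integral>\<^sup>+x\<in>R. ennreal (g x) * v x \<partial>M)"
  shows "ennreal (t / 2) * ennreal z \<le> (\<integral>\<^sup>+x\<in>R. (if t / 2 < g x then ennreal (g x) * v x else 0) \<partial>M)"
proof -
  have "ennreal (t / 2) * ennreal z + ennreal (t / 2) * ennreal z = ennreal t * ennreal z"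
    using t fin(2) by (simp add: ennreal_mult[symmetric] ennreal_plus[symmetric] del: ennreal_plus)
  also note gt
  also have "(\<integral>\<^sup>+x\<in>R. ennreal (g x) * v x \<partial>M)
    \<le> (\<integral>\<^sup>+x. (if t / 2 < g x then ennreal (g x) * v x else 0) * indicator R x + ennreal (t / 2) * (v x * indicator R x) \<partial>M)"
  proof (rule nn_integral_mono)
    fix x
    show "ennreal (g x) * v x * indicator R x
      \<le> (if t / 2 < g x then ennreal (g x) * v x else 0) * indicator R x + ennreal (t / 2) * (v x * indicator R x)"
      by (auto simp: not_less mult.assoc intro!: mult_right_mono ennreal_leI)
  qed
  also have "\<dots> = (\<integral>\<^sup>+x\<in>R. (if t / 2 < g x then ennreal (g x) * v x else 0) \<partial>M) + ennreal (t / 2) * ennreal z"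
    unfolding fin(1)[symmetric] by (subst nn_integral_add) (auto simp: nn_integral_cmult)
  finally have "ennreal (t / 2) * ennreal z + ennreal (t / 2) * ennreal z
    \<le> ennreal (t / 2) * ennreal z + (\<integral>\<^sup>+x\<in>R. (if t / 2 < g x then ennreal (g x) * v x else 0) \<partial>M)"
    by (simp only: add.commute)
  thus ?thesis unfolding ennreal_add_left_cancel_le by (auto simp: ennreal_mult_eq_top_iff)
qed

end

text \<open>J is finite so that every sum over it is finite; no bound below depends on the number of
  its cubes. \<Lambda> is any bound for the A_infinity constant, and the sets \<open>E Q\<close>
  witness sparseness.\<close>

locale sparse_weight = adjacent +
  fixes J :: "'a set set" and E :: "'a set \<Rightarrow> 'a set" and w :: "'a \<Rightarrow> real" and \<Lambda> :: real
  assumes J: "finite J" "nested J" "J \<subseteq> cubes \<DD>"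
    and E_sets: "Q \<in> J \<Longrightarrow> E Q \<in> sets M" and E_sub: "Q \<in> J \<Longrightarrow> E Q \<subseteq> Q" and E_disj: "disjoint_family_on E J"
    and E_large: "Q \<in> J \<Longrightarrow> emeasure M Q \<le> 2 * emeasure M (E Q)"
    and w [measurable]: "w \<in> borel_measurable M" and w_pos: "AE x in M. 0 < w x"
    and w_fin: "Q \<in> cubes \<DD> \<Longrightarrow> (\<integral>\<^sup>+x\<in>Q. ennreal (w x) \<partial>M) < \<infinity>"
    and Lambda_pos: "0 < \<Lambda>"
    and Ainf: "Q \<in> cubes \<DD> \<Longrightarrow>
      (\<integral>\<^sup>+x\<in>Q. Mx (\<lambda>y. ennreal (w y) * indicator Q y) x \<partial>M) \<le> ennreal \<Lambda> * (\<integral>\<^sup>+x\<in>Q. ennreal (w x) \<partial>M)"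
begin

definition wt :: "'a set \<Rightarrow> real" where "wt Q = enn2real (\<integral>\<^sup>+x\<in>Q. ennreal (w x) \<partial>M)"

lemma wt_eq: "Q \<in> cubes \<DD> \<Longrightarrow> (\<integral>\<^sup>+x\<in>Q. ennreal (w x) \<partial>M) = ennreal (wt Q)"
  unfolding wt_def using w_fin[of Q] by (simp add: less_top)

lemma wt_pos: "Q \<in> cubes \<DD> \<Longrightarrow> 0 < wt Q"
  using integral_cube_pos[OF w w_pos, of Q] w_fin[of Q] unfolding wt_def by (simp add: enn2real_positive_iff)

lemma J_cubes: "Q \<in> J \<Longrightarrow> Q \<in> cubes \<DD>"
  using J(3) by blast

lemma J_sets: "Q \<in> J \<Longrightarrow> Q \<in> sets M"
  using J_cubes cubes_sets by blast

text \<open>On all of Q the maximal function is at least the average of w over Q, and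
  \<open>E Q\<close> carries at least half of the measure of Q. Since the sets \<open>E Q\<close>
  are disjoint, these bounds can be summed.\<close>

lemma wt_le_integral_Mx:
  assumes Q: "Q \<in> J" and R: "Q \<subseteq> R"
  shows "ennreal (wt Q) \<le> 2 * (\<integral>\<^sup>+x\<in>E Q. Mx (\<lambda>y. ennreal (w y) * indicator R y) x \<partial>M)"
proof -
  have Qc: "Q \<in> cubes \<DD>" by (rule J_cubes[OF Q])
  define z where "z = ennreal (wt Q) / emeasure M Q"
  have z: "z \<le> Mx (\<lambda>y. ennreal (w y) * indicator R y) x" if "x \<in> Q" for x
  proof -
    have "ennreal (wt Q) = (\<integral>\<^sup>+y\<in>Q. (ennreal (w y) * indicator R y) \<partial>M)"
      unfolding wt_eq[OF Qc, symmetric] using R by (intro nn_integral_cong) (auto split: split_indicator)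
    thus ?thesis unfolding z_def using Mx_ge[OF Qc that, of "\<lambda>y. ennreal (w y) * indicator R y"] by simp
  qed
  have "ennreal (wt Q) = z * emeasure M Q"
    unfolding z_def using cubes_pos[OF Qc] cubes_finite[OF Qc] by (intro ennreal_divide_mult_cancel[symmetric]) auto
  also have "\<dots> \<le> z * (2 * emeasure M (E Q))" by (intro mult_left_mono E_large Q) auto
  also have "\<dots> = 2 * (\<integral>\<^sup>+x. z * indicator (E Q) x \<partial>M)"
    using E_sets[OF Q] by (simp add: nn_integral_cmult_indicator ac_simps)
  also have "\<dots> \<le> 2 * (\<integral>\<^sup>+x\<in>E Q. Mx (\<lambda>y. ennreal (w y) * indicator R y) x \<partial>M)"
    using z E_sub[OF Q] by (intro mult_left_mono nn_integral_mono) (auto split: split_indicator)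
  finally show ?thesis .
qed

lemma sum_integral_E_le:
  assumes "I \<subseteq> J" "\<And>Q. Q \<in> I \<Longrightarrow> Q \<subseteq> R" and h [measurable]: "h \<in> borel_measurable M"
  shows "(\<Sum>Q\<in>I. \<integral>\<^sup>+x\<in>E Q. h x \<partial>M) \<le> (\<integral>\<^sup>+x\<in>R. h x \<partial>M)"
proof -
  have fin: "finite I" using assms(1) J(1) finite_subset by blast
  have EI: "E Q \<in> sets M" if "Q \<in> I" for Q using that assms(1) E_sets by blast
  have "(\<Sum>Q\<in>I. \<integral>\<^sup>+x\<in>E Q. h x \<partial>M) = (\<Sum>Q\<in>I. emeasure (density M h) (E Q))"
    using EI by (intro sum.cong) (auto simp: emeasure_density)
  also have "\<dots> = emeasure (density M h) (\<Union>Q\<in>I. E Q)"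
    using EI fin disjoint_family_on_mono[OF assms(1) E_disj] by (intro sum_emeasure) auto
  also have "\<dots> = (\<integral>\<^sup>+x\<in>(\<Union>Q\<in>I. E Q). h x \<partial>M)"
    using EI fin by (intro emeasure_density h sets.finite_UN) auto
  also have "\<dots> \<le> (\<integral>\<^sup>+x\<in>R. h x \<partial>M)"
  proof (rule nn_integral_mono)
    have "(\<Union>Q\<in>I. E Q) \<subseteq> R" using E_sub assms(1,2) by blast
    thus "h x * indicator (\<Union>Q\<in>I. E Q) x \<le> h x * indicator R x" for x
      by (auto split: split_indicator)
  qed
  finally show ?thesis .
qed

lemma Carleson_weight:
  assumes R: "R \<in> cubes \<DD>" and "I \<subseteq> J" "\<And>Q. Q \<in> I \<Longrightarrow> Q \<subseteq> R"
  shows "(\<Sum>Q\<in>I. wt Q) \<le> 2 * \<Lambda> * wt R"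
proof -
  have Ic: "Q \<in> cubes \<DD>" if "Q \<in> I" for Q using that assms(2) J_cubes by blast
  have "ennreal (\<Sum>Q\<in>I. wt Q) = (\<Sum>Q\<in>I. ennreal (wt Q))"
    using wt_pos[OF Ic] by (intro sum_ennreal[symmetric]) (auto intro: less_imp_le)
  also have "\<dots> \<le> (\<Sum>Q\<in>I. 2 * (\<integral>\<^sup>+x\<in>E Q. Mx (\<lambda>y. ennreal (w y) * indicator R y) x \<partial>M))"
    using assms(2,3) by (intro sum_mono wt_le_integral_Mx) auto
  also have "\<dots> = 2 * (\<Sum>Q\<in>I. (\<integral>\<^sup>+x\<in>E Q. Mx (\<lambda>y. ennreal (w y) * indicator R y) x \<partial>M))"
    by (rule sum_distrib_left[symmetric])
  also have "\<dots> \<le> 2 * (\<integral>\<^sup>+x\<in>R. Mx (\<lambda>y. ennreal (w y) * indicator R y) x \<partial>M)"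
    using assms(2,3) by (intro mult_left_mono sum_integral_E_le Mx_measurable) auto
  also have "\<dots> \<le> 2 * (ennreal \<Lambda> * ennreal (wt R))"
    using Ainf[OF R] unfolding wt_eq[OF R] by (intro mult_left_mono) auto
  also have "\<dots> = ennreal (2 * \<Lambda> * wt R)"
    using Lambda_pos wt_pos[OF R] by (simp add: ennreal_mult mult.assoc)
  finally show ?thesis using Lambda_pos wt_pos[OF R] by (simp add: ennreal_le_iff)
qed

text \<open>Here c is the average of G with respect to w. The cubes with c > t lie below disjoint
  maximal ones; \<open>Carleson_weight\<close> sums the cubes under each maximal cube, and on the
  maximal cubes themselves the weak type bound is immediate.\<close>

lemma Carleson_embedding:
  fixes G :: "'a \<Rightarrow> real"
  assumes G [measurable]: "G \<in> borel_measurable M" and G0: "\<And>x. 0 \<le> G x" and c: "\<And>Q. Q \<in> J \<Longrightarrow> 0 \<le> c Q"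
    and cG: "\<And>Q. Q \<in> J \<Longrightarrow> (\<integral>\<^sup>+x\<in>Q. ennreal (G x) * ennreal (w x) \<partial>M) = ennreal (c Q * wt Q)" and q: "1 < q"
  shows "ennreal (\<Sum>Q\<in>J. wt Q * c Q powr q)
    \<le> ennreal (4 * \<Lambda> * 2 powr (q - 1) * (q / (q - 1))) * (\<integral>\<^sup>+x. ennreal (G x powr q) * ennreal (w x) \<partial>M)"
proof (rule layer_cake_sum_le[OF sigma_finite J(1) c _ G G0 _ q])
  show "0 \<le> wt Q" if "Q \<in> J" for Q using wt_pos[OF J_cubes[OF that]] by simp
  fix t :: real assume t: "0 < t"
  define g' where "g' x = (if t / 2 < G x then ennreal (G x) * ennreal (w x) else 0)" for x
  have g' [measurable]: "g' \<in> borel_measurable M" unfolding g'_def by measurable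
  define Jt where "Jt = {Q \<in> J. t < c Q}"
  have JtJ: "Jt \<subseteq> J" and fJt: "finite Jt" using J(1) by (auto simp: Jt_def)
  obtain \<M> where \<M>: "\<M> \<subseteq> Jt" "disjoint \<M>" "\<And>Q. Q \<in> Jt \<Longrightarrow> \<exists>R\<in>\<M>. Q \<subseteq> R"
    using nested_finite_maximal[OF fJt nested_subset[OF J(2) JtJ]] by blast
  have fM: "finite \<M>" using \<M>(1) fJt finite_subset by blast
  \<comment> \<open>Fixing one maximal cube above each cube splits the sum into Carleson sums
    without repetition.\<close>
  from \<M>(3) obtain top where top: "\<And>Q. Q \<in> Jt \<Longrightarrow> top Q \<in> \<M>" "\<And>Q. Q \<in> Jt \<Longrightarrow> Q \<subseteq> top Q" by metis
  have Mc: "R \<in> cubes \<DD>" "R \<in> J" "t < c R" if "R \<in> \<M>" for R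
    using that \<M>(1) JtJ J_cubes by (auto simp: Jt_def)
  have "(\<Sum>Q\<in>Jt. wt Q) = (\<Sum>R\<in>\<M>. \<Sum>Q\<in>{Q \<in> Jt. top Q = R}. wt Q)"
    using top(1) by (intro sum.group[symmetric] fJt fM) auto
  also have "\<dots> \<le> (\<Sum>R\<in>\<M>. 2 * \<Lambda> * wt R)"
    using JtJ top(2) by (intro sum_mono Carleson_weight Mc) auto
  finally have "ennreal (\<Sum>Q\<in>Jt. wt Q) \<le> ennreal (\<Sum>R\<in>\<M>. 2 * \<Lambda> * wt R)" by (rule ennreal_leI)
  \<comment> \<open>Here 2 \<Lambda> = (4 \<Lambda> / t) (t / 2): the truncation of G at t/2 leaves
    only half of the level t.\<close>
  also have "\<dots> = (\<Sum>R\<in>\<M>. ennreal (4 * \<Lambda> / t) * (ennreal (t / 2) * ennreal (wt R)))"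
  proof (subst sum_ennreal[symmetric])
    show "0 \<le> 2 * \<Lambda> * wt R" if "R \<in> \<M>" for R using Lambda_pos wt_pos[OF Mc(1)[OF that]] by simp
    show "(\<Sum>R\<in>\<M>. ennreal (2 * \<Lambda> * wt R)) = (\<Sum>R\<in>\<M>. ennreal (4 * \<Lambda> / t) * (ennreal (t / 2) * ennreal (wt R)))"
    proof (rule sum.cong[OF refl])
      fix R assume "R \<in> \<M>"
      hence "0 < wt R" using wt_pos Mc by blast
      thus "ennreal (2 * \<Lambda> * wt R) = ennreal (4 * \<Lambda> / t) * (ennreal (t / 2) * ennreal (wt R))"
        using t Lambda_pos by (simp add: ennreal_mult[symmetric])
    qed
  qed
  also have "\<dots> \<le> (\<Sum>R\<in>\<M>. ennreal (4 * \<Lambda> / t) * (\<integral>\<^sup>+x\<in>R. g' x \<partial>M))"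
  proof (intro sum_mono mult_left_mono)
    fix R assume R: "R \<in> \<M>"
    show "ennreal (t / 2) * ennreal (wt R) \<le> (\<integral>\<^sup>+x\<in>R. g' x \<partial>M)"
      unfolding g'_def
    proof (rule truncation_le)
      show "R \<in> sets M" using Mc(1)[OF R] by (rule cubes_sets)
      show "(\<integral>\<^sup>+x\<in>R. ennreal (w x) \<partial>M) = ennreal (wt R)" by (rule wt_eq[OF Mc(1)[OF R]])
      show "0 \<le> wt R" using wt_pos[OF Mc(1)[OF R]] by simp
      have "ennreal t * ennreal (wt R) = ennreal (t * wt R)" using t wt_pos[OF Mc(1)[OF R]] by (simp add: ennreal_mult)
      also have "\<dots> \<le> ennreal (c R * wt R)" using Mc(3)[OF R] wt_pos[OF Mc(1)[OF R]] by (intro ennreal_leI mult_right_mono) auto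
      also have "\<dots> = (\<integral>\<^sup>+x\<in>R. ennreal (G x) * ennreal (w x) \<partial>M)" by (rule cG[OF Mc(2)[OF R], symmetric])
      finally show "ennreal t * ennreal (wt R) \<le> (\<integral>\<^sup>+x\<in>R. ennreal (G x) * ennreal (w x) \<partial>M)" .
    qed (use t in auto)
  qed auto
  also have "\<dots> = ennreal (4 * \<Lambda> / t) * (\<Sum>R\<in>\<M>. \<integral>\<^sup>+x\<in>R. g' x \<partial>M)" by (rule sum_distrib_left[symmetric])
  also have "(\<Sum>R\<in>\<M>. \<integral>\<^sup>+x\<in>R. g' x \<partial>M) = (\<integral>\<^sup>+x\<in>\<Union>\<M>. g' x \<partial>M)"
    using Mc(1) cubes_sets by (intro sum_set_nn_integral fM \<M>(2) g') auto
  also have "\<dots> \<le> (\<integral>\<^sup>+x. g' x \<partial>M)" by (intro nn_integral_mono) (auto split: split_indicator)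
  finally show "ennreal (\<Sum>Q\<in>{Q \<in> J. t < c Q}. wt Q)
    \<le> ennreal (4 * \<Lambda> / t) * (\<integral>\<^sup>+x. (if t / 2 < G x then ennreal (G x) * ennreal (w x) else 0) \<partial>M)"
    unfolding Jt_def g'_def by (simp add: mult_left_mono)
qed (use Lambda_pos in auto)

text \<open>The weight is absorbed through \<open>\<langle>w\<rangle> \<le> Mw\<close> on the cube, so that only the unweighted
  maximal inequality is needed.\<close>

lemma sparse_averages_le:
  fixes f :: "'a \<Rightarrow> real" and p H W :: real
  assumes f [measurable]: "f \<in> borel_measurable M" and a: "\<And>Q. Q \<in> J \<Longrightarrow> 0 \<le> a Q"
    and hh: "\<And>Q. Q \<in> J \<Longrightarrow> hh Q \<in> cubes \<DD>" "\<And>Q. Q \<in> J \<Longrightarrow> Q \<subseteq> hh Q"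
      "\<And>Q. Q \<in> J \<Longrightarrow> emeasure M (hh Q) \<le> ennreal H * emeasure M Q"
    and af: "\<And>Q. Q \<in> J \<Longrightarrow> (\<integral>\<^sup>+x\<in>hh Q. ennreal \<bar>f x\<bar> \<partial>M) = ennreal (a Q) * emeasure M (hh Q)"
    and p: "1 < p" and H: "0 \<le> H" and W: "0 \<le> W"
    and fW: "(\<integral>\<^sup>+x. ennreal (\<bar>f x\<bar> powr p) * Mx (\<lambda>y. ennreal (w y)) x \<partial>M) = ennreal W"
  shows "(\<Sum>Q\<in>J. wt Q * a Q powr p) \<le> H * (4 * real N * 2 powr (p - 1) * (p / (p - 1))) * W"
proof -
  define Mw where "Mw = Mx (\<lambda>y. ennreal (w y))"
  have Mw [measurable]: "Mw \<in> borel_measurable M" unfolding Mw_def by (rule Mx_measurable)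
  \<comment> \<open>Where \<open>Mw\<close> is infinite, \<open>enn2real\<close> returns 0. This is
    harmless, because the finite integral \<open>fW\<close> forces f = 0 there almost
    everywhere.\<close>
  define v where "v x = enn2real (Mw x)" for x
  have v [measurable]: "v \<in> borel_measurable M" unfolding v_def by measurable
  define h where "h x = \<bar>f x\<bar> * v x powr (1 / p)" for x
  have h [measurable]: "h \<in> borel_measurable M" unfolding h_def by measurable
  have h0: "0 \<le> h x" for x unfolding h_def by simp
  have "(\<integral>\<^sup>+x. ennreal (\<bar>f x\<bar> powr p) * Mw x \<partial>M) \<noteq> \<infinity>" using fW unfolding Mw_def by simp
  hence "AE x in M. ennreal (\<bar>f x\<bar> powr p) * Mw x \<noteq> \<infinity>" by (intro nn_integral_noteq_infinite) measurable
  hence inf: "AE x in M. Mw x = \<infinity> \<longrightarrow> f x = 0"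
    by eventually_elim (auto simp: ennreal_mult_eq_top_iff)
  have hp: "(\<integral>\<^sup>+x. ennreal (h x powr p) * 1 \<partial>M) = ennreal W"
    unfolding fW[symmetric] Mw_def[symmetric]
  proof (rule nn_integral_cong_AE, use inf in eventually_elim)
    case (elim x)
    show ?case
    proof (cases "Mw x = \<infinity>")
      case True
      thus ?thesis using elim p by (simp add: h_def)
    next
      case False
      hence "Mw x = ennreal (v x)" unfolding v_def by (simp add: less_top)
      thus ?thesis using p by (simp add: h_def powr_mult powr_powr v_def ennreal_mult)
    qed
  qed
  define \<omega> where "\<omega> Q = wt (hh Q) / measure M (hh Q)" for Q
  have om: "0 < \<omega> Q" if "Q \<in> J" for Q
    unfolding \<omega>_def using wt_pos[OF hh(1)[OF that]] measure_cubes_pos[OF hh(1)[OF that]] by simp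
  have om_le: "ennreal (\<omega> Q) \<le> Mw x" if "Q \<in> J" "x \<in> hh Q" for Q x
  proof -
    have c: "hh Q \<in> cubes \<DD>" by (rule hh(1)[OF that(1)])
    have "ennreal (\<omega> Q) = ennreal (wt (hh Q)) / emeasure M (hh Q)"
      unfolding \<omega>_def emeasure_cubes[OF c] using wt_pos[OF c] measure_cubes_pos[OF c] by (intro divide_ennreal[symmetric]) auto
    also have "\<dots> \<le> Mw x" unfolding wt_eq[OF c, symmetric] Mw_def by (rule Mx_ge[OF c that(2)])
    finally show ?thesis .
  qed
  \<comment> \<open>The p-th power of c times the measure of \<open>hh Q\<close> is
    \<open>a Q powr p * wt (hh Q)\<close>; still c is at most the unweighted average of h over
    \<open>hh Q\<close>, since \<omega> is at most \<open>Mw\<close> there.\<close>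
  define c where "c Q = a Q * \<omega> Q powr (1 / p)" for Q
  have c0: "0 \<le> c Q" if "Q \<in> J" for Q unfolding c_def using a[OF that] by simp
  have ch: "ennreal (c Q) * emeasure M (hh Q) \<le> (\<integral>\<^sup>+x\<in>hh Q. ennreal (h x) * 1 \<partial>M)" if Q: "Q \<in> J" for Q
  proof -
    note cubes_sets[OF hh(1)[OF Q], measurable]
    have "ennreal (c Q) * emeasure M (hh Q) = ennreal (\<omega> Q powr (1/p)) * (\<integral>\<^sup>+x\<in>hh Q. ennreal \<bar>f x\<bar> \<partial>M)"
      unfolding af[OF Q] c_def using a[OF Q] by (simp add: ennreal_mult ac_simps)
    also have "\<dots> = (\<integral>\<^sup>+x. ennreal (\<omega> Q powr (1/p)) * (ennreal \<bar>f x\<bar> * indicator (hh Q) x) \<partial>M)"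
      by (intro nn_integral_cmult[symmetric]) measurable
    also have "\<dots> \<le> (\<integral>\<^sup>+x\<in>hh Q. ennreal (h x) * 1 \<partial>M)"
    proof (rule nn_integral_mono_AE, use inf in eventually_elim)
      case (elim x)
      show ?case
      proof (cases "x \<in> hh Q \<and> Mw x \<noteq> \<infinity>")
        case True
        hence "Mw x = ennreal (v x)" unfolding v_def by (simp add: less_top)
        hence "ennreal (\<omega> Q) \<le> ennreal (v x)" using om_le[OF Q, of x] True by metis
        hence "\<omega> Q \<le> v x" by (subst (asm) ennreal_le_iff) (simp_all add: v_def)
        hence "\<omega> Q powr (1/p) \<le> v x powr (1/p)" using om[OF Q] p by (intro powr_mono2) auto
        hence "\<omega> Q powr (1/p) * \<bar>f x\<bar> \<le> h x" unfolding h_def by (simp add: mult.commute mult_left_mono)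
        thus ?thesis using True by (simp add: ennreal_mult[symmetric] ennreal_leI)
      qed (use elim in auto)
    qed
    finally show ?thesis .
  qed
  have "ennreal (\<Sum>Q\<in>J. measure M Q * c Q powr p)
    \<le> ennreal (4 * real N * 2 powr (p - 1) * (p / (p - 1))) * (\<integral>\<^sup>+x. ennreal (h x powr p) * 1 \<partial>M)"
  proof (rule layer_cake_sum_le[OF sigma_finite J(1) c0 _ h h0 _ p])
    fix t :: real assume t: "0 < t"
    define g' where "g' x = (if t / 2 < h x then ennreal (h x) * 1 else 0)" for x
    have g' [measurable]: "g' \<in> borel_measurable M" unfolding g'_def by measurable
    define Jt where "Jt = {Q \<in> J. t < c Q}"
    have JtJ: "Jt \<subseteq> J" and fJt: "finite Jt" using J(1) by (auto simp: Jt_def)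
    have Jc: "Q \<in> cubes \<DD>" if "Q \<in> Jt" for Q using that JtJ J_cubes by blast
    \<comment> \<open>Sparseness bounds the sum by twice the measure of the union of the cubes
      \<open>hh Q\<close>. These belong to several systems, so \<open>cubes_weak_type\<close> with
      its factor N is used for them.\<close>
    have "ennreal (\<Sum>Q\<in>Jt. measure M Q) = (\<Sum>Q\<in>Jt. ennreal (measure M Q))"
      by (rule sum_ennreal[symmetric]) simp
    also have "\<dots> = (\<Sum>Q\<in>Jt. emeasure M Q)"
      by (intro sum.cong refl emeasure_cubes[symmetric] Jc)
    also have "\<dots> \<le> (\<Sum>Q\<in>Jt. 2 * (\<integral>\<^sup>+x\<in>E Q. 1 \<partial>M))"
      using E_large E_sets JtJ by (intro sum_mono) (auto simp: nn_integral_indicator)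
    also have "\<dots> = 2 * (\<Sum>Q\<in>Jt. (\<integral>\<^sup>+x\<in>E Q. 1 \<partial>M))" by (rule sum_distrib_left[symmetric])
    also have "\<dots> \<le> 2 * (\<integral>\<^sup>+x\<in>\<Union>(hh ` Jt). 1 \<partial>M)"
      using JtJ hh(2) by (intro mult_left_mono sum_integral_E_le) auto
    also have "(\<integral>\<^sup>+x\<in>\<Union>(hh ` Jt). 1 \<partial>M) = emeasure M (\<Union>(hh ` Jt))"
    proof -
      have "hh Q \<in> sets M" if "Q \<in> Jt" for Q using hh(1) that JtJ cubes_sets by blast
      hence "\<Union>(hh ` Jt) \<in> sets M" using fJt by auto
      thus ?thesis by simp
    qed
    also have "2 * emeasure M (\<Union>(hh ` Jt)) = ennreal (4 / t) * (ennreal (t / 2) * emeasure M (\<Union>(hh ` Jt)))"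
      using t by (simp add: mult.assoc[symmetric] ennreal_mult[symmetric])
    also have "\<dots> \<le> ennreal (4 / t) * (of_nat N * (\<integral>\<^sup>+x. g' x \<partial>M))"
    proof (intro mult_left_mono cubes_weak_type g')
      show "hh ` Jt \<subseteq> cubes \<DD>" using hh(1) JtJ by blast
      fix S assume "S \<in> hh ` Jt"
      then obtain Q where Q: "Q \<in> J" "t < c Q" "S = hh Q" by (auto simp: Jt_def)
      have Sc: "S \<in> cubes \<DD>" using Q hh(1) by blast
      show "ennreal (t / 2) * emeasure M S \<le> (\<integral>\<^sup>+x\<in>S. g' x \<partial>M)"
        unfolding g'_def emeasure_cubes[OF Sc]
      proof (rule truncation_le)
        show "S \<in> sets M" by (rule cubes_sets[OF Sc])
        show "(\<integral>\<^sup>+x\<in>S. 1 \<partial>M) = ennreal (measure M S)" using emeasure_cubes[OF Sc] cubes_sets[OF Sc] by simp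
        have "ennreal t * ennreal (measure M S) \<le> ennreal (c Q) * ennreal (measure M S)"
          using Q by (intro mult_right_mono ennreal_leI) auto
        also have "\<dots> \<le> (\<integral>\<^sup>+x\<in>S. ennreal (h x) * 1 \<partial>M)"
          using ch[OF Q(1)] unfolding Q(3)[symmetric] emeasure_cubes[OF Sc] .
        finally show "ennreal t * ennreal (measure M S) \<le> (\<integral>\<^sup>+x\<in>S. ennreal (h x) * 1 \<partial>M)" .
      qed (use t in auto)
    qed auto
    also have "\<dots> = ennreal (4 * real N / t) * (\<integral>\<^sup>+x. g' x \<partial>M)"
      using t by (simp add: mult.assoc[symmetric] ennreal_of_nat_eq_real_of_nat ennreal_mult[symmetric])
    finally show "ennreal (\<Sum>Q\<in>{Q \<in> J. t < c Q}. measure M Q)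
      \<le> ennreal (4 * real N / t) * (\<integral>\<^sup>+x. (if t / 2 < h x then ennreal (h x) * 1 else 0) \<partial>M)"
      unfolding Jt_def g'_def by (simp add: mult_left_mono)
  qed auto
  hence "ennreal (\<Sum>Q\<in>J. measure M Q * c Q powr p) \<le> ennreal (4 * real N * 2 powr (p - 1) * (p / (p - 1)) * W)"
    unfolding hp using p W by (subst ennreal_mult) auto
  hence main: "(\<Sum>Q\<in>J. measure M Q * c Q powr p) \<le> 4 * real N * 2 powr (p - 1) * (p / (p - 1)) * W"
    using p W by (subst (asm) ennreal_le_iff) auto
  have "(\<Sum>Q\<in>J. wt Q * a Q powr p) \<le> (\<Sum>Q\<in>J. H * (measure M Q * c Q powr p))"
  proof (rule sum_mono)
    fix Q assume Q: "Q \<in> J"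
    have c1: "hh Q \<in> cubes \<DD>" "Q \<in> cubes \<DD>" using hh(1)[OF Q] J_cubes[OF Q] by auto
    have "ennreal (wt Q) \<le> ennreal (wt (hh Q))"
      unfolding wt_eq[OF c1(1), symmetric] wt_eq[OF c1(2), symmetric] using hh(2)[OF Q]
      by (intro nn_integral_mono) (auto split: split_indicator)
    hence "wt Q \<le> wt (hh Q)" using wt_pos[OF c1(1)] by (simp add: ennreal_le_iff)
    also have "\<dots> = \<omega> Q * measure M (hh Q)" unfolding \<omega>_def using measure_cubes_pos[OF c1(1)] by simp
    also have "\<dots> \<le> \<omega> Q * (H * measure M Q)"
    proof (rule mult_left_mono)
      have "ennreal (measure M (hh Q)) \<le> ennreal (H * measure M Q)"
        using hh(3)[OF Q] unfolding emeasure_cubes[OF c1(1)] emeasure_cubes[OF c1(2)] using H by (simp add: ennreal_mult)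
      thus "measure M (hh Q) \<le> H * measure M Q" using H by (simp add: ennreal_le_iff)
    qed (use om[OF Q] in simp)
    finally have "wt Q * a Q powr p \<le> \<omega> Q * (H * measure M Q) * a Q powr p" by (intro mult_right_mono) auto
    also have "\<dots> = H * (measure M Q * c Q powr p)"
      unfolding c_def using a[OF Q] om[OF Q] p by (simp add: powr_mult powr_powr)
    finally show "wt Q * a Q powr p \<le> H * (measure M Q * c Q powr p)" .
  qed
  also have "\<dots> = H * (\<Sum>Q\<in>J. measure M Q * c Q powr p)" by (rule sum_distrib_left[symmetric])
  also have "\<dots> \<le> H * (4 * real N * 2 powr (p - 1) * (p / (p - 1)) * W)" by (intro mult_left_mono main H)
  finally show ?thesis by (simp add: mult.assoc)
qed

text \<open>As G^q = F^p, the Carleson embedding bounds the sum over the averages of G by a multiple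
  of X, the quantity to be estimated. Part of X is therefore absorbed. X is finite because the
  family is finite, F is bounded and w is integrable over cubes.\<close>

theorem sparse_weighted_bound:
  fixes f :: "'a \<Rightarrow> real" and p q H W :: real
  assumes f [measurable]: "f \<in> borel_measurable M" and a: "\<And>Q. Q \<in> J \<Longrightarrow> 0 \<le> a Q"
    and hh: "\<And>Q. Q \<in> J \<Longrightarrow> hh Q \<in> cubes \<DD>" "\<And>Q. Q \<in> J \<Longrightarrow> Q \<subseteq> hh Q"
      "\<And>Q. Q \<in> J \<Longrightarrow> emeasure M (hh Q) \<le> ennreal H * emeasure M Q"
    and af: "\<And>Q. Q \<in> J \<Longrightarrow> (\<integral>\<^sup>+x\<in>hh Q. ennreal \<bar>f x\<bar> \<partial>M) = ennreal (a Q) * emeasure M (hh Q)"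
    and p: "1 < p" and q: "q = p / (p - 1)" and H: "1 \<le> H" and W: "0 \<le> W"
    and fW: "(\<integral>\<^sup>+x. ennreal (\<bar>f x\<bar> powr p) * Mx (\<lambda>y. ennreal (w y)) x \<partial>M) = ennreal W"
  shows "(\<integral>\<^sup>+x. ennreal ((\<Sum>Q\<in>J. a Q * indicator Q x) powr p) * ennreal (w x) \<partial>M)
    \<le> ennreal ((8 * H * real N * p * q) powr p * \<Lambda> powr (p - 1) * W)"
proof -
  have q1: "1 < q" and pq: "1 / p + 1 / q = 1" and qq: "q / (q - 1) = p" and pmq: "(p - 1) * q = p"
    unfolding q using p by (auto simp: field_simps)
  define F where "F x = (\<Sum>Q\<in>J. a Q * indicator Q x)" for x :: 'a
  have F0: "0 \<le> F x" for x unfolding F_def using a by (intro sum_nonneg) auto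
  have F [measurable]: "F \<in> borel_measurable M"
    unfolding F_def using J_sets
    by (intro borel_measurable_sum borel_measurable_times borel_measurable_const borel_measurable_indicator) auto
  define G where "G x = F x powr (p - 1)" for x
  have G [measurable]: "G \<in> borel_measurable M" unfolding G_def by measurable
  have G0: "0 \<le> G x" for x unfolding G_def by simp
  define C where "C = (\<Sum>Q\<in>J. a Q)"
  have FC: "F x \<le> C" for x
    unfolding F_def C_def using a by (intro sum_mono) (auto split: split_indicator)
  define c where "c Q = enn2real (\<integral>\<^sup>+x\<in>Q. ennreal (G x) * ennreal (w x) \<partial>M) / wt Q" for Q
  have c0: "0 \<le> c Q" if "Q \<in> J" for Q unfolding c_def using wt_pos[OF J_cubes[OF that]] by simp
  have cG: "(\<integral>\<^sup>+x\<in>Q. ennreal (G x) * ennreal (w x) \<partial>M) = ennreal (c Q * wt Q)" if Q: "Q \<in> J" for Q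
  proof -
    note J_sets[OF Q, measurable]
    have "(\<integral>\<^sup>+x\<in>Q. ennreal (G x) * ennreal (w x) \<partial>M) \<le> (\<integral>\<^sup>+x. ennreal (C powr (p - 1)) * (ennreal (w x) * indicator Q x) \<partial>M)"
      using F0 FC p unfolding G_def
      by (intro nn_integral_mono) (auto simp: mult.assoc intro!: mult_right_mono ennreal_leI powr_mono2)
    also have "\<dots> = ennreal (C powr (p - 1)) * ennreal (wt Q)"
      unfolding wt_eq[OF J_cubes[OF Q], symmetric] by (intro nn_integral_cmult) measurable
    also have "\<dots> < \<infinity>" by (simp add: ennreal_mult_less_top)
    finally show ?thesis unfolding c_def using wt_pos[OF J_cubes[OF Q]] by (simp add: less_top)
  qed
  define X where "X = (\<Sum>Q\<in>J. a Q * (c Q * wt Q))"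
  have X0: "0 \<le> X" unfolding X_def using a c0 wt_pos[OF J_cubes] by (intro sum_nonneg mult_nonneg_nonneg) (auto intro: less_imp_le)
  have FX: "(\<integral>\<^sup>+x. ennreal (F x powr p) * ennreal (w x) \<partial>M) = ennreal X"
  proof -
    have "(\<integral>\<^sup>+x. ennreal (F x powr p) * ennreal (w x) \<partial>M)
      = (\<integral>\<^sup>+x. (\<Sum>Q\<in>J. ennreal (a Q) * (ennreal (G x) * ennreal (w x) * indicator Q x)) \<partial>M)"
    proof (rule nn_integral_cong)
      fix x
      have "F x powr p = F x * G x"
        unfolding G_def using F0[of x] p by (cases "F x = 0") (auto simp: powr_diff)
      hence "ennreal (F x powr p) = ennreal (F x) * ennreal (G x)" using F0 G0 by (simp add: ennreal_mult)
      also have "ennreal (F x) = (\<Sum>Q\<in>J. ennreal (a Q) * indicator Q x)"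
        unfolding F_def using a by (subst sum_ennreal[symmetric]) (auto simp: ennreal_mult ennreal_indicator intro!: sum.cong split: split_indicator)
      finally show "ennreal (F x powr p) * ennreal (w x) = (\<Sum>Q\<in>J. ennreal (a Q) * (ennreal (G x) * ennreal (w x) * indicator Q x))"
        by (simp only: mult.assoc sum_distrib_right) (intro sum.cong refl, simp only: ac_simps)
    qed
    also have "\<dots> = (\<Sum>Q\<in>J. ennreal (a Q) * (\<integral>\<^sup>+x\<in>Q. ennreal (G x) * ennreal (w x) \<partial>M))"
    proof -
      have m: "(\<lambda>x. ennreal (G x) * ennreal (w x) * indicator Q x) \<in> borel_measurable M" if "Q \<in> J" for Q
        by (intro borel_measurable_times_ennreal borel_measurable_indicator J_sets that) measurable
      have "(\<integral>\<^sup>+x. (\<Sum>Q\<in>J. ennreal (a Q) * (ennreal (G x) * ennreal (w x) * indicator Q x)) \<partial>M)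
        = (\<Sum>Q\<in>J. (\<integral>\<^sup>+x. ennreal (a Q) * (ennreal (G x) * ennreal (w x) * indicator Q x) \<partial>M))"
        by (intro nn_integral_sum borel_measurable_times_ennreal[OF borel_measurable_const m])
      also have "\<dots> = (\<Sum>Q\<in>J. ennreal (a Q) * (\<integral>\<^sup>+x\<in>Q. ennreal (G x) * ennreal (w x) \<partial>M))"
        by (intro sum.cong refl nn_integral_cmult m)
      finally show ?thesis .
    qed
    also have "\<dots> = (\<Sum>Q\<in>J. ennreal (a Q * (c Q * wt Q)))"
      using a c0 cG wt_pos[OF J_cubes] by (intro sum.cong) (auto simp: ennreal_mult[symmetric] less_imp_le)
    also have "\<dots> = ennreal X"
      unfolding X_def using a c0 wt_pos[OF J_cubes] by (intro sum_ennreal mult_nonneg_nonneg) (auto intro: less_imp_le)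
    finally show ?thesis .
  qed
  \<comment> \<open>The constant of \<open>Carleson_embedding\<close>, where q / (q - 1) =
    p.\<close>
  define b where "b = 4 * \<Lambda> * 2 powr (q - 1) * p"
  have b: "0 < b" unfolding b_def using Lambda_pos p by simp
  have B: "(\<Sum>Q\<in>J. wt Q * c Q powr q) \<le> b * X"
  proof -
    have "G x powr q = F x powr p" for x unfolding G_def using pmq by (simp add: powr_powr)
    hence "(\<integral>\<^sup>+x. ennreal (G x powr q) * ennreal (w x) \<partial>M) = ennreal X" using FX by simp
    hence "ennreal (\<Sum>Q\<in>J. wt Q * c Q powr q) \<le> ennreal b * ennreal X"
      using Carleson_embedding[OF G G0 c0 cG q1] unfolding b_def qq by simp
    hence "ennreal (\<Sum>Q\<in>J. wt Q * c Q powr q) \<le> ennreal (b * X)" using b X0 by (simp add: ennreal_mult)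
    thus ?thesis using b X0 by (subst (asm) ennreal_le_iff) auto
  qed
  define Y where "Y = (\<Sum>Q\<in>J. wt Q * a Q powr p)"
  have Y: "Y \<le> H * (4 * real N * 2 powr (p - 1) * q) * W"
    unfolding Y_def q using H by (intro sparse_averages_le[OF f a hh af p _ W fW]) auto
  \<comment> \<open>With this scaling (c / s)^q = c^q / b, so the second sum in Young's inequality
    contributes at most X / q, and X / p remains on the left.\<close>
  define s where "s = b powr (1 / q)"
  have s: "0 < s" unfolding s_def using b by simp
  have "X \<le> (\<Sum>Q\<in>J. s powr p / p * (wt Q * a Q powr p) + 1 / (b * q) * (wt Q * c Q powr q))"
    unfolding X_def
  proof (rule sum_mono)
    fix Q assume Q: "Q \<in> J"
    have wQ: "0 < wt Q" by (rule wt_pos[OF J_cubes[OF Q]])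
    have "a Q * c Q = (s * a Q) * (c Q / s)" using s by simp
    also have "\<dots> \<le> (s * a Q) powr p / p + (c Q / s) powr q / q"
      using p q1 pq s a[OF Q] c0[OF Q] by (intro Youngs_inequality) auto
    also have "(s * a Q) powr p = s powr p * a Q powr p" using s a[OF Q] by (simp add: powr_mult)
    also have "(c Q / s) powr q = c Q powr q / b"
      using s c0[OF Q] b q1 by (simp add: powr_divide s_def powr_powr)
    finally have "a Q * c Q * wt Q \<le> (s powr p * a Q powr p / p + c Q powr q / b / q) * wt Q"
      using wQ by (intro mult_right_mono) auto
    thus "a Q * (c Q * wt Q) \<le> s powr p / p * (wt Q * a Q powr p) + 1 / (b * q) * (wt Q * c Q powr q)"
      by (simp add: algebra_simps)
  qed
  also have "\<dots> = s powr p / p * Y + 1 / (b * q) * (\<Sum>Q\<in>J. wt Q * c Q powr q)"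
    unfolding Y_def by (simp add: sum.distrib sum_distrib_left)
  also have "\<dots> \<le> s powr p / p * Y + 1 / (b * q) * (b * X)"
    using b q1 B by (intro add_left_mono mult_left_mono) auto
  also have "\<dots> = s powr p / p * Y + X * (1 / q)" using b by simp
  finally have "X * (1 - 1 / q) \<le> s powr p / p * Y" by (simp add: right_diff_distrib)
  moreover have "1 - 1 / q = 1 / p" using pq by simp
  ultimately have "X / p \<le> s powr p * Y / p" by simp
  hence "X \<le> s powr p * Y" using p by (simp add: divide_le_cancel)
  also have "s powr p = b powr (p - 1)"
  proof -
    have "p / q = p - 1" unfolding q using p by simp
    thus ?thesis unfolding s_def by (simp add: powr_powr)
  qed
  also have "b powr (p - 1) * Y \<le> b powr (p - 1) * (H * (4 * real N * 2 powr (p - 1) * q) * W)"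
    by (intro mult_left_mono Y) auto
  also have "\<dots> \<le> (8 * H * real N * p * q) powr p * \<Lambda> powr (p - 1) * W"
  proof -
    \<comment> \<open>As p tends to 1, the factor 2^(q-1) in b explodes. It enters with the power p
      - 1, however, and (q + 1)(p - 1) = 2 p - 1.\<close>
    have b_eq: "b powr (p - 1) = 2 powr (2 * p - 1) * \<Lambda> powr (p - 1) * p powr (p - 1)"
    proof -
      have "b = 2 powr (q + 1) * \<Lambda> * p"
      proof -
        have "q + 1 = (q - 1) + 2" by simp
        hence "(2::real) powr (q + 1) = 2 powr ((q - 1) + 2)" by (rule arg_cong)
        also have "\<dots> = 2 powr (q - 1) * 4" by (subst powr_add) simp
        finally show ?thesis unfolding b_def by simp
      qed
      hence "b powr (p - 1) = 2 powr ((q + 1) * (p - 1)) * \<Lambda> powr (p - 1) * p powr (p - 1)"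
        using Lambda_pos p by (simp add: powr_mult powr_powr)
      also have "(q + 1) * (p - 1) = 2 * p - 1" using pmq by (simp add: algebra_simps)
      finally show ?thesis .
    qed
    have N1: "1 \<le> real N" using N_ge_1 by simp
    have HN: "1 \<le> H * real N" using mult_mono[OF H N1] H by simp
    have "(2::real) powr (2 * p - 1) * (4 * 2 powr (p - 1)) = 2 powr (2 * p - 1) * (2 powr 2 * 2 powr (p - 1))" by simp
    also have "\<dots> = 2 powr (3 * p)" unfolding powr_add[symmetric] by simp
    also have "\<dots> = (2 powr 3) powr p" by (simp only: powr_powr)
    finally have 8: "(2::real) powr (2 * p - 1) * (4 * 2 powr (p - 1)) = 8 powr p" by simp
    \<comment> \<open>Bases that are at least 1 are raised to the power p, so that the p-th root
      taken in the end leaves the linear factor p q.\<close>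
    have 1: "H * real N \<le> (H * real N) powr p" using HN p powr_mono[of 1 p "H * real N"] by simp
    have 2: "q \<le> q powr p" using q1 p powr_mono[of 1 p q] by simp
    have 3: "p powr (p - 1) \<le> p powr p" using p by (intro powr_mono) auto
    have "b powr (p - 1) * (H * (4 * real N * 2 powr (p - 1) * q) * W)
      = (2 powr (2 * p - 1) * (4 * 2 powr (p - 1))) * ((H * real N) * (q * p powr (p - 1))) * (\<Lambda> powr (p - 1) * W)"
      unfolding b_eq by (simp add: ac_simps)
    also have "\<dots> \<le> 8 powr p * ((H * real N) powr p * (q powr p * p powr p)) * (\<Lambda> powr (p - 1) * W)"
      unfolding 8 using 1 2 3 W HN q1 by (intro mult_right_mono mult_left_mono mult_mono) auto
    also have "\<dots> = (8 * H * real N * p * q) powr p * \<Lambda> powr (p - 1) * W"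
      using H p q1 by (simp add: powr_mult ac_simps)
    finally show ?thesis .
  qed
  finally have "ennreal X \<le> ennreal ((8 * H * real N * p * q) powr p * \<Lambda> powr (p - 1) * W)" by (rule ennreal_leI)
  thus ?thesis using FX unfolding F_def by simp
qed

end

section \<open>Passage to the limit\<close>

context cz_main begin

text \<open>The finite family J of the pointwise bound depends on x, but it is contained in a member
  of one increasing exhaustion. The weighted bound is uniform over the members, so monotone
  convergence applies.\<close>

lemma local_weighted_bound:
  fixes w :: "'a \<Rightarrow> real" and p q \<Lambda> W :: real
  assumes f: "in_L2 M f" and Q0: "Q0 \<in> \<U>"
    and w [measurable]: "w \<in> borel_measurable M" and w_pos: "AE x in M. 0 < w x"
    and w_fin: "\<And>Q. Q \<in> cubes \<DD> \<Longrightarrow> (\<integral>\<^sup>+x\<in>Q. ennreal (w x) \<partial>M) < \<infinity>"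
    and Lambda_pos: "0 < \<Lambda>"
    and Ainf: "\<And>Q. Q \<in> cubes \<DD> \<Longrightarrow>
      (\<integral>\<^sup>+x\<in>Q. Mx (\<lambda>y. ennreal (w y) * indicator Q y) x \<partial>M) \<le> ennreal \<Lambda> * (\<integral>\<^sup>+x\<in>Q. ennreal (w x) \<partial>M)"
    and p: "1 < p" and q: "q = p / (p - 1)" and W: "0 \<le> W"
    and fW: "(\<integral>\<^sup>+x. ennreal (\<bar>f x\<bar> powr p) * Mx (\<lambda>y. ennreal (w y)) x \<partial>M) = ennreal W"
  shows "(\<integral>\<^sup>+x\<in>Q0. ennreal (\<bar>Tloc f Q0 x\<bar> powr p) * ennreal (w x) \<partial>M)
    \<le> ennreal ((cS * (8 * H * real N) * p * q) powr p * \<Lambda> powr (p - 1) * W)"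
proof -
  note in_L2_measurable[OF f, measurable]
  have q0: "0 < q" unfolding q using p by simp
  obtain \<S> E where \<S>: "\<S> \<subseteq> \<U>" "\<And>Q. Q \<in> \<S> \<Longrightarrow> E Q \<in> sets M" "\<And>Q. Q \<in> \<S> \<Longrightarrow> E Q \<subseteq> Q"
    "disjoint_family_on E \<S>" "\<And>Q. Q \<in> \<S> \<Longrightarrow> emeasure M Q \<le> 2 * emeasure M (E Q)"
    "AE x in M. x \<in> Q0 \<longrightarrow> (\<exists>J\<subseteq>\<S>. finite J \<and> \<bar>Tloc f Q0 x\<bar> \<le> cS * (\<Sum>Q\<in>J. avg f (hat Q) * indicator Q x))"
    using sparse_domination[OF f Q0] by blast
  have cntS: "countable \<S>" by (rule countable_subset[OF \<S>(1) countable_cubes])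
  obtain F where F: "\<And>n. finite (F n)" "\<And>n. F n \<subseteq> \<S>" "incseq F" "(\<Union>n::nat. F n) = \<S>"
    using countable_finite_exhaustion[OF cntS] by metis
  define sm where "sm J x = (\<Sum>Q\<in>J. avg f (hat Q) * indicator Q x)" for J x
  have sm_mono: "sm J x \<le> sm J' x" if "J \<subseteq> J'" "finite J'" for J J' x
    unfolding sm_def using that avg_nonneg by (intro sum_mono2) auto
  have sm0: "0 \<le> sm J x" for J x unfolding sm_def using avg_nonneg by (intro sum_nonneg) auto
  have smM: "sm J \<in> borel_measurable M" if "J \<subseteq> \<S>" for J
    unfolding sm_def using that \<S>(1) cube_sets
    by (intro borel_measurable_sum borel_measurable_times borel_measurable_const borel_measurable_indicator) auto
  have smFM [measurable]: "sm (F n) \<in> borel_measurable M" for n by (rule smM[OF F(2)])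
  define u where "u n x = ennreal (cS powr p) * (ennreal (sm (F n) x powr p) * ennreal (w x))" for n x
  have uM [measurable]: "u n \<in> borel_measurable M" for n unfolding u_def by measurable
  have "incseq u"
    unfolding incseq_def le_fun_def u_def
  proof (intro allI impI mult_left_mono mult_right_mono ennreal_leI powr_mono2)
    fix m n :: nat and x assume "m \<le> n"
    thus "sm (F m) x \<le> sm (F n) x" using F(1,3) by (intro sm_mono) (auto simp: incseq_def)
  qed (use p sm0 in auto)
  have "(\<integral>\<^sup>+x\<in>Q0. ennreal (\<bar>Tloc f Q0 x\<bar> powr p) * ennreal (w x) \<partial>M) \<le> (\<integral>\<^sup>+x. (SUP n. u n x) \<partial>M)"
  proof (rule nn_integral_mono_AE, use \<S>(6) in eventually_elim)
    case (elim x)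
    show ?case
    proof (cases "x \<in> Q0")
      case True
      with elim obtain J where J: "J \<subseteq> \<S>" "finite J" "\<bar>Tloc f Q0 x\<bar> \<le> cS * sm J x" unfolding sm_def by blast
      have "\<exists>n. J \<subseteq> F n"
        using J(2,1)
      proof (induction J)
        case (insert Q J)
        then obtain n where n: "J \<subseteq> F n" by auto
        obtain m where m: "Q \<in> F m" using insert F(4) by blast
        have "F n \<subseteq> F (max n m)" "F m \<subseteq> F (max n m)" using F(3) unfolding incseq_def by auto
        thus ?case using n m by blast
      qed simp
      then obtain n where "J \<subseteq> F n" by blast
      hence "cS * sm J x \<le> cS * sm (F n) x" using F(1) cS_ge by (intro mult_left_mono sm_mono) auto
      with J(3) have "\<bar>Tloc f Q0 x\<bar> powr p \<le> (cS * sm (F n) x) powr p" using p by (intro powr_mono2) auto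
      also have "\<dots> = cS powr p * sm (F n) x powr p" using cS_ge sm0 by (simp add: powr_mult)
      finally have "ennreal (\<bar>Tloc f Q0 x\<bar> powr p) * ennreal (w x) \<le> ennreal (cS powr p * sm (F n) x powr p) * ennreal (w x)"
        by (intro mult_right_mono ennreal_leI) auto
      also have "\<dots> = u n x" unfolding u_def by (simp add: ennreal_mult mult.assoc)
      also have "\<dots> \<le> (SUP n. u n x)" by (rule SUP_upper) simp
      finally show ?thesis using True by simp
    qed simp
  qed
  also have "\<dots> = (SUP n. \<integral>\<^sup>+x. u n x \<partial>M)" using \<open>incseq u\<close> by (rule nn_integral_monotone_convergence_SUP) measurable
  also have "\<dots> \<le> ennreal ((cS * (8 * H * real N) * p * q) powr p * \<Lambda> powr (p - 1) * W)"
  proof (rule SUP_least)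
    fix n
    have FU: "Q \<in> \<U>" if "Q \<in> F n" for Q using that F(2)[of n] \<S>(1) by blast
    have "sparse_weight M \<rho> \<kappa> D N \<delta> C\<^sub>0 \<epsilon> A \<DD> (F n) E w \<Lambda>"
    proof (intro sparse_weight.intro adjacent_axioms sparse_weight_axioms.intro)
      show "nested (F n)" using nested_subset[OF nested_cubes] FU by blast
      show "F n \<subseteq> cubes \<DD>" using FU U_subset_cubes by blast
      show "disjoint_family_on E (F n)" by (rule disjoint_family_on_mono[OF F(2) \<S>(4)])
    qed (use F(1) F(2)[of n] \<S>(2,3,5) w w_pos w_fin Lambda_pos Ainf in \<open>auto simp: subset_iff\<close>)
    then interpret sw: sparse_weight M \<rho> \<kappa> D N \<delta> C\<^sub>0 \<epsilon> A \<DD> "F n" E w \<Lambda> .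
    have "(\<integral>\<^sup>+x. u n x \<partial>M) = ennreal (cS powr p) * (\<integral>\<^sup>+x. ennreal (sm (F n) x powr p) * ennreal (w x) \<partial>M)"
      unfolding u_def by (rule nn_integral_cmult) measurable
    also have "\<dots> \<le> ennreal (cS powr p) * ennreal ((8 * H * real N * p * q) powr p * \<Lambda> powr (p - 1) * W)"
    proof (rule mult_left_mono)
      show "(\<integral>\<^sup>+x. ennreal (sm (F n) x powr p) * ennreal (w x) \<partial>M) \<le> ennreal ((8 * H * real N * p * q) powr p * \<Lambda> powr (p - 1) * W)"
        unfolding sm_def
      proof (rule sw.sparse_weighted_bound[OF _ _ _ _ _ _ p q H_ge_1 W fW])
        show "hat Q \<in> cubes \<DD>" "Q \<subseteq> hat Q" "emeasure M (hat Q) \<le> ennreal H * emeasure M Q"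
          "(\<integral>\<^sup>+x\<in>hat Q. ennreal \<bar>f x\<bar> \<partial>M) = ennreal (avg f (hat Q)) * emeasure M (hat Q)" if "Q \<in> F n" for Q
          using FU[OF that] by (intro hat_cubes cube_subset_hat hat_measure avg_eq f; assumption)+
      qed (auto intro: avg_nonneg)
    qed simp
    also have "\<dots> = ennreal ((cS * (8 * H * real N) * p * q) powr p * \<Lambda> powr (p - 1) * W)"
    proof -
      have "(cS * (8 * H * real N) * p * q) powr p = cS powr p * (8 * H * real N * p * q) powr p"
        using cS_ge H_ge_1 p q0 by (simp add: powr_mult[symmetric] ac_simps)
      thus ?thesis using W by (simp add: ennreal_mult[symmetric] mult.assoc)
    qed
    finally show "(\<integral>\<^sup>+x. u n x \<partial>M) \<le> ennreal ((cS * (8 * H * real N) * p * q) powr p * \<Lambda> powr (p - 1) * W)" .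
  qed
  finally show ?thesis .
qed

end

section \<open>From cubes to the whole space\<close>

locale cz_adjacent = adjacent M \<rho> \<kappa> D N \<delta> C\<^sub>0 \<epsilon> A \<DD> + cz_op M \<rho> \<kappa> D K \<eta> C\<^sub>K T \<beta>
  for M :: "'a measure" and \<rho> \<kappa> D N \<delta> C\<^sub>0 \<epsilon> A \<DD> K \<eta> C\<^sub>K T \<beta>
begin

lemma T_bound_integral:
  assumes "in_L2 M f"
  shows "(\<integral>x. (T f x)\<^sup>2 \<partial>M) \<le> \<beta> * (\<integral>x. (f x)\<^sup>2 \<partial>M)"
proof -
  have i: "integrable M (\<lambda>x. (T f x)\<^sup>2)" "integrable M (\<lambda>x. (f x)\<^sup>2)"
    using assms T_L2[OF assms] unfolding in_L2_def by auto
  have "ennreal (\<integral>x. (T f x)\<^sup>2 \<partial>M) \<le> ennreal \<beta> * ennreal (\<integral>x. (f x)\<^sup>2 \<partial>M)"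
    using T_bound[OF assms] i by (simp add: nn_integral_eq_integral)
  also have "\<dots> = ennreal (\<beta> * (\<integral>x. (f x)\<^sup>2 \<partial>M))" using beta_nonneg by (simp add: ennreal_mult)
  finally show ?thesis using beta_nonneg by (subst (asm) ennreal_le_iff) auto
qed

text \<open>Dominated convergence gives convergence of the truncations in L2, the bound of T
  transports it to their images, and a subsequence converges almost everywhere.\<close>

lemma truncation_AE_subseq:
  assumes f: "in_L2 M f" and S: "\<And>n. S n \<in> sets M"
    and cover: "\<And>x. x \<in> space M \<Longrightarrow> \<forall>\<^sub>F n in sequentially. x \<in> S n"
  obtains s :: "nat \<Rightarrow> nat" where "strict_mono s" "AE x in M. (\<lambda>n. T (\<lambda>y. f y * indicator (S (s n)) y) x) \<longlonglongrightarrow> T f x"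
proof -
  note in_L2_measurable[OF f, measurable] S[measurable]
  define g where "g n y = f y * indicator (S n) y" for n y
  have g: "in_L2 M (g n)" for n unfolding g_def by (intro in_L2_indicator f S)
  define d where "d n y = f y - g n y" for n y
  have d: "in_L2 M (d n)" for n unfolding d_def by (intro in_L2_diff f g)
  define u where "u n x = (T (d n) x)\<^sup>2" for n x
  have ui: "integrable M (u n)" for n unfolding u_def using T_L2[OF d[of n]] unfolding in_L2_def by simp
  have "(\<lambda>n. \<integral>x. (d n x)\<^sup>2 \<partial>M) \<longlonglongrightarrow> (\<integral>x. 0 \<partial>M)"
  proof (rule integral_dominated_convergence[where w = "\<lambda>x. (f x)\<^sup>2"])
    show "integrable M (\<lambda>x. (f x)\<^sup>2)" using f unfolding in_L2_def by simp
    show "(\<lambda>x. (d n x)\<^sup>2) \<in> borel_measurable M" for n using in_L2_measurable[OF d[of n]] by measurable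
    show "AE x in M. (\<lambda>n. (d n x)\<^sup>2) \<longlonglongrightarrow> 0"
    proof (rule AE_I2)
      fix x assume "x \<in> space M"
      from cover[OF this] have "\<forall>\<^sub>F n in sequentially. (d n x)\<^sup>2 = 0"
        by eventually_elim (simp add: d_def g_def)
      thus "(\<lambda>n. (d n x)\<^sup>2) \<longlonglongrightarrow> 0" by (rule tendsto_eventually)
    qed
    show "AE x in M. norm ((d n x)\<^sup>2) \<le> (f x)\<^sup>2" for n
      by (rule AE_I2) (auto simp: d_def g_def split: split_indicator)
  qed measurable
  hence "(\<lambda>n. \<beta> * (\<integral>x. (d n x)\<^sup>2 \<partial>M)) \<longlonglongrightarrow> \<beta> * 0" by (intro tendsto_mult tendsto_const) simp
  hence lim: "(\<lambda>n. \<beta> * (\<integral>x. (d n x)\<^sup>2 \<partial>M)) \<longlonglongrightarrow> 0" by simp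
  have "(\<lambda>n. \<integral>x. norm (u n x) \<partial>M) \<longlonglongrightarrow> 0"
  proof (rule tendsto_sandwich[OF _ _ tendsto_const lim])
    show "\<forall>\<^sub>F n in sequentially. 0 \<le> (\<integral>x. norm (u n x) \<partial>M)" by (intro always_eventually allI integral_nonneg_AE) auto
    show "\<forall>\<^sub>F n in sequentially. (\<integral>x. norm (u n x) \<partial>M) \<le> \<beta> * (\<integral>x. (d n x)\<^sup>2 \<partial>M)"
      using T_bound_integral[OF d] unfolding u_def by (intro always_eventually allI) simp
  qed
  from tendsto_L1_AE_subseq[OF ui this] obtain s :: "nat \<Rightarrow> nat"
    where s: "strict_mono s" "AE x in M. (\<lambda>n. u (s n) x) \<longlonglongrightarrow> 0" by blast
  have "AE x in M. \<forall>n. T (d n) x = T f x - T (g n) x"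
    unfolding AE_all_countable d_def using T_diff[OF f g] by blast
  with s(2) have "AE x in M. (\<lambda>n. T (g (s n)) x) \<longlonglongrightarrow> T f x"
  proof eventually_elim
    case (elim x)
    have "(\<lambda>n. sqrt (u (s n) x)) \<longlonglongrightarrow> sqrt 0" using elim(1) by (rule tendsto_real_sqrt)
    hence "(\<lambda>n. \<bar>T f x - T (g (s n)) x\<bar>) \<longlonglongrightarrow> 0" using elim(2) unfolding u_def by simp
    hence "(\<lambda>n. T f x - T (g (s n)) x) \<longlonglongrightarrow> 0" by (rule tendsto_rabs_zero_cancel)
    hence "(\<lambda>n. T f x - (T f x - T (g (s n)) x)) \<longlonglongrightarrow> T f x - 0" by (intro tendsto_diff tendsto_const)
    thus ?case by simp
  qed
  thus thesis using that[OF s(1)] unfolding g_def by blast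
qed

text \<open>An increasing sequence of cubes of one system need not exhaust the space. Hence cubes
  containing larger and larger balls are taken from any of the systems; their bounds share one
  constant, and Fatou's lemma passes to the limit.\<close>

theorem weighted_bound:
  fixes w :: "'a \<Rightarrow> real" and p q \<Lambda> W :: real
  assumes f: "in_L2 M f"
    and w [measurable]: "w \<in> borel_measurable M" and w_pos: "AE x in M. 0 < w x"
    and w_fin: "\<And>Q. Q \<in> cubes \<DD> \<Longrightarrow> (\<integral>\<^sup>+x\<in>Q. ennreal (w x) \<partial>M) < \<infinity>"
    and Lambda_pos: "0 < \<Lambda>"
    and Ainf: "\<And>Q. Q \<in> cubes \<DD> \<Longrightarrow>
      (\<integral>\<^sup>+x\<in>Q. Mx (\<lambda>y. ennreal (w y) * indicator Q y) x \<partial>M) \<le> ennreal \<Lambda> * (\<integral>\<^sup>+x\<in>Q. ennreal (w x) \<partial>M)"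
    and p: "1 < p" and q: "q = p / (p - 1)" and W: "0 \<le> W"
    and fW: "(\<integral>\<^sup>+x. ennreal (\<bar>f x\<bar> powr p) * Mx (\<lambda>y. ennreal (w y)) x \<partial>M) = ennreal W"
  shows "(\<integral>\<^sup>+x. ennreal (\<bar>T f x\<bar> powr p) * ennreal (w x) \<partial>M)
    \<le> ennreal ((sparse_const C\<^sub>0 \<epsilon> A N * (8 * hat_const C\<^sub>0 A * real N) * p * q) powr p * \<Lambda> powr (p - 1) * W)"
    (is "_ \<le> ?Z")
proof -
  obtain x0 where x0: "x0 \<in> space M" using nonempty by blast
  \<comment> \<open>The system, and with it \<open>dil\<close>, varies with n, so only
    measurability, inclusions and the bound are retained. The radius n + 1 is positive also at n =
    0.\<close>
  have "\<forall>n::nat. \<exists>Q S. S \<in> sets M \<and> Q \<in> sets M \<and> ball x0 (real n + 1) \<subseteq> Q \<and> Q \<subseteq> S \<and>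
    (\<integral>\<^sup>+x\<in>Q. ennreal (\<bar>T (\<lambda>y. f y * indicator S y) x\<bar> powr p) * ennreal (w x) \<partial>M) \<le> ?Z"
  proof
    fix n
    obtain Q where Q: "Q \<in> cubes \<DD>" "ball x0 (real n + 1) \<subseteq> Q" using ball_in_cube[OF x0, of "real n + 1"] by auto
    obtain \<D> where sys: "\<D> \<in> \<DD>" "Q \<in> dyadic_system.\<U> \<D>" using Q(1) by (rule in_cubesE)
    interpret cz_main M \<rho> \<kappa> D N \<delta> C\<^sub>0 \<epsilon> A \<DD> K \<eta> C\<^sub>K T \<beta> \<D>
      by (intro cz_main.intro adjacent_axioms cz_op_axioms cz_main_axioms.intro sys)
    from local_weighted_bound[OF f sys(2) w w_pos w_fin Lambda_pos Ainf p q W fW]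
    have "(\<integral>\<^sup>+x\<in>Q. ennreal (\<bar>T (\<lambda>y. f y * indicator (dil Q) y) x\<bar> powr p) * ennreal (w x) \<partial>M) \<le> ?Z"
      unfolding Tloc_def .
    thus "\<exists>Q S. S \<in> sets M \<and> Q \<in> sets M \<and> ball x0 (real n + 1) \<subseteq> Q \<and> Q \<subseteq> S \<and>
      (\<integral>\<^sup>+x\<in>Q. ennreal (\<bar>T (\<lambda>y. f y * indicator S y) x\<bar> powr p) * ennreal (w x) \<partial>M) \<le> ?Z"
      using Q(2) dil_sets[OF sys(2)] cube_subset_dil[OF sys(2)] cubes_sets[OF Q(1)]
      by (intro exI[of _ Q] exI[of _ "dil Q"] conjI)
  qed
  from choice[OF this] obtain Q where "\<forall>n. \<exists>S. S \<in> sets M \<and> Q n \<in> sets M \<and> ball x0 (real n + 1) \<subseteq> Q n \<and> Q n \<subseteq> S \<and>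
    (\<integral>\<^sup>+x\<in>Q n. ennreal (\<bar>T (\<lambda>y. f y * indicator S y) x\<bar> powr p) * ennreal (w x) \<partial>M) \<le> ?Z" ..
  from choice[OF this] obtain S where QS': "\<forall>n. S n \<in> sets M \<and> Q n \<in> sets M \<and> ball x0 (real n + 1) \<subseteq> Q n \<and> Q n \<subseteq> S n \<and>
    (\<integral>\<^sup>+x\<in>Q n. ennreal (\<bar>T (\<lambda>y. f y * indicator (S n) y) x\<bar> powr p) * ennreal (w x) \<partial>M) \<le> ?Z" ..
  have QS: "\<And>n. S n \<in> sets M" "\<And>n. Q n \<in> sets M" "\<And>n. ball x0 (real n + 1) \<subseteq> Q n"
    "\<And>n. Q n \<subseteq> S n"
    "\<And>n::nat. (\<integral>\<^sup>+x\<in>Q n. ennreal (\<bar>T (\<lambda>y. f y * indicator (S n) y) x\<bar> powr p) * ennreal (w x) \<partial>M) \<le> ?Z"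
    using QS' by simp_all
  have evQ: "\<forall>\<^sub>F n in sequentially. x \<in> Q n" if x: "x \<in> space M" for x
  proof -
    obtain k :: nat where k: "\<rho> x0 x < real k" using reals_Archimedean2 by blast
    have "x \<in> Q n" if "k \<le> n" for n
    proof -
      have "\<rho> x0 x < real n + 1" using k that by linarith
      thus ?thesis using QS(3)[of n] x by (auto simp: mem_ball)
    qed
    thus ?thesis by (auto simp: eventually_sequentially)
  qed
  have evS: "\<forall>\<^sub>F n in sequentially. x \<in> S n" if "x \<in> space M" for x
    using evQ[OF that] by eventually_elim (use QS(4) in blast)
  obtain s :: "nat \<Rightarrow> nat" where s: "strict_mono s"
    "AE x in M. (\<lambda>n. T (\<lambda>y. f y * indicator (S (s n)) y) x) \<longlonglongrightarrow> T f x"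
    by (rule truncation_AE_subseq[OF f QS(1) evS])
  define r where "r n = T (\<lambda>y. f y * indicator (S (s n)) y)" for n
  have rM [measurable]: "r n \<in> borel_measurable M" for n
    unfolding r_def by (intro in_L2_measurable T_L2 in_L2_indicator f QS)
  \<comment> \<open>The bound is available on \<open>Q (s n)\<close> only; the restriction
    disappears in the limit, because each point eventually lies in all these cubes.\<close>
  define v where "v n x = ennreal (\<bar>r n x\<bar> powr p) * ennreal (w x) * indicator (Q (s n)) x" for n x
  have "(\<integral>\<^sup>+x. ennreal (\<bar>T f x\<bar> powr p) * ennreal (w x) \<partial>M) \<le> (\<integral>\<^sup>+x. liminf (\<lambda>n. v n x) \<partial>M)"
  proof (rule nn_integral_mono_AE)
    show "AE x in M. ennreal (\<bar>T f x\<bar> powr p) * ennreal (w x) \<le> liminf (\<lambda>n. v n x)"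
      using s(2) AE_space
    proof eventually_elim
      case (elim x)
      have "(\<lambda>n. \<bar>r n x\<bar> powr p) \<longlonglongrightarrow> \<bar>T f x\<bar> powr p"
        using elim(1) p unfolding r_def by (intro tendsto_powr' tendsto_rabs tendsto_const) auto
      hence "(\<lambda>n. ennreal (w x) * ennreal (\<bar>r n x\<bar> powr p)) \<longlonglongrightarrow> ennreal (w x) * ennreal (\<bar>T f x\<bar> powr p)"
        by (intro ennreal_tendsto_cmult tendsto_ennrealI) auto
      moreover have "\<forall>\<^sub>F n in sequentially. x \<in> Q (s n)"
        using evQ[OF elim(2)] filterlim_subseq[OF s(1)] by (auto simp: filterlim_iff)
      hence "\<forall>\<^sub>F n in sequentially. ennreal (w x) * ennreal (\<bar>r n x\<bar> powr p) = v n x"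
        by eventually_elim (simp add: v_def mult.commute)
      ultimately have "(\<lambda>n. v n x) \<longlonglongrightarrow> ennreal (w x) * ennreal (\<bar>T f x\<bar> powr p)"
        by (rule Lim_transform_eventually)
      hence "liminf (\<lambda>n. v n x) = ennreal (w x) * ennreal (\<bar>T f x\<bar> powr p)"
        by (intro lim_imp_Liminf) auto
      thus ?case by (simp add: mult.commute)
    qed
  qed
  also have "\<dots> \<le> liminf (\<lambda>n. \<integral>\<^sup>+x. v n x \<partial>M)"
    unfolding v_def using QS(2)
    by (intro nn_integral_liminf borel_measurable_times_ennreal borel_measurable_indicator) auto
  also have "\<dots> \<le> liminf (\<lambda>n::nat. ?Z)"
    unfolding v_def r_def by (intro Liminf_mono always_eventually allI QS(5))
  also have "\<dots> = ?Z" by (rule Liminf_const) simp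
  finally show ?thesis .
qed

end

section \<open>Weights\<close>

lemma ennpowr_ennreal: "0 \<le> z \<Longrightarrow> ennpowr (ennreal z) a = ennreal (z powr a)"
  unfolding ennpowr_def by simp

lemma ennpowr_mono: "s \<le> t \<Longrightarrow> 0 \<le> a \<Longrightarrow> ennpowr s a \<le> ennpowr t a"
  by (cases s; cases t) (auto simp: ennpowr_def top_unique intro!: ennreal_leI powr_mono2)

lemma ennpowr_mult:
  assumes "c \<noteq> \<infinity>" "0 < c" "0 < a"
  shows "ennpowr (c * t) a = ennpowr c a * ennpowr t a"
proof (cases t)
  case (real r)
  obtain z where z: "c = ennreal z" "0 < z" using assms(1,2) by (cases c) auto
  thus ?thesis using real by (simp add: ennreal_mult[symmetric] ennpowr_ennreal powr_mult)
next
  case top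
  obtain z where z: "c = ennreal z" "0 < z" using assms(1,2) by (cases c) auto
  thus ?thesis using top by (simp add: ennpowr_def ennreal_mult_top)
qed

context adjacent begin

lemma Mx_cong_AE:
  assumes "AE x in M. h x = h' x"
  shows "Mx h = Mx h'"
proof -
  have "(\<integral>\<^sup>+y\<in>Q. h y \<partial>M) = (\<integral>\<^sup>+y\<in>Q. h' y \<partial>M)" for Q
    using assms by (intro nn_integral_cong_AE, eventually_elim) simp
  thus ?thesis unfolding Mx_def by simp
qed

lemma Mx_mono: "(\<And>y. h y \<le> h' y) \<Longrightarrow> Mx h x \<le> Mx h' x"
  unfolding Mx_def by (intro SUP_mono) (auto intro!: divide_right_mono_ennreal nn_integral_mono mult_right_mono)

lemma cubes_nonempty: "cubes \<DD> \<noteq> {}"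
proof -
  obtain x where "x \<in> space M" using nonempty by blast
  from ball_in_cube[OF this, of 1] show ?thesis by auto
qed

context
  fixes w :: "'a \<Rightarrow> real"
  assumes weight: "weight M \<rho> w"
begin

lemma weight_measurable [measurable]: "w \<in> borel_measurable M"
  and weight_pos: "AE x in M. 0 < w x"
  using weight unfolding weight_def by auto

lemma weight_integral_finite:
  assumes Q: "Q \<in> cubes \<DD>"
  shows "(\<integral>\<^sup>+x\<in>Q. ennreal (w x) \<partial>M) < \<infinity>"
proof -
  obtain \<D> where sys: "\<D> \<in> \<DD>" "Q \<in> dyadic_system.\<U> \<D>" using Q by (rule in_cubesE)
  interpret d: dyadic_system M \<rho> \<kappa> D \<delta> C\<^sub>0 \<epsilon> \<D> by (rule dyadic_system[OF sys(1)])
  define B where "B = ball (d.cen Q) (C\<^sub>0 * d.rad Q)"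
  have "set_integrable M B w"
    unfolding B_def using weight d.cen_space[OF sys(2)] d.C0_pos d.rad_pos unfolding weight_def by simp
  hence "(\<integral>\<^sup>+x. ennreal (norm (indicator B x *\<^sub>R w x)) \<partial>M) < \<infinity>"
    unfolding set_integrable_def integrable_iff_bounded by blast
  moreover have "(\<integral>\<^sup>+x\<in>Q. ennreal (w x) \<partial>M) \<le> (\<integral>\<^sup>+x. ennreal (norm (indicator B x *\<^sub>R w x)) \<partial>M)"
    using d.cube_subset_ball[OF sys(2)] unfolding B_def
    by (intro nn_integral_mono) (auto split: split_indicator intro!: ennreal_leI)
  ultimately show ?thesis by (rule le_less_trans[rotated])
qed

lemma maximal_weight: "maximal M \<DD> w = Mx (\<lambda>y. ennreal (w y))"
  unfolding maximal_eq_Mx using weight_pos by (intro Mx_cong_AE, eventually_elim) simp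

lemma maximal_weight_indicator:
  "maximal M \<DD> (\<lambda>y. w y * indicator Q y) = Mx (\<lambda>y. ennreal (w y) * indicator Q y)"
  unfolding maximal_eq_Mx using weight_pos
  by (intro Mx_cong_AE, eventually_elim) (auto split: split_indicator)

lemma Ainf_const_eq:
  "Ainf_const M \<DD> w = (SUP Q\<in>cubes \<DD>. (\<integral>\<^sup>+x\<in>Q. Mx (\<lambda>y. ennreal (w y) * indicator Q y) x \<partial>M) / (\<integral>\<^sup>+x\<in>Q. ennreal (w x) \<partial>M))"
  unfolding Ainf_const_def maximal_weight_indicator ..

lemma weight_integral_pos: "Q \<in> cubes \<DD> \<Longrightarrow> 0 < (\<integral>\<^sup>+x\<in>Q. ennreal (w x) \<partial>M)"
  by (rule integral_cube_pos[OF weight_measurable weight_pos])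

lemma Ainf_const_bound:
  assumes Q: "Q \<in> cubes \<DD>"
  shows "(\<integral>\<^sup>+x\<in>Q. Mx (\<lambda>y. ennreal (w y) * indicator Q y) x \<partial>M) \<le> Ainf_const M \<DD> w * (\<integral>\<^sup>+x\<in>Q. ennreal (w x) \<partial>M)"
proof -
  let ?z = "\<integral>\<^sup>+x\<in>Q. ennreal (w x) \<partial>M"
  have "(\<integral>\<^sup>+x\<in>Q. Mx (\<lambda>y. ennreal (w y) * indicator Q y) x \<partial>M)
    = (\<integral>\<^sup>+x\<in>Q. Mx (\<lambda>y. ennreal (w y) * indicator Q y) x \<partial>M) / ?z * ?z"
    using weight_integral_pos[OF Q] weight_integral_finite[OF Q]
    by (intro ennreal_divide_mult_cancel[symmetric]) auto
  also have "\<dots> \<le> Ainf_const M \<DD> w * ?z"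
    unfolding Ainf_const_eq using Q by (intro mult_right_mono SUP_upper) auto
  finally show ?thesis .
qed

text \<open>On Q the maximal function of w \<chi>_Q is at least the average of w. This keeps the
  factor in front of the norm positive, which matters when that norm is infinite.\<close>

lemma Ainf_const_ge_1: "1 \<le> Ainf_const M \<DD> w"
proof -
  obtain Q where Q: "Q \<in> cubes \<DD>" using cubes_nonempty by blast
  note cubes_sets[OF Q, measurable]
  let ?z = "\<integral>\<^sup>+x\<in>Q. ennreal (w x) \<partial>M"
  have "?z = (\<integral>\<^sup>+x\<in>Q. ?z / emeasure M Q \<partial>M)"
    using cubes_pos[OF Q] cubes_finite[OF Q]
    by (subst nn_integral_cmult_indicator) (auto simp: ennreal_divide_mult_cancel)
  also have "\<dots> \<le> (\<integral>\<^sup>+x\<in>Q. Mx (\<lambda>y. ennreal (w y) * indicator Q y) x \<partial>M)"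
  proof (rule nn_integral_mono)
    fix x
    have e: "?z = (\<integral>\<^sup>+y\<in>Q. (ennreal (w y) * indicator Q y) \<partial>M)"
      by (intro nn_integral_cong) (auto split: split_indicator)
    show "?z / emeasure M Q * indicator Q x \<le> Mx (\<lambda>y. ennreal (w y) * indicator Q y) x * indicator Q x"
      using Mx_ge[OF Q, of x "\<lambda>y. ennreal (w y) * indicator Q y"] unfolding e[symmetric]
      by (cases "x \<in> Q") simp_all
  qed
  also have "\<dots> \<le> Ainf_const M \<DD> w * ?z" by (rule Ainf_const_bound[OF Q])
  finally have "1 * ?z \<le> Ainf_const M \<DD> w * ?z" by simp
  thus ?thesis
    using weight_integral_pos[OF Q] weight_integral_finite[OF Q]
    by (subst (asm) ennreal_mult_le_mult_iff[of ?z, unfolded mult.commute[of ?z]]) auto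
qed

text \<open>Each cube gives the bound outside a null set, and the countability of the cubes permits
  the supremum.\<close>

lemma Mx_le_A1:
  assumes A1: "A1_const M \<DD> w < \<infinity>"
  shows "AE x in M. Mx (\<lambda>y. ennreal (w y)) x \<le> A1_const M \<DD> w * ennreal (w x)"
proof -
  have "AE x in M. x \<in> Q \<longrightarrow> (\<integral>\<^sup>+y\<in>Q. ennreal (w y) \<partial>M) / emeasure M Q \<le> A1_const M \<DD> w * ennreal (w x)"
    if Q: "Q \<in> cubes \<DD>" for Q
  proof -
    note cubes_sets[OF Q, measurable]
    let ?a = "(\<integral>\<^sup>+y\<in>Q. ennreal (w y) \<partial>M) / emeasure M Q"
    let ?e = "esssup (restrict_space M Q) (\<lambda>x. inverse (ennreal (w x)))"
    have "AE x in restrict_space M Q. inverse (ennreal (w x)) \<le> ?e" by (rule esssup_AE)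
    hence "AE x in M. x \<in> Q \<longrightarrow> inverse (ennreal (w x)) \<le> ?e"
      using cubes_sets[OF Q] by (subst (asm) AE_restrict_space_iff) auto
    with weight_pos show ?thesis
    proof eventually_elim
      case (elim x)
      show ?case
      proof
        assume "x \<in> Q"
        hence "?a * inverse (ennreal (w x)) \<le> ?a * ?e" using elim by (intro mult_left_mono) auto
        also have "\<dots> \<le> A1_const M \<DD> w" unfolding A1_const_def using Q by (intro SUP_upper) auto
        finally have "?a * inverse (ennreal (w x)) * ennreal (w x) \<le> A1_const M \<DD> w * ennreal (w x)"
          by (rule mult_right_mono) simp
        moreover have "inverse (ennreal (w x)) * ennreal (w x) = 1"
          using elim by (simp add: inverse_ennreal ennreal_mult[symmetric])
        ultimately show "?a \<le> A1_const M \<DD> w * ennreal (w x)" by (simp add: mult.assoc)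
      qed
    qed
  qed
  hence "AE x in M. \<forall>Q\<in>cubes \<DD>. x \<in> Q \<longrightarrow> (\<integral>\<^sup>+y\<in>Q. ennreal (w y) \<partial>M) / emeasure M Q \<le> A1_const M \<DD> w * ennreal (w x)"
    using countable_cubes_all by (subst AE_ball_countable) auto
  thus ?thesis by eventually_elim (auto simp: Mx_def intro!: SUP_least)
qed

text \<open>By M(w \<chi>_Q) <= Mw <= [w] w with the A_1 constant. Hence A_1 weights are A_infinity
  weights, and the second inequality can be deduced from the first.\<close>

lemma Ainf_le_A1:
  assumes A1: "A1_const M \<DD> w < \<infinity>"
  shows "Ainf_const M \<DD> w \<le> A1_const M \<DD> w"
  unfolding Ainf_const_eq
proof (rule SUP_least)
  fix Q assume Q: "Q \<in> cubes \<DD>"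
  note cubes_sets[OF Q, measurable]
  let ?z = "\<integral>\<^sup>+x\<in>Q. ennreal (w x) \<partial>M"
  have "(\<integral>\<^sup>+x\<in>Q. Mx (\<lambda>y. ennreal (w y) * indicator Q y) x \<partial>M) \<le> (\<integral>\<^sup>+x. A1_const M \<DD> w * (ennreal (w x) * indicator Q x) \<partial>M)"
  proof (rule nn_integral_mono_AE, use Mx_le_A1[OF A1] in eventually_elim)
    case (elim x)
    have "Mx (\<lambda>y. ennreal (w y) * indicator Q y) x \<le> Mx (\<lambda>y. ennreal (w y)) x"
      by (intro Mx_mono) (auto split: split_indicator)
    with elim have "Mx (\<lambda>y. ennreal (w y) * indicator Q y) x \<le> A1_const M \<DD> w * ennreal (w x)" by (rule order_trans[rotated])
    thus ?case unfolding mult.assoc[symmetric] by (rule mult_right_mono) simp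
  qed
  also have "\<dots> = A1_const M \<DD> w * ?z" by (rule nn_integral_cmult) measurable
  finally have "(\<integral>\<^sup>+x\<in>Q. Mx (\<lambda>y. ennreal (w y) * indicator Q y) x \<partial>M) / ?z \<le> A1_const M \<DD> w * ?z / ?z"
    by (rule divide_right_mono_ennreal)
  also have "\<dots> = A1_const M \<DD> w"
    using weight_integral_pos[OF Q] weight_integral_finite[OF Q] by (intro ennreal_mult_divide_eq) auto
  finally show "(\<integral>\<^sup>+x\<in>Q. Mx (\<lambda>y. ennreal (w y) * indicator Q y) x \<partial>M) / ?z \<le> A1_const M \<DD> w" .
qed

end

end

section \<open>The two norm inequalities\<close>

context cz_adjacent begin

definition bound_const :: real where
  "bound_const = sparse_const C\<^sub>0 \<epsilon> A N * (8 * hat_const C\<^sub>0 A * real N)"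

lemma bound_const_pos: "0 < bound_const"
proof -
  obtain \<D> where sys: "\<D> \<in> \<DD>" using systems_nonempty by blast
  interpret cz_main M \<rho> \<kappa> D N \<delta> C\<^sub>0 \<epsilon> A \<DD> K \<eta> C\<^sub>K T \<beta> \<D>
    by (intro cz_main.intro adjacent_axioms cz_op_axioms cz_main_axioms.intro sys)
  show ?thesis unfolding bound_const_def using cS_ge H_ge_1 N_ge_1 by simp
qed

lemma Lp_norm_Ainf_bound:
  assumes f: "in_L2 M f" and w: "Ainf_weight M \<rho> \<DD> w" and p: "1 < p" and q: "q = p / (p - 1)"
    and C: "bound_const \<le> C"
  shows "Lp_norm M p (\<lambda>x. ennreal (w x)) (T f)
    \<le> ennreal (C * p * q) * ennpowr (Ainf_const M \<DD> w) (1 / q) * Lp_norm M p (maximal M \<DD> w) f"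
proof -
  have wt: "weight M \<rho> w" and fin: "Ainf_const M \<DD> w < \<infinity>" using w unfolding Ainf_weight_def by auto
  obtain \<Lambda> where L: "Ainf_const M \<DD> w = ennreal \<Lambda>" "0 \<le> \<Lambda>"
    using fin by (cases "Ainf_const M \<DD> w") auto
  have L1: "1 \<le> \<Lambda>" using Ainf_const_ge_1[OF wt] unfolding L(1) using L(2)
    by (simp add: ennreal_1[symmetric] ennreal_le_iff del: ennreal_1)
  have q0: "0 < q" unfolding q using p by simp
  have C0: "0 < C" using bound_const_pos C by simp
  define I where "I = (\<integral>\<^sup>+x. ennreal (\<bar>f x\<bar> powr p) * maximal M \<DD> w x \<partial>M)"
  show ?thesis
  proof (cases I)
    \<comment> \<open>The right-hand side is infinite: the factors in front of the infinite norm are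
      nonzero.\<close>
    case top
    have "Lp_norm M p (maximal M \<DD> w) f = \<infinity>" using top unfolding Lp_norm_def I_def ennpowr_def by simp
    moreover have "ennreal (C * p * q) * ennpowr (Ainf_const M \<DD> w) (1 / q) \<noteq> 0"
      unfolding L(1) using L1 C0 p q0 by (simp add: ennpowr_ennreal)
    ultimately show ?thesis by (simp add: ennreal_mult_top)
  next
    case (real W)
    have fW: "(\<integral>\<^sup>+x. ennreal (\<bar>f x\<bar> powr p) * Mx (\<lambda>y. ennreal (w y)) x \<partial>M) = ennreal W"
      using real unfolding I_def maximal_weight[OF wt] by simp
    let ?c = "bound_const * p * q"
    have c0: "0 < ?c" using bound_const_pos p q0 by simp
    have "(\<integral>\<^sup>+x. ennreal (\<bar>T f x\<bar> powr p) * ennreal (w x) \<partial>M) \<le> ennreal (?c powr p * \<Lambda> powr (p - 1) * W)"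
      unfolding bound_const_def
      using Ainf_const_bound[OF wt] L1 real(1) unfolding L(1)
      by (intro weighted_bound[OF f weight_measurable[OF wt] weight_pos[OF wt] weight_integral_finite[OF wt] _ _ p q _ fW]) auto
    hence "Lp_norm M p (\<lambda>x. ennreal (w x)) (T f) \<le> ennpowr (ennreal (?c powr p * \<Lambda> powr (p - 1) * W)) (1 / p)"
      unfolding Lp_norm_def using p by (intro ennpowr_mono) auto
    also have "\<dots> = ennreal ((?c powr p * \<Lambda> powr (p - 1) * W) powr (1 / p))"
      using real(1) by (intro ennpowr_ennreal) auto
    also have "(?c powr p * \<Lambda> powr (p - 1) * W) powr (1 / p) = ?c * \<Lambda> powr (1 / q) * W powr (1 / p)"
    proof -
      have e: "(p - 1) * (1 / p) = 1 / q" unfolding q by simp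
      have "(?c powr p * \<Lambda> powr (p - 1) * W) powr (1 / p) = (?c powr p) powr (1 / p) * (\<Lambda> powr (p - 1)) powr (1 / p) * W powr (1 / p)"
        using real(1) by (simp add: powr_mult)
      also have "(?c powr p) powr (1 / p) = ?c" using c0 p by (simp add: powr_powr)
      also have "(\<Lambda> powr (p - 1)) powr (1 / p) = \<Lambda> powr (1 / q)" unfolding powr_powr e ..
      finally show ?thesis .
    qed
    also have "ennreal (?c * \<Lambda> powr (1 / q) * W powr (1 / p)) \<le> ennreal (C * p * q * \<Lambda> powr (1 / q) * W powr (1 / p))"
      using C p q0 by (intro ennreal_leI mult_right_mono) auto
    also have "\<dots> = ennreal (C * p * q) * ennreal (\<Lambda> powr (1 / q)) * ennreal (W powr (1 / p))"
      using C0 p q0 by (simp add: ennreal_mult)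
    also have "\<dots> = ennreal (C * p * q) * ennpowr (Ainf_const M \<DD> w) (1 / q) * Lp_norm M p (maximal M \<DD> w) f"
      unfolding Lp_norm_def I_def[symmetric] L(1) real(2) using L(2) real(1) by (simp add: ennpowr_ennreal)
    finally show ?thesis .
  qed
qed

lemma Lp_norm_A1_bound:
  assumes f: "in_L2 M f" and w: "A1_weight M \<rho> \<DD> w" and p: "1 < p" and q: "q = p / (p - 1)"
    and C: "bound_const \<le> C"
  shows "Lp_norm M p (\<lambda>x. ennreal (w x)) (T f)
    \<le> ennreal (C * p * q) * ennpowr (Ainf_const M \<DD> w) (1 / q) * ennpowr (A1_const M \<DD> w) (1 / p) *
      Lp_norm M p (\<lambda>x. ennreal (w x)) f"
proof -
  note in_L2_measurable[OF f, measurable]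
  have wt: "weight M \<rho> w" and A1: "A1_const M \<DD> w < \<infinity>" using w unfolding A1_weight_def by auto
  note weight_measurable[OF wt, measurable]
  have le: "Ainf_const M \<DD> w \<le> A1_const M \<DD> w" by (rule Ainf_le_A1[OF wt A1])
  hence "Ainf_weight M \<rho> \<DD> w" unfolding Ainf_weight_def using wt A1 by (auto intro: le_less_trans)
  from Lp_norm_Ainf_bound[OF f this p q C]
  have "Lp_norm M p (\<lambda>x. ennreal (w x)) (T f)
    \<le> ennreal (C * p * q) * ennpowr (Ainf_const M \<DD> w) (1 / q) * Lp_norm M p (maximal M \<DD> w) f" .
  also have "Lp_norm M p (maximal M \<DD> w) f \<le> ennpowr (A1_const M \<DD> w) (1 / p) * Lp_norm M p (\<lambda>x. ennreal (w x)) f"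
  proof -
    have "(\<integral>\<^sup>+x. ennreal (\<bar>f x\<bar> powr p) * maximal M \<DD> w x \<partial>M) \<le> (\<integral>\<^sup>+x. A1_const M \<DD> w * (ennreal (\<bar>f x\<bar> powr p) * ennreal (w x)) \<partial>M)"
    proof (rule nn_integral_mono_AE, use Mx_le_A1[OF wt A1] in eventually_elim)
      case (elim x)
      hence "ennreal (\<bar>f x\<bar> powr p) * maximal M \<DD> w x \<le> ennreal (\<bar>f x\<bar> powr p) * (A1_const M \<DD> w * ennreal (w x))"
        unfolding maximal_weight[OF wt] by (rule mult_left_mono) simp
      thus ?case by (simp only: mult.left_commute)
    qed
    also have "\<dots> = A1_const M \<DD> w * (\<integral>\<^sup>+x. ennreal (\<bar>f x\<bar> powr p) * ennreal (w x) \<partial>M)"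
      by (rule nn_integral_cmult) measurable
    finally have "Lp_norm M p (maximal M \<DD> w) f \<le> ennpowr (A1_const M \<DD> w * (\<integral>\<^sup>+x. ennreal (\<bar>f x\<bar> powr p) * ennreal (w x) \<partial>M)) (1 / p)"
      unfolding Lp_norm_def using p by (intro ennpowr_mono) auto
    also have "\<dots> = ennpowr (A1_const M \<DD> w) (1 / p) * Lp_norm M p (\<lambda>x. ennreal (w x)) f"
    proof -
      have "0 < A1_const M \<DD> w" 
        by (rule less_le_trans[OF zero_less_one order_trans[OF Ainf_const_ge_1[OF wt] le]])
      thus ?thesis unfolding Lp_norm_def using A1 p by (intro ennpowr_mult) auto
    qed
    finally show ?thesis .
  qed
  finally show ?thesis by (simp add: mult.assoc mult_left_mono)
qed

end

section \<open>Choice of the constants and conclusion\<close>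

lemma cz_operator_cz_op:
  assumes "hom_space M \<rho> \<kappa> D" "cz_operator M \<rho> T"
  obtains K \<eta> C\<^sub>K \<beta> where "cz_op M \<rho> \<kappa> D K \<eta> C\<^sub>K T \<beta>"
proof -
  interpret hom_space M \<rho> \<kappa> D by fact
  from assms(2) obtain K where bl: "bounded_linear_on_L2 M T" and K: "cz_kernel M \<rho> K"
    and rep: "\<forall>f. in_L2 M f \<longrightarrow> (AE x in M. x \<notin> ess_support M \<rho> f \<longrightarrow> T f x = (\<integral>y. K x y * f y \<partial>M))"
    unfolding cz_operator_def by blast
  from bl have L2: "\<forall>f. in_L2 M f \<longrightarrow> in_L2 M (T f)"
    and lin: "\<forall>f g a b. in_L2 M f \<and> in_L2 M g \<longrightarrow> (AE x in M. T (\<lambda>y. a * f y + b * g y) x = a * T f x + b * T g x)"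
    unfolding bounded_linear_on_L2_def by simp_all
  from bl obtain B where B: "\<forall>f. in_L2 M f \<longrightarrow> sqrt (\<integral>x. (T f x)\<^sup>2 \<partial>M) \<le> B * sqrt (\<integral>x. (f x)\<^sup>2 \<partial>M)"
    unfolding bounded_linear_on_L2_def by blast
  from K obtain \<eta> C where eta: "0 < \<eta>" and k: "\<forall>x\<^sub>0\<in>space M. \<forall>y\<in>space M. x\<^sub>0 \<noteq> y \<longrightarrow>
        \<bar>K x\<^sub>0 y\<bar> \<le> C / measure M (qball M \<rho> x\<^sub>0 (\<rho> x\<^sub>0 y)) \<and>
        (\<forall>x\<in>space M. x \<noteq> y \<and> \<rho> x\<^sub>0 x \<le> \<eta> * \<rho> x\<^sub>0 y \<longrightarrow>
           \<bar>K x y - K x\<^sub>0 y\<bar>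
             \<le> (\<rho> x x\<^sub>0 / \<rho> x\<^sub>0 y) powr \<eta> * (1 / measure M (qball M \<rho> x\<^sub>0 (\<rho> x\<^sub>0 y))) \<and>
           \<bar>K y x - K y x\<^sub>0\<bar>
             \<le> (\<rho> x x\<^sub>0 / \<rho> x\<^sub>0 y) powr \<eta> * (1 / measure M (qball M \<rho> x\<^sub>0 (\<rho> x\<^sub>0 y))))"
    unfolding cz_kernel_def by (elim exE conjE)
  \<comment> \<open>The definitions do not fix the signs of B and C; B^2 and |C| are nonnegative
    substitutes.\<close>
  have "cz_op M \<rho> \<kappa> D K \<eta> \<bar>C\<bar> T (B\<^sup>2)"
  proof (intro cz_op.intro kernel.intro hom_space_axioms kernel_axioms.intro cz_op_axioms.intro)
    fix x y assume xy: "x \<in> space M" "y \<in> space M" "x \<noteq> y"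
    have "\<bar>K x y\<bar> \<le> C / V x (\<rho> x y)" using k xy unfolding V_def by blast
    also have "\<dots> \<le> \<bar>C\<bar> / V x (\<rho> x y)" by (intro divide_right_mono) (auto simp: V_def)
    finally show "\<bar>K x y\<bar> \<le> \<bar>C\<bar> / V x (\<rho> x y)" .
  next
    fix c y x assume *: "c \<in> space M" "y \<in> space M" "x \<in> space M" "c \<noteq> y" "x \<noteq> y" "\<rho> c x \<le> \<eta> * \<rho> c y"
    from bspec[OF bspec[OF k *(1)] *(2)] *
    show "\<bar>K x y - K c y\<bar> \<le> (\<rho> x c / \<rho> c y) powr \<eta> / V c (\<rho> c y)"
      "\<bar>K y x - K y c\<bar> \<le> (\<rho> x c / \<rho> c y) powr \<eta> / V c (\<rho> c y)"
      unfolding V_def by auto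
  next
    fix f assume f: "in_L2 M f"
    have i: "integrable M (\<lambda>x. (T f x)\<^sup>2)" "integrable M (\<lambda>x. (f x)\<^sup>2)"
      using f L2 unfolding in_L2_def by auto
    have p: "0 \<le> (\<integral>x. (T f x)\<^sup>2 \<partial>M)" "0 \<le> (\<integral>x. (f x)\<^sup>2 \<partial>M)" by (simp_all add: integral_nonneg_AE)
    have "(sqrt (\<integral>x. (T f x)\<^sup>2 \<partial>M))\<^sup>2 \<le> (B * sqrt (\<integral>x. (f x)\<^sup>2 \<partial>M))\<^sup>2"
      using B f p by (intro power_mono) auto
    hence "(\<integral>x. (T f x)\<^sup>2 \<partial>M) \<le> B\<^sup>2 * (\<integral>x. (f x)\<^sup>2 \<partial>M)" using p by (simp add: power_mult_distrib)
    hence "ennreal (\<integral>x. (T f x)\<^sup>2 \<partial>M) \<le> ennreal (B\<^sup>2 * (\<integral>x. (f x)\<^sup>2 \<partial>M))" by (rule ennreal_leI)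
    thus "(\<integral>\<^sup>+x. ennreal ((T f x)\<^sup>2) \<partial>M) \<le> ennreal (B\<^sup>2) * (\<integral>\<^sup>+x. ennreal ((f x)\<^sup>2) \<partial>M)"
      using i p by (simp add: nn_integral_eq_integral ennreal_mult)
  qed (use L2 lin rep eta in auto)
  thus thesis by (rule that)
qed

theorem corollary3p2:
  fixes M :: "'a measure" and \<rho> :: "'a \<Rightarrow> 'a \<Rightarrow> real"
    and T :: "('a \<Rightarrow> real) \<Rightarrow> 'a \<Rightarrow> real"
    and N :: nat and \<delta> C\<^sub>0 \<epsilon> A :: real
  assumes "homogeneous_type M \<rho>"
    and "cz_operator M \<rho> T"
  shows "\<exists>C::real. 0 < C \<and>
    (\<forall>\<DD>. adjacent_dyadic_systems M \<rho> N \<delta> C\<^sub>0 \<epsilon> A \<DD> \<longrightarrow>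
      (\<forall>p p' :: real. 1 < p \<and> p' = p / (p - 1) \<longrightarrow>
        (\<forall>f w. in_L2 M f \<longrightarrow>
          (Ainf_weight M \<rho> \<DD> w \<longrightarrow>
             Lp_norm M p (\<lambda>x. ennreal (w x)) (T f)
               \<le> ennreal (C * p * p') * ennpowr (Ainf_const M \<DD> w) (1 / p') *
                 Lp_norm M p (maximal M \<DD> w) f) \<and>
          (A1_weight M \<rho> \<DD> w \<longrightarrow>
             Lp_norm M p (\<lambda>x. ennreal (w x)) (T f)
               \<le> ennreal (C * p * p') * ennpowr (Ainf_const M \<DD> w) (1 / p') *
                 ennpowr (A1_const M \<DD> w) (1 / p) *
                 Lp_norm M p (\<lambda>x. ennreal (w x)) f))))"
proof (cases "space M = {}")
  case True
  hence "Lp_norm M p (\<lambda>x. ennreal (w x)) (T f) = 0" for p f and w :: "'a \<Rightarrow> real"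
    unfolding Lp_norm_def ennpowr_def by (simp add: nn_integral_empty)
  thus ?thesis by (intro exI[of _ 1]) auto
next
  case False
  obtain \<kappa> D where hs: "hom_space M \<rho> \<kappa> D" using homogeneous_type_hom_space[OF assms(1)] .
  obtain K \<eta> C\<^sub>K \<beta> where op: "cz_op M \<rho> \<kappa> D K \<eta> C\<^sub>K T \<beta>" using cz_operator_cz_op[OF hs assms(2)] .
  interpret op: cz_op M \<rho> \<kappa> D K \<eta> C\<^sub>K T \<beta> by fact
  \<comment> \<open>Fixed before \<DD>, p, f and w are given: it involves only the constants of the
    space and the operator and the parameters of the decompositions.\<close>
  define b where "b = op.sparse_const C\<^sub>0 \<epsilon> A N * (8 * op.hat_const C\<^sub>0 A * real N)"
  \<comment> \<open>b is known to be positive only if the parameters admit a family of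
    decompositions; for N = 0, say, it is 0.\<close>
  define C where "C = max 1 b"
  have "(Ainf_weight M \<rho> \<DD> w \<longrightarrow>
             Lp_norm M p (\<lambda>x. ennreal (w x)) (T f)
               \<le> ennreal (C * p * p') * ennpowr (Ainf_const M \<DD> w) (1 / p') *
                 Lp_norm M p (maximal M \<DD> w) f) \<and>
          (A1_weight M \<rho> \<DD> w \<longrightarrow>
             Lp_norm M p (\<lambda>x. ennreal (w x)) (T f)
               \<le> ennreal (C * p * p') * ennpowr (Ainf_const M \<DD> w) (1 / p') *
                 ennpowr (A1_const M \<DD> w) (1 / p) *
                 Lp_norm M p (\<lambda>x. ennreal (w x)) f)"
    if adj: "adjacent_dyadic_systems M \<rho> N \<delta> C\<^sub>0 \<epsilon> A \<DD>" and p: "1 < p" "p' = p / (p - 1)" and f: "in_L2 M f"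
    for \<DD> p p' f w
  proof -
    interpret cz_adjacent M \<rho> \<kappa> D N \<delta> C\<^sub>0 \<epsilon> A \<DD> K \<eta> C\<^sub>K T \<beta>
      by (intro cz_adjacent.intro adjacent.intro hs op adjacent_axioms.intro adj False)
    have "bound_const \<le> C" unfolding bound_const_def C_def b_def by simp
    thus ?thesis using Lp_norm_Ainf_bound[OF f _ p] Lp_norm_A1_bound[OF f _ p] by blast
  qed
  moreover have "0 < C" unfolding C_def by simp
  ultimately show ?thesis by blast
qed

end
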